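(* Let $k$ be a field and let $R$ be an affine almost PI $k$-algebra. Then $R$ has only countably many height 1 prime ideals.
   Context: All algebras are associative with 1. A $k$-algebra is affine if it is finitely generated as a $k$-algebra. PI means satisfying a (nontrivial) polynomial identity over $k$. A $k$-algebra $R$ is almost PI if $R$ is not PI and $R/I$ is PI for every nonzero two-sided ideal $I$ of $R$; such an algebra is prime. Countably many means at most $\aleph_0$. The height of a prime ideal $P$ is the supremum of lengths of strictly descending chains of prime ideals starting at $P$. *)

theory Defs
  imports
    "HOL-Algebra.Algebra"
    "HOL-Library.Countable_Set"
    "HOL-Library.Extended_Nat"
begin

text \<open>
  \<^locale>\<open>algebra\<close> of HOL-Algebra demands a commutative ring; the locale below is its
  noncommutative analogue over a field. The zero algebra is allowed, so that every
  quotient \<open>R/I\<close>, including \<open>I = R\<close>, is again an algebra.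
\<close>

locale assoc_algebra = module K R + K: field K + ring R for K and R (structure) +
  assumes smult_assoc_l:
      "\<lbrakk> c \<in> carrier K; x \<in> carrier R; y \<in> carrier R \<rbrakk> \<Longrightarrow> (c \<odot> x) \<otimes> y = c \<odot> (x \<otimes> y)"
    and smult_assoc_r:
      "\<lbrakk> c \<in> carrier K; x \<in> carrier R; y \<in> carrier R \<rbrakk> \<Longrightarrow> x \<otimes> (c \<odot> y) = c \<odot> (x \<otimes> y)"

definition unital_subalgebra ::
    "('k, 'c) ring_scheme \<Rightarrow> ('k, 'a, 'b) module_scheme \<Rightarrow> 'a set \<Rightarrow> bool" where
  "unital_subalgebra K R A \<longleftrightarrow>
     subring A R \<and> (\<forall>c\<in>carrier K. \<forall>x\<in>A. c \<odot>\<^bsub>R\<^esub> x \<in> A)"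

definition generated_subalgebra ::
    "('k, 'c) ring_scheme \<Rightarrow> ('k, 'a, 'b) module_scheme \<Rightarrow> 'a set \<Rightarrow> 'a set" where
  "generated_subalgebra K R S = \<Inter>{A. unital_subalgebra K R A \<and> S \<subseteq> A}"

definition affine_algebra ::
    "('k, 'c) ring_scheme \<Rightarrow> ('k, 'a, 'b) module_scheme \<Rightarrow> bool" where
  "affine_algebra K R \<longleftrightarrow>
     (\<exists>S. finite S \<and> S \<subseteq> carrier R \<and> generated_subalgebra K R S = carrier R)"

text \<open>
  An element of the free algebra on countably many noncommuting indeterminates
  \<open>X\<^sub>0, X\<^sub>1, \<dots>\<close> is its coefficient function: the word \<open>[i, j, \<dots>]\<close> stands for the monomial
  \<open>X\<^sub>i X\<^sub>j \<dots>\<close>, and \<open>[]\<close> for \<open>1\<close>.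
\<close>

definition nc_polys :: "('k, 'c) ring_scheme \<Rightarrow> (nat list \<Rightarrow> 'k) set" where
  "nc_polys K = {f. range f \<subseteq> carrier K \<and> finite {w. f w \<noteq> \<zero>\<^bsub>K\<^esub>}}"

definition word_eval :: "('a, 'b) ring_scheme \<Rightarrow> (nat \<Rightarrow> 'a) \<Rightarrow> nat list \<Rightarrow> 'a" where
  "word_eval R r w = foldr (\<otimes>\<^bsub>R\<^esub>) (map r w) \<one>\<^bsub>R\<^esub>"

definition nc_eval ::
    "('k, 'c) ring_scheme \<Rightarrow> ('k, 'a, 'b) module_scheme \<Rightarrow> (nat \<Rightarrow> 'a) \<Rightarrow>
      (nat list \<Rightarrow> 'k) \<Rightarrow> 'a" where
  "nc_eval K R r f = (\<Oplus>\<^bsub>R\<^esub>w\<in>{w. f w \<noteq> \<zero>\<^bsub>K\<^esub>}. f w \<odot>\<^bsub>R\<^esub> word_eval R r w)"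

definition PI_algebra ::
    "('k, 'c) ring_scheme \<Rightarrow> ('k, 'a, 'b) module_scheme \<Rightarrow> bool" where
  "PI_algebra K R \<longleftrightarrow>
     (\<exists>f\<in>nc_polys K. f \<noteq> (\<lambda>w. \<zero>\<^bsub>K\<^esub>) \<and>
        (\<forall>r. range r \<subseteq> carrier R \<longrightarrow> nc_eval K R r f = \<zero>\<^bsub>R\<^esub>))"

text \<open>\<open>R Quot I\<close> forgets the scalars; this restores them.\<close>

definition alg_quot :: "('k, 'a, 'b) module_scheme \<Rightarrow> 'a set \<Rightarrow> ('k, 'a set) module" where
  "alg_quot R I =
     ring.extend (R Quot I)
       (module.fields (\<lambda>c A. \<Union>x\<in>A. I +>\<^bsub>R\<^esub> (c \<odot>\<^bsub>R\<^esub> x)))"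

definition almost_PI ::
    "('k, 'c) ring_scheme \<Rightarrow> ('k, 'a, 'b) module_scheme \<Rightarrow> bool" where
  "almost_PI K R \<longleftrightarrow>
     \<not> PI_algebra K R \<and>
     (\<forall>I. ideal I R \<and> I \<noteq> {\<zero>\<^bsub>R\<^esub>} \<longrightarrow> PI_algebra K (alg_quot R I))"

text \<open>
  The library's \<^locale>\<open>primeideal\<close> is elementwise and restricted to commutative rings;
  this is the notion for noncommutative rings.
\<close>

definition nc_prime_ideal :: "('a, 'b) ring_scheme \<Rightarrow> 'a set \<Rightarrow> bool" where
  "nc_prime_ideal R P \<longleftrightarrow>
     ideal P R \<and> P \<noteq> carrier R \<and>
     (\<forall>I J. ideal I R \<and> ideal J R \<and> I \<cdot>\<^bsub>R\<^esub> J \<subseteq> P \<longrightarrow> I \<subseteq> P \<or> J \<subseteq> P)"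

definition descending_prime_chain ::
    "('a, 'b) ring_scheme \<Rightarrow> 'a set \<Rightarrow> nat \<Rightarrow> (nat \<Rightarrow> 'a set) \<Rightarrow> bool" where
  "descending_prime_chain R P n Q \<longleftrightarrow>
     Q 0 = P \<and> (\<forall>i\<le>n. nc_prime_ideal R (Q i)) \<and> (\<forall>i<n. Q (Suc i) \<subset> Q i)"

definition prime_height :: "('a, 'b) ring_scheme \<Rightarrow> 'a set \<Rightarrow> enat" where
  "prime_height R P = Sup {enat n | n. \<exists>Q. descending_prime_chain R P n Q}"

text \<open>\<^const>\<open>alg_quot\<close> is an algebra whose scalar action is the induced one.\<close>

lemma (in assoc_algebra) ideal_smult_closed:
  assumes "ideal I R" "c \<in> carrier K" "x \<in> I"
  shows "c \<odot> x \<in> I"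
proof -
  interpret I: ideal I R by fact
  have x: "x \<in> carrier R" using assms by auto
  have "(c \<odot> \<one>) \<otimes> x = c \<odot> x"
    using smult_assoc_l[of c "\<one>" x] assms x by simp
  moreover have "(c \<odot> \<one>) \<otimes> x \<in> I"
    using assms by (intro I.I_l_closed) auto
  ultimately show ?thesis by simp
qed

lemma (in assoc_algebra) alg_quot_smult:
  assumes I: "ideal I R" and c: "c \<in> carrier K" and x: "x \<in> carrier R"
  shows "c \<odot>\<^bsub>alg_quot R I\<^esub> (I +> x) = I +> (c \<odot> x)"
proof -
  interpret I: ideal I R by fact
  have "I +> (c \<odot> y) = I +> (c \<odot> x)" if yI: "y \<in> I +> x" for y
  proof -
    obtain h where h: "h \<in> I" and y: "y = h \<oplus> x"
      using yI by (auto simp: a_r_coset_def')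
    have "c \<odot> y = (c \<odot> h) \<oplus> (c \<odot> x)"
      using h y c x smult_r_distr by auto
    then have "c \<odot> y \<in> I +> (c \<odot> x)"
      using ideal_smult_closed[OF I c h] by (auto simp: a_r_coset_def')
    from a_repr_independence[OF this smult_closed[OF c x] I.a_subgroup]
    show ?thesis by (rule sym)
  qed
  moreover have "x \<in> I +> x" using x by (rule I.a_rcos_self)
  ultimately have "(\<Union>y\<in>I +> x. I +> (c \<odot> y)) = I +> (c \<odot> x)"
    by blast
  then show ?thesis by (simp add: alg_quot_def ring.defs module.defs)
qed

lemma (in assoc_algebra) assoc_algebra_alg_quot:
  assumes I: "ideal I R"
  shows "assoc_algebra K (alg_quot R I)"
proof -
  interpret I: ideal I R by fact
  interpret RI: ring "R Quot I" by (rule I.quotient_is_ring)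
  have "ring (alg_quot R I)"
  proof (intro ringI abelian_groupI monoidI)
    show "\<exists>y\<in>carrier (alg_quot R I). y \<oplus>\<^bsub>alg_quot R I\<^esub> x = \<zero>\<^bsub>alg_quot R I\<^esub>"
      if "x \<in> carrier (alg_quot R I)" for x
      using that RI.l_neg by (auto simp: alg_quot_def ring.defs module.defs)
  qed (simp_all add: alg_quot_def ring.defs module.defs RI.a_ac RI.m_assoc
        RI.l_distr RI.r_distr)
  then interpret Q: ring "alg_quot R I" .
  have carr: "carrier (alg_quot R I) = a_rcosets I"
    by (simp add: alg_quot_def ring.defs module.defs FactRing_def)
  have rep: "\<exists>x\<in>carrier R. A = I +> x" if "A \<in> carrier (alg_quot R I)" for A
    using that unfolding carr A_RCOSETS_def' by auto
  have mem: "I +> x \<in> carrier (alg_quot R I)" if "x \<in> carrier R" for x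
    using that unfolding carr A_RCOSETS_def' by auto
  have add: "(I +> x) \<oplus>\<^bsub>alg_quot R I\<^esub> (I +> y) = I +> (x \<oplus> y)"
    if "x \<in> carrier R" "y \<in> carrier R" for x y
    using that by (simp add: alg_quot_def ring.defs module.defs FactRing_def I.a_rcos_sum)
  have mult: "(I +> x) \<otimes>\<^bsub>alg_quot R I\<^esub> (I +> y) = I +> (x \<otimes> y)"
    if "x \<in> carrier R" "y \<in> carrier R" for x y
    using that by (simp add: alg_quot_def ring.defs module.defs FactRing_def I.rcoset_mult_add)
  note sims = alg_quot_smult[OF I] add mult mem
  show ?thesis
  proof unfold_locales
    show "c \<odot>\<^bsub>alg_quot R I\<^esub> A \<in> carrier (alg_quot R I)"
      if "c \<in> carrier K" and A: "A \<in> carrier (alg_quot R I)" for c A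
      using rep[OF A] that(1)
      by (elim bexE) (simp add: sims smult_closed)
    show "(c \<oplus>\<^bsub>K\<^esub> d) \<odot>\<^bsub>alg_quot R I\<^esub> A = c \<odot>\<^bsub>alg_quot R I\<^esub> A \<oplus>\<^bsub>alg_quot R I\<^esub> d \<odot>\<^bsub>alg_quot R I\<^esub> A"
      if "c \<in> carrier K" and "d \<in> carrier K" and A: "A \<in> carrier (alg_quot R I)" for c d A
      using rep[OF A] that(1,2)
      by (elim bexE) (simp add: sims smult_l_distr)
    show "c \<odot>\<^bsub>alg_quot R I\<^esub> (A \<oplus>\<^bsub>alg_quot R I\<^esub> B) = c \<odot>\<^bsub>alg_quot R I\<^esub> A \<oplus>\<^bsub>alg_quot R I\<^esub> c \<odot>\<^bsub>alg_quot R I\<^esub> B"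
      if "c \<in> carrier K" and A: "A \<in> carrier (alg_quot R I)" and B: "B \<in> carrier (alg_quot R I)" for c A B
      using rep[OF A] rep[OF B] that(1)
      by (elim bexE) (simp add: sims smult_r_distr)
    show "(c \<otimes>\<^bsub>K\<^esub> d) \<odot>\<^bsub>alg_quot R I\<^esub> A = c \<odot>\<^bsub>alg_quot R I\<^esub> (d \<odot>\<^bsub>alg_quot R I\<^esub> A)"
      if "c \<in> carrier K" and "d \<in> carrier K" and A: "A \<in> carrier (alg_quot R I)" for c d A
      using rep[OF A] that(1,2)
      by (elim bexE) (simp add: sims smult_assoc1)
    show "\<one>\<^bsub>K\<^esub> \<odot>\<^bsub>alg_quot R I\<^esub> A = A"
      if A: "A \<in> carrier (alg_quot R I)" for A
      using rep[OF A] that(1)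
      by (elim bexE) (simp add: sims)
    show "(c \<odot>\<^bsub>alg_quot R I\<^esub> A) \<otimes>\<^bsub>alg_quot R I\<^esub> B = c \<odot>\<^bsub>alg_quot R I\<^esub> (A \<otimes>\<^bsub>alg_quot R I\<^esub> B)"
      if "c \<in> carrier K" and A: "A \<in> carrier (alg_quot R I)" and B: "B \<in> carrier (alg_quot R I)" for c A B
      using rep[OF A] rep[OF B] that(1)
      by (elim bexE) (simp add: sims smult_assoc_l)
    show "A \<otimes>\<^bsub>alg_quot R I\<^esub> (c \<odot>\<^bsub>alg_quot R I\<^esub> B) = c \<odot>\<^bsub>alg_quot R I\<^esub> (A \<otimes>\<^bsub>alg_quot R I\<^esub> B)"
      if "c \<in> carrier K" and A: "A \<in> carrier (alg_quot R I)" and B: "B \<in> carrier (alg_quot R I)" for c A B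
      using rep[OF A] rep[OF B] that(1)
      by (elim bexE) (simp add: sims smult_assoc_r)
  qed
qed

end

theory Submission
  imports Defs "HOL-Combinatorics.Multiset_Permutations"
begin

text \<open>
  Let \<open>P\<close> be a prime with \<open>R/P\<close> PI of degree \<open>d\<close>. Since \<open>R/P\<close> has no nil right ideals, Amitsur's
  trick applies: if \<open>b\<close> is not nilpotent modulo \<open>P\<close>, it acts nontrivially on a simple
  \<open>R[t]\<close>-module \<open>V\<close> killed by \<open>P\<close> in which \<open>b t\<close> fixes a nonzero vector. Adjoining to \<open>R[t]\<close> a
  maximal commuting set of its endomorphisms of \<open>V\<close> preserves multilinear identities, so
  Kaplansky's argument produces fewer than \<open>d\<close> diagonal matrix units, whose corner is
  commutative. Hence \<open>P\<close> is an intersection of kernels of matrix representations of size less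
  than \<open>d\<close> over commutative rings.

  For fixed \<open>d\<close> these kernels form a Noetherian space: \<open>R\<close> is affine, so all matrix entries lie in
  one affine, hence Noetherian, commutative algebra. Therefore there are finitely many primes
  \<open>N\<^sub>1, \<dots>, N\<^sub>s\<close>, themselves intersections of such kernels, such that every prime of this kind
  contains one of them. Since standard polynomials vanish modulo every \<open>N\<^sub>i\<close> and \<open>R\<close> is not PI, all
  \<open>N\<^sub>i\<close> are nonzero, so a height one prime is one of the \<open>N\<^sub>i\<close> for some \<open>d\<close>.
\<close>

section \<open>Nil right ideals modulo a prime\<close>

text \<open>Two obstacles shape the proof. A prime PI ring can have a nonzero Jacobson radical, as
  formal power series show, so simple modules of \<open>R/P\<close> give no immediate separation of
  its elements. After adjoining a central variable \<open>t\<close>, an element \<open>b\<close>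
  that is not nilpotent modulo \<open>P\<close> leaves \<open>1 - b t\<close> without a left inverse
  modulo \<open>P\<close>, and this yields a simple module on which \<open>b\<close> is nonzero.
  Secondly, the degree \<open>d\<close> of an identity of \<open>R/P\<close> depends on
  \<open>P\<close>, with no common bound for all height one primes in sight: finiteness is obtained
  for one \<open>d\<close> at a time, and the union over \<open>d\<close> is the origin of
  "countable".

  The Noetherian property for a fixed size comes from bundling all representations of that size into
  one, over the product of their commutative rings.

  The degree \<open>d * d\<close> of the standard polynomial is crude but asks only for the
  pigeonhole principle: matrices of size \<open>n < d\<close> are spanned by \<open>n * n\<close>
  matrix units. The polynomial depends on \<open>d\<close> alone, so it still vanishes modulo an
  intersection of kernels. Finally \<open>0\<close> is itself prime, so a nonzero prime strictly
  inside \<open>P\<close> forces height at least two.\<close>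

lemma word_eval_Nil [simp]: "word_eval R r [] = \<one>\<^bsub>R\<^esub>"
  and word_eval_Cons [simp]: "word_eval R r (i # w) = r i \<otimes>\<^bsub>R\<^esub> word_eval R r w"
  by (simp_all add: word_eval_def)

lemma word_eval_cong: "(\<And>i. i \<in> set w \<Longrightarrow> r i = s i) \<Longrightarrow> word_eval R r w = word_eval R s w"
  by (induction w) auto

lemma word_eval_map: "word_eval R r (map f w) = word_eval R (\<lambda>i. r (f i)) w"
  by (induction w) auto

lemma permutations_of_setE:
  assumes "w \<in> permutations_of_set S" "S \<noteq> {}"
  obtains i u where "w = i # u" "i \<in> S" "u \<in> permutations_of_set (S - {i})"
  using assms by (auto simp: permutations_of_set_nonempty)

lemma (in additive_subgroup) finsum_mem:
  assumes "ring G" "\<And>x. x \<in> A \<Longrightarrow> f x \<in> H"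
  shows "finsum G f A \<in> H"
proof -
  interpret ring G by fact
  show ?thesis using assms(2)
  proof (induction A rule: infinite_finite_induct)
    case (insert x F)
    then have "f \<in> F \<rightarrow> carrier G" "f x \<in> carrier G" using a_subset by auto
    with insert show ?case by simp
  qed auto
qed

text \<open>Coefficients are ring elements, not scalars, so that one notion serves \<open>R\<close>,
  rings of operators, and the coefficients \<open>c (i # u)\<close> left over when a first variable
  is split off.\<close>

definition multilin ::
    "('a, 'b) ring_scheme \<Rightarrow> nat set \<Rightarrow> (nat list \<Rightarrow> 'a) \<Rightarrow> (nat \<Rightarrow> 'a) \<Rightarrow> 'a" where
  "multilin R S c r = (\<Oplus>\<^bsub>R\<^esub>w\<in>permutations_of_set S. c w \<otimes>\<^bsub>R\<^esub> word_eval R r w)"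

definition center :: "('a, 'b) ring_scheme \<Rightarrow> 'a set" where
  "center R = {z \<in> carrier R. \<forall>x\<in>carrier R. z \<otimes>\<^bsub>R\<^esub> x = x \<otimes>\<^bsub>R\<^esub> z}"

lemma centerD:
  assumes "z \<in> center R"
  shows "z \<in> carrier R" "x \<in> carrier R \<Longrightarrow> z \<otimes>\<^bsub>R\<^esub> x = x \<otimes>\<^bsub>R\<^esub> z"
  using assms by (auto simp: center_def)

context ring begin

lemma word_eval_closed [simp, intro]:
  "(\<And>i. i \<in> set w \<Longrightarrow> r i \<in> carrier R) \<Longrightarrow> word_eval R r w \<in> carrier R"
  by (induction w) auto

lemma word_eval_append:
  assumes "\<And>i. i \<in> set (v @ w) \<Longrightarrow> r i \<in> carrier R"
  shows "word_eval R r (v @ w) = word_eval R r v \<otimes> word_eval R r w"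
  using assms
proof (induction v)
  case (Cons i v)
  then have "word_eval R r v \<in> carrier R" "word_eval R r w \<in> carrier R" "r i \<in> carrier R"
    by auto
  with Cons show ?case by (simp add: m_assoc)
qed auto

text \<open>Instead of the ideals generated by \<open>a\<close> and \<open>b\<close>, the proof uses
  sets that are two-sided ideals almost by definition: \<open>I\<close> consists of the
  \<open>x\<close> with \<open>x R b\<close> inside \<open>P\<close>, and \<open>J\<close> of the
  \<open>y\<close> with \<open>I R y\<close> inside \<open>P\<close>. They contain \<open>a\<close>
  and \<open>b\<close>, and their product lies in \<open>P\<close>.\<close>

lemma prime_ideal_elementwise:
  assumes P: "nc_prime_ideal R P" and ab: "a \<in> carrier R" "b \<in> carrier R"
    and arb: "\<And>r. r \<in> carrier R \<Longrightarrow> a \<otimes> r \<otimes> b \<in> P"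
  shows "a \<in> P \<or> b \<in> P"
proof -
  have idl: "ideal P R" using P by (simp add: nc_prime_ideal_def)
  interpret P: ideal P R by fact
  define I where "I = {x \<in> carrier R. \<forall>r\<in>carrier R. x \<otimes> r \<otimes> b \<in> P}"
  define J where "J = {y \<in> carrier R. \<forall>x\<in>I. \<forall>r\<in>carrier R. x \<otimes> r \<otimes> y \<in> P}"
  have I: "ideal I R"
  proof (rule idealI[OF ring_axioms])
    show "subgroup I (add_monoid R)"
    proof (rule group.subgroupI)
      show "group (add_monoid R)" by (rule add.is_group)
      show "I \<noteq> {}" using ab by (auto simp: I_def intro!: exI[of _ "\<zero>"])
      show "inv\<^bsub>add_monoid R\<^esub> x \<in> I" if "x \<in> I" for x
        using that ab unfolding I_def a_inv_def[symmetric]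
        by (auto simp: l_minus)
    qed (use ab in \<open>auto simp: I_def l_distr\<close>)
    show "x \<otimes> y \<in> I" if "y \<in> I" "x \<in> carrier R" for x y
    proof -
      have "x \<otimes> y \<otimes> r \<otimes> b \<in> P" if r: "r \<in> carrier R" for r
      proof -
        have "x \<otimes> y \<otimes> r \<otimes> b = x \<otimes> (y \<otimes> r \<otimes> b)"
          using \<open>y \<in> I\<close> \<open>x \<in> carrier R\<close> r ab by (simp add: I_def m_assoc)
        then show ?thesis
          using \<open>y \<in> I\<close> \<open>x \<in> carrier R\<close> r by (simp add: I_def P.I_l_closed)
      qed
      then show ?thesis using that by (auto simp: I_def)
    qed
    show "y \<otimes> x \<in> I" if "y \<in> I" "x \<in> carrier R" for x y
    proof -
      have "y \<otimes> x \<otimes> r \<otimes> b \<in> P" if "r \<in> carrier R" for r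
        using \<open>y \<in> I\<close> \<open>x \<in> carrier R\<close> that ab m_assoc[of y x r] by (auto simp: I_def)
      then show ?thesis using that by (auto simp: I_def)
    qed
  qed
  then interpret I: ideal I R .
  have J: "ideal J R"
  proof (rule idealI[OF ring_axioms])
    show "subgroup J (add_monoid R)"
    proof (rule group.subgroupI)
      show "group (add_monoid R)" by (rule add.is_group)
      show "J \<noteq> {}" by (auto simp: J_def intro!: exI[of _ "\<zero>"])
      show "inv\<^bsub>add_monoid R\<^esub> x \<in> J" if "x \<in> J" for x
        using that unfolding J_def a_inv_def[symmetric]
        by (auto simp: r_minus)
    qed (auto simp: J_def r_distr)
    show "y \<otimes> x \<in> J" if "y \<in> J" "x \<in> carrier R" for x y
    proof -
      have "z \<otimes> r \<otimes> (y \<otimes> x) \<in> P" if "z \<in> I" "r \<in> carrier R" for z r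
      proof -
        have "z \<otimes> r \<otimes> (y \<otimes> x) = z \<otimes> r \<otimes> y \<otimes> x"
          using that \<open>y \<in> J\<close> \<open>x \<in> carrier R\<close> by (intro m_assoc[symmetric]) (auto simp: J_def)
        then show ?thesis using that \<open>y \<in> J\<close> \<open>x \<in> carrier R\<close>
          by (simp add: J_def P.I_r_closed)
      qed
      then show ?thesis using that by (auto simp: J_def)
    qed
    show "x \<otimes> y \<in> J" if "y \<in> J" "x \<in> carrier R" for x y
    proof -
      have "z \<otimes> r \<otimes> (x \<otimes> y) \<in> P" if "z \<in> I" "r \<in> carrier R" for z r
      proof -
        have "z \<otimes> r \<otimes> (x \<otimes> y) = z \<otimes> (r \<otimes> x) \<otimes> y"
          using that \<open>y \<in> J\<close> \<open>x \<in> carrier R\<close> I.a_subset by (auto simp: J_def m_assoc)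
        then show ?thesis using that \<open>y \<in> J\<close> \<open>x \<in> carrier R\<close> by (auto simp: J_def)
      qed
      then show ?thesis using that by (auto simp: J_def)
    qed
  qed
  have "I \<cdot> J \<subseteq> P"
  proof
    fix z assume "z \<in> I \<cdot> J"
    then show "z \<in> P"
    proof (induction rule: ideal_prod.induct)
      case (prod i j)
      then have "i \<otimes> \<one> \<otimes> j \<in> P" by (simp add: J_def del: r_one)
      moreover have "i \<in> carrier R" using prod I.a_subset by auto
      ultimately show ?case by simp
    qed auto
  qed
  with P I J have "I \<subseteq> P \<or> J \<subseteq> P" unfolding nc_prime_ideal_def by blast
  moreover have "a \<in> I" unfolding I_def using ab arb by blast
  moreover have "b \<in> J" unfolding J_def I_def using ab by blast
  ultimately show ?thesis by blast
qed

text \<open>Isolates the variable that will take a value in \<open>a R\<close> while the others take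
  values in \<open>b R\<close>. Centrality of the coefficients is what moves \<open>r i\<close> in
  front of \<open>c (i # u)\<close>.\<close>

lemma multilin_split_first:
  assumes S: "finite S" "i \<in> S" and c: "\<And>w. c w \<in> center R"
    and r: "\<And>j. j \<in> S \<Longrightarrow> r j \<in> carrier R"
  shows "multilin R S c r =
     r i \<otimes> multilin R (S - {i}) (\<lambda>u. c (i # u)) r \<oplus>
     (\<Oplus>w\<in>permutations_of_set S - (#) i ` permutations_of_set (S - {i}). c w \<otimes> word_eval R r w)"
proof -
  let ?X = "(#) i ` permutations_of_set (S - {i})"
  have cc: "c w \<in> carrier R" for w by (rule centerD(1)[OF c])
  have wc: "word_eval R r w \<in> carrier R" if "w \<in> permutations_of_set S" for w
    using that r by (auto simp: permutations_of_set_def)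
  have wc': "word_eval R r w \<in> carrier R" if "w \<in> permutations_of_set (S - {i})" for w
    using that r by (auto simp: permutations_of_set_def)
  have sub: "?X \<subseteq> permutations_of_set S"
  proof (rule image_subsetI)
    fix u assume "u \<in> permutations_of_set (S - {i})"
    then have "set u = S - {i}" "distinct u" by (simp_all add: permutations_of_set_def)
    with S(2) show "i # u \<in> permutations_of_set S"
      by (simp add: permutations_of_set_def insert_absorb)
  qed
  have "multilin R S c r = (\<Oplus>w\<in>?X \<union> (permutations_of_set S - ?X). c w \<otimes> word_eval R r w)"
    using sub by (auto simp: multilin_def intro!: arg_cong[where f = "finsum R _"])
  also have "\<dots> = (\<Oplus>w\<in>?X. c w \<otimes> word_eval R r w) \<oplus> (\<Oplus>w\<in>permutations_of_set S - ?X. c w \<otimes> word_eval R r w)"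
    using S sub cc wc by (intro finsum_Un_disjoint) auto
  also have "(\<Oplus>w\<in>?X. c w \<otimes> word_eval R r w) = (\<Oplus>u\<in>permutations_of_set (S - {i}). c (i # u) \<otimes> word_eval R r (i # u))"
    using sub cc wc by (intro finsum_reindex) auto
  also have "\<dots> = (\<Oplus>u\<in>permutations_of_set (S - {i}). r i \<otimes> (c (i # u) \<otimes> word_eval R r u))"
  proof (intro finsum_cong' refl)
    fix u assume u: "u \<in> permutations_of_set (S - {i})"
    have "c (i # u) \<otimes> word_eval R r (i # u) = c (i # u) \<otimes> r i \<otimes> word_eval R r u"
      using wc'[OF u] cc r S by (simp add: m_assoc)
    also have "c (i # u) \<otimes> r i = r i \<otimes> c (i # u)"
      by (intro centerD(2)[OF c] r S(2))
    finally show "c (i # u) \<otimes> word_eval R r (i # u) = r i \<otimes> (c (i # u) \<otimes> word_eval R r u)"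
      using wc'[OF u] cc r S by (simp add: m_assoc)
  qed (use wc' cc r S in auto)
  also have "\<dots> = r i \<otimes> multilin R (S - {i}) (\<lambda>u. c (i # u)) r"
    unfolding multilin_def using S wc' cc r by (intro finsum_rdistr[symmetric]) auto
  finally show ?thesis .
qed

lemma multilin_closed:
  assumes "\<And>w. c w \<in> carrier R" "\<And>j. j \<in> S \<Longrightarrow> r j \<in> carrier R"
  shows "multilin R S c r \<in> carrier R"
  unfolding multilin_def
proof (intro finsum_closed Pi_I m_closed assms(1) word_eval_closed assms(2))
  show "i \<in> S" if "w \<in> permutations_of_set S" "i \<in> set w" for w i
    using that by (auto simp: permutations_of_set_def)
qed

text \<open>Substituting multiples of an element \<open>b\<close> with \<open>a' b \<in> P\<close> for all variables except one
  kills, after multiplication by \<open>a'\<close>, every monomial not beginning with that variable; this lowers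
  the degree of an identity on a nil right ideal.\<close>

lemma prime_PI_nil_right_ideal:
  assumes P: "nc_prime_ideal R P"
    and "finite S" and "\<And>w. c w \<in> center R" and "w \<in> permutations_of_set S" "c w \<notin> P"
    and "a \<in> carrier R" "a \<notin> P"
    and "\<And>r. (\<And>i. i \<in> S \<Longrightarrow> \<exists>x\<in>carrier R. r i = a \<otimes> x) \<Longrightarrow> multilin R S c r \<in> P"
  shows "\<exists>x\<in>carrier R. \<forall>m::nat. (a \<otimes> x) [^] m \<notin> P"
  using assms(2-)
proof (induction "card S" arbitrary: S c w a)
  case 0
  have cc: "c w \<in> carrier R" for w by (rule centerD(1)[OF 0(3)])
  from 0 have "S = {}" by simp
  with 0 have "multilin R {} c (\<lambda>_. a) \<in> P" by auto
  then have "c [] \<in> P" using cc by (simp add: multilin_def)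
  with 0 \<open>S = {}\<close> show ?case by simp
next
  case (Suc n)
  interpret P: ideal P R using P by (simp add: nc_prime_ideal_def)
  show ?case
  proof (rule ccontr)
    assume "\<not> ?thesis"
    then have nil: "\<exists>m::nat. (a \<otimes> x) [^] m \<in> P" if "x \<in> carrier R" for x using that by auto
    have a: "a \<in> carrier R" by fact
    obtain z where z: "z \<in> carrier R" "a \<otimes> z \<otimes> a \<notin> P"
      using prime_ideal_elementwise[OF P a a] Suc.prems by blast
    let ?y = "a \<otimes> z"
    have y: "?y \<in> carrier R" using a z by simp
    \<comment> \<open>\<open>y = a z\<close> is nilpotent modulo \<open>P\<close>, so such an
      exponent exists; it is at least 2 because neither \<open>a\<close> nor \<open>a z a\<close>
      lies in \<open>P\<close>.\<close>
    define k where "k = (LEAST m::nat. ?y [^] m \<otimes> a \<in> P)"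
    obtain m :: nat where "?y [^] m \<in> P" using nil z by blast
    then have "?y [^] m \<otimes> a \<in> P" using a by (intro P.I_r_closed)
    then have k: "?y [^] k \<otimes> a \<in> P" unfolding k_def by (rule LeastI)
    have least: "?y [^] m \<otimes> a \<notin> P" if "m < k" for m
      using not_less_Least that unfolding k_def by blast
    have "k \<noteq> 0"
    proof
      assume "k = 0"
      with k a Suc.prems(6) show False by simp
    qed
    moreover have "k \<noteq> 1"
    proof
      assume "k = 1"
      with k y z(2) show False by simp
    qed
    ultimately have k2: "k \<ge> 2" by linarith
    \<comment> \<open>\<open>b\<close> is outside \<open>P\<close> by minimality of
      \<open>k\<close>, whereas \<open>a' b\<close> is \<open>y ^ (2 k - 2) a\<close> with
      \<open>2 k - 2\<close> at least \<open>k\<close>, so it falls into \<open>P\<close>. Moreover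
      \<open>b\<close> lies in \<open>a R\<close>, so multiples of \<open>b\<close> are admissible
      values.\<close>
    define a' where "a' = ?y [^] (k - 1)"
    define b where "b = a' \<otimes> a"
    have a': "a' \<in> carrier R" and b: "b \<in> carrier R" using y a by (auto simp: a'_def b_def)
    have bP: "b \<notin> P" using least[of "k - 1"] k2 by (simp add: b_def a'_def)
    have "a' \<otimes> b = ?y [^] (k - 1 + (k - 1)) \<otimes> a"
      using y a nat_pow_mult[OF y, of "k-1" "k-1"]
      by (simp add: b_def a'_def m_assoc[symmetric])
    also have "k - 1 + (k - 1) = (k - 2) + k" using k2 by simp
    also have "?y [^] \<dots> \<otimes> a = ?y [^] (k - 2) \<otimes> (?y [^] k \<otimes> a)"
      using y a nat_pow_mult[OF y, of "k-2" k] by (simp add: m_assoc[symmetric])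
    also have "\<dots> \<in> P" using k y by (intro P.I_l_closed[of "?y [^] k \<otimes> a"]) auto
    finally have a'b: "a' \<otimes> b \<in> P" .
    obtain s where s: "s \<in> carrier R" "b = a \<otimes> s"
    proof -
      have "?y [^] (k - 1) = ?y \<otimes> ?y [^] (k - 2)"
        using k2 y nat_pow_mult[OF y, of 1 "k-2"] by (simp add: numeral_2_eq_2 Suc_diff_Suc)
      then have "b = a \<otimes> (z \<otimes> ?y [^] (k - 2) \<otimes> a)"
        using a z y by (simp add: b_def a'_def m_assoc)
      then show ?thesis by (rule that[rotated]) (use a z in simp)
    qed
    from Suc.hyps have "S \<noteq> {}" by auto
    then obtain i u where w: "w = i # u" "i \<in> S" "u \<in> permutations_of_set (S - {i})"
      using permutations_of_setE[OF Suc.prems(3)] by blast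
    have cc: "c w \<in> carrier R" for w by (rule centerD(1)[OF Suc.prems(2)])
    have "\<exists>x\<in>carrier R. \<forall>m::nat. (b \<otimes> x) [^] m \<notin> P"
    proof (rule Suc.hyps(1)[of "S - {i}" "\<lambda>u. c (i # u)" u b])
      show "n = card (S - {i})" using Suc.hyps(2) Suc.prems(1) w(2) by simp
      fix r assume r: "\<And>j. j \<in> S - {i} \<Longrightarrow> \<exists>x\<in>carrier R. r j = b \<otimes> x"
      let ?g = "multilin R (S - {i}) (\<lambda>u. c (i # u)) r"
      have rc: "r j \<in> carrier R" if "j \<in> S - {i}" for j using r[OF that] b by auto
      have g: "?g \<in> carrier R" by (intro multilin_closed cc rc)
      have "b \<otimes> x \<otimes> ?g \<in> P" if x: "x \<in> carrier R" for x
      proof -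
        let ?r = "r(i := a \<otimes> x)"
        have g': "multilin R (S - {i}) (\<lambda>u. c (i # u)) ?r = ?g"
          unfolding multilin_def using rc cc
          by (intro finsum_cong')
            (auto intro!: m_closed word_eval_closed arg_cong2[where f = "(\<otimes>)"] word_eval_cong
                  simp: permutations_of_set_def)
        have rc': "?r j \<in> carrier R" if "j \<in> S" for j using that rc a x by auto
        let ?X = "permutations_of_set S - (#) i ` permutations_of_set (S - {i})"
        let ?h = "(\<Oplus>w\<in>?X. c w \<otimes> word_eval R ?r w)"
        have wc: "word_eval R ?r w \<in> carrier R" if "w \<in> ?X" for w
          using that rc' by (intro word_eval_closed) (auto simp: permutations_of_set_def)
        have hc: "?h \<in> carrier R" using wc cc by (intro finsum_closed) auto
        have "multilin R S c ?r \<in> P"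
        proof (rule Suc.prems(7))
          fix j assume j: "j \<in> S"
          show "\<exists>x\<in>carrier R. ?r j = a \<otimes> x"
          proof (cases "j = i")
            case False
            with r j obtain v where "v \<in> carrier R" "r j = b \<otimes> v" by auto
            with s a have "s \<otimes> v \<in> carrier R" "?r j = a \<otimes> (s \<otimes> v)"
              using False by (auto simp: m_assoc)
            then show ?thesis by blast
          qed (use x in auto)
        qed
        moreover have "multilin R S c ?r = a \<otimes> x \<otimes> ?g \<oplus> ?h"
          using multilin_split_first[of S i c ?r] Suc.prems(1,2) w(2) rc' g' by simp
        ultimately have "a' \<otimes> (a \<otimes> x \<otimes> ?g \<oplus> ?h) \<in> P" using a' by (auto intro: P.I_l_closed)
        also have "a' \<otimes> (a \<otimes> x \<otimes> ?g \<oplus> ?h) = b \<otimes> x \<otimes> ?g \<oplus> a' \<otimes> ?h"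
          using a a' x g hc by (simp add: r_distr b_def m_assoc)
        finally have 1: "b \<otimes> x \<otimes> ?g \<oplus> a' \<otimes> ?h \<in> P" .
        have "a' \<otimes> ?h = (\<Oplus>w\<in>?X. a' \<otimes> (c w \<otimes> word_eval R ?r w))"
          using a' wc cc Suc.prems(1) by (intro finsum_rdistr) auto
        also have "\<dots> \<in> P"
        proof (intro P.finsum_mem ring_axioms)
          fix w assume w': "w \<in> ?X"
          then have "w \<in> permutations_of_set S" by auto
          then obtain j v where jv: "w = j # v" "j \<in> S" "v \<in> permutations_of_set (S - {j})"
            using permutations_of_setE[OF _ \<open>S \<noteq> {}\<close>] by blast
          have ji: "j \<noteq> i"
          proof
            assume "j = i"
            with jv have "w \<in> (#) i ` permutations_of_set (S - {i})" by simp
            with w' show False by simp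
          qed
          with r[of j] jv(2) obtain t where "t \<in> carrier R" "r j = b \<otimes> t" by blast
          with ji have t: "t \<in> carrier R" "?r j = b \<otimes> t" by simp_all
          have vc: "word_eval R ?r v \<in> carrier R"
            using jv rc' by (intro word_eval_closed) (auto simp: permutations_of_set_def)
          have "a' \<otimes> (c w \<otimes> word_eval R ?r w) = c w \<otimes> (a' \<otimes> word_eval R ?r w)"
            using centerD(2)[OF Suc.prems(2), of a' w] a' cc wc[OF w'] by (simp add: m_assoc[symmetric])
          also have "a' \<otimes> word_eval R ?r w = (a' \<otimes> b) \<otimes> (t \<otimes> word_eval R ?r v)"
            unfolding jv(1) word_eval_Cons t(2) using a' b t vc by (simp add: m_assoc)
          also have "c w \<otimes> \<dots> \<in> P"
            using a'b t(1) vc cc by (simp add: P.I_l_closed P.I_r_closed)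
          finally show "a' \<otimes> (c w \<otimes> word_eval R ?r w) \<in> P" .
        qed
        finally have 2: "a' \<otimes> ?h \<in> P" .
        have "b \<otimes> x \<otimes> ?g = (b \<otimes> x \<otimes> ?g \<oplus> a' \<otimes> ?h) \<ominus> a' \<otimes> ?h"
          using b x g a' hc by (simp add: a_minus_def a_assoc r_neg)
        also have "\<dots> \<in> P" using 1 2 by (simp add: a_minus_def P.a_closed P.a_inv_closed)
        finally show ?thesis .
      qed
      \<comment> \<open>\<open>b R g\<close> lies in \<open>P\<close> and \<open>b\<close> does not:
        primeness gives the identity of smaller degree on \<open>b R\<close>, and its coefficient at
        \<open>u\<close> is still the one outside \<open>P\<close>.\<close>
      with prime_ideal_elementwise[OF P b g] bP show "?g \<in> P" by auto
    qed (use Suc.prems w b bP in auto)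
    then obtain x where x: "x \<in> carrier R" "\<forall>m::nat. (b \<otimes> x) [^] m \<notin> P" by blast
    have "b \<otimes> x = a \<otimes> (s \<otimes> x)" using s x a by (simp add: m_assoc)
    with nil[of "s \<otimes> x"] x s show False by auto
  qed
qed

end

section \<open>Hilbert's basis theorem for adjunctions in a commutative ring\<close>

text \<open>Ideals of a subring, expressed with the operations of the ambient ring so that
  \<open>S\<close> can grow while the structure stays fixed. Negation is multiplication by the
  element \<open>- 1\<close> of a subring.\<close>

definition ideal_of :: "('a, 'b) ring_scheme \<Rightarrow> 'a set \<Rightarrow> 'a set \<Rightarrow> bool" where
  "ideal_of R S I \<longleftrightarrow> I \<subseteq> S \<and> \<zero>\<^bsub>R\<^esub> \<in> I \<and> (\<forall>a\<in>I. \<forall>b\<in>I. a \<oplus>\<^bsub>R\<^esub> b \<in> I) \<and> (\<forall>s\<in>S. \<forall>a\<in>I. s \<otimes>\<^bsub>R\<^esub> a \<in> I)"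

definition ideal_hull :: "('a, 'b) ring_scheme \<Rightarrow> 'a set \<Rightarrow> 'a set \<Rightarrow> 'a set" where
  "ideal_hull R S E = \<Inter>{J. ideal_of R S J \<and> E \<subseteq> J}"

definition noetherian_subring :: "('a, 'b) ring_scheme \<Rightarrow> 'a set \<Rightarrow> bool" where
  "noetherian_subring R S \<longleftrightarrow> subring S R \<and>
     (\<forall>I. ideal_of R S I \<longrightarrow> (\<exists>F\<subseteq>I. finite F \<and> I \<subseteq> ideal_hull R S F))"

lemma ideal_ofI:
  assumes "I \<subseteq> S" "\<zero>\<^bsub>R\<^esub> \<in> I" "\<And>a b. a \<in> I \<Longrightarrow> b \<in> I \<Longrightarrow> a \<oplus>\<^bsub>R\<^esub> b \<in> I"
    "\<And>s a. s \<in> S \<Longrightarrow> a \<in> I \<Longrightarrow> s \<otimes>\<^bsub>R\<^esub> a \<in> I"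
  shows "ideal_of R S I"
  using assms by (simp add: ideal_of_def)

lemma ideal_ofD:
  assumes "ideal_of R S I"
  shows "I \<subseteq> S" "\<zero>\<^bsub>R\<^esub> \<in> I" "a \<in> I \<Longrightarrow> b \<in> I \<Longrightarrow> a \<oplus>\<^bsub>R\<^esub> b \<in> I" "s \<in> S \<Longrightarrow> a \<in> I \<Longrightarrow> s \<otimes>\<^bsub>R\<^esub> a \<in> I"
  using assms by (simp_all add: ideal_of_def)

lemma ideal_hull_superset: "E \<subseteq> ideal_hull R S E"
  by (auto simp: ideal_hull_def)

lemma ideal_hull_minimal: "ideal_of R S J \<Longrightarrow> E \<subseteq> J \<Longrightarrow> ideal_hull R S E \<subseteq> J"
  by (auto simp: ideal_hull_def)

lemma ideal_hull_mono: "E \<subseteq> E' \<Longrightarrow> ideal_hull R S E \<subseteq> ideal_hull R S E'"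
  by (auto simp: ideal_hull_def)

context cring begin

lemma ideal_of_ideal_hull:
  assumes S: "subring S R" and E: "E \<subseteq> S"
  shows "ideal_of R S (ideal_hull R S E)"
proof -
  have "ideal_of R S S"
    using S by (intro ideal_ofI) (auto intro: subringE)
  then have "ideal_hull R S E \<subseteq> S" using E by (intro ideal_hull_minimal)
  then show ?thesis
    unfolding ideal_hull_def by (intro ideal_ofI) (auto dest: ideal_ofD)
qed

text \<open>Generators can be taken from the given set \<open>E\<close>: the hulls of its finite
  subsets form a directed family, so their union is an ideal, and each of its finitely many
  generators already lies in one such hull.\<close>

lemma noetherian_subring_finite_subset:
  assumes N: "noetherian_subring R S" and E: "E \<subseteq> S"
  obtains F where "F \<subseteq> E" "finite F" "E \<subseteq> ideal_hull R S F"
proof -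
  have S: "subring S R" using N by (simp add: noetherian_subring_def)
  define U where "U = \<Union>{ideal_hull R S F |F. F \<subseteq> E \<and> finite F}"
  have hull: "ideal_of R S (ideal_hull R S F)" if "F \<subseteq> E" for F
    using that E S by (intro ideal_of_ideal_hull) auto
  have UI: "a \<in> U" if "a \<in> ideal_hull R S F" "F \<subseteq> E" "finite F" for a F
    using that unfolding U_def by blast
  have UE: "\<exists>F. a \<in> ideal_hull R S F \<and> F \<subseteq> E \<and> finite F" if "a \<in> U" for a
    using that unfolding U_def by blast
  have "ideal_of R S U"
  proof (rule ideal_ofI)
    show "U \<subseteq> S"
    proof
      fix a assume "a \<in> U"
      then obtain F where "a \<in> ideal_hull R S F" "F \<subseteq> E" using UE by blast
      then show "a \<in> S" using ideal_ofD(1)[OF hull[of F]] by blast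
    qed
    show "\<zero> \<in> U" using UI[of \<zero> "{}"] ideal_ofD(2)[OF hull[of "{}"]] by blast
    show "a \<oplus> b \<in> U" if ab: "a \<in> U" "b \<in> U" for a b
    proof -
      obtain F where F: "a \<in> ideal_hull R S F" "F \<subseteq> E" "finite F" using UE ab by blast
      obtain G where G: "b \<in> ideal_hull R S G" "G \<subseteq> E" "finite G" using UE ab by blast
      have FG: "F \<union> G \<subseteq> E" "finite (F \<union> G)" using F G by auto
      have "a \<in> ideal_hull R S (F \<union> G)" "b \<in> ideal_hull R S (F \<union> G)"
        using F(1) G(1) ideal_hull_mono[of F "F \<union> G" R S] ideal_hull_mono[of G "F \<union> G" R S] by blast+
      then have "a \<oplus> b \<in> ideal_hull R S (F \<union> G)" by (rule ideal_ofD(3)[OF hull[OF FG(1)]])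
      then show ?thesis using UI FG by blast
    qed
    show "s \<otimes> a \<in> U" if sa: "s \<in> S" "a \<in> U" for s a
    proof -
      obtain F where F: "a \<in> ideal_hull R S F" "F \<subseteq> E" "finite F" using UE sa by blast
      then have "s \<otimes> a \<in> ideal_hull R S F" using ideal_ofD(4)[OF hull[OF F(2)]] sa by blast
      then show ?thesis using UI F by blast
    qed
  qed
  then obtain G where G: "G \<subseteq> U" "finite G" "U \<subseteq> ideal_hull R S G"
    using N by (auto simp: noetherian_subring_def)
  have "\<forall>g\<in>G. \<exists>F. g \<in> ideal_hull R S F \<and> F \<subseteq> E \<and> finite F" using UE G by blast
  then obtain f where f: "\<And>g. g \<in> G \<Longrightarrow> g \<in> ideal_hull R S (f g) \<and> f g \<subseteq> E \<and> finite (f g)"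
    by metis
  define F where "F = (\<Union>g\<in>G. f g)"
  have F: "F \<subseteq> E" "finite F" using f G by (auto simp: F_def)
  have "G \<subseteq> ideal_hull R S F"
  proof
    fix g assume "g \<in> G"
    then have "f g \<subseteq> F" by (auto simp: F_def)
    then show "g \<in> ideal_hull R S F" using f[OF \<open>g \<in> G\<close>] ideal_hull_mono[of "f g" F] by blast
  qed
  then have "ideal_hull R S G \<subseteq> ideal_hull R S F" by (intro ideal_hull_minimal hull F)
  moreover have "E \<subseteq> U"
  proof
    fix a assume "a \<in> E"
    moreover have "a \<in> ideal_hull R S {a}" using ideal_hull_superset by fastforce
    ultimately show "a \<in> U" using UI[of a "{a}"] by simp
  qed
  ultimately have "E \<subseteq> ideal_hull R S F" using G by blast
  with F that show ?thesis by blast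
qed

text \<open>Formulated by inverses instead of \<open>field\<close>: the subring it is applied to is
  the image of \<open>K\<close> in a product ring, which is the zero ring when the index set is
  empty.\<close>

lemma noetherian_subring_field:
  assumes S: "subring S R" and inv: "\<And>s. s \<in> S \<Longrightarrow> s \<noteq> \<zero> \<Longrightarrow> \<exists>t\<in>S. t \<otimes> s = \<one>"
  shows "noetherian_subring R S"
  unfolding noetherian_subring_def
proof (intro conjI allI impI S)
  fix I assume I: "ideal_of R S I"
  show "\<exists>F\<subseteq>I. finite F \<and> I \<subseteq> ideal_hull R S F"
  proof (cases "I \<subseteq> {\<zero>}")
    case True
    have "\<zero> \<in> ideal_hull R S {}" using ideal_of_ideal_hull[OF S, of "{}"] by (simp add: ideal_of_def)
    then show ?thesis using True by blast
  next
    case False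
    then obtain s where s: "s \<in> I" "s \<noteq> \<zero>" by auto
    then obtain t where t: "t \<in> S" "t \<otimes> s = \<one>" using inv ideal_ofD(1)[OF I] by blast
    have hull: "ideal_of R S (ideal_hull R S {s})"
      using s ideal_ofD(1)[OF I] by (intro ideal_of_ideal_hull S) auto
    have "s \<in> ideal_hull R S {s}" using ideal_hull_superset by fastforce
    then have one: "\<one> \<in> ideal_hull R S {s}" using ideal_ofD(4)[OF hull] t by metis
    have "x \<in> ideal_hull R S {s}" if "x \<in> I" for x
    proof -
      have x: "x \<in> S" using that ideal_ofD(1)[OF I] by auto
      then have "x \<otimes> \<one> = x" using subringE(1)[OF S] by auto
      with ideal_ofD(4)[OF hull x one] show ?thesis by simp
    qed
    then show ?thesis using s by (intro exI[of _ "{s}"]) auto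
  qed
qed

end

text \<open>The values at \<open>x\<close> of polynomials over \<open>S\<close> of degree less than
  \<open>n\<close>; the shift by one makes stage 0 the zero polynomial. Since \<open>x\<close> may
  satisfy relations over \<open>S\<close>, an element has no well-defined leading coefficient, only
  possible choices of one.\<close>

primrec poly_values :: "('a, 'b) ring_scheme \<Rightarrow> 'a set \<Rightarrow> 'a \<Rightarrow> nat \<Rightarrow> 'a set" where
  "poly_values R S x 0 = {\<zero>\<^bsub>R\<^esub>}"
| "poly_values R S x (Suc n) =
     {s \<otimes>\<^bsub>R\<^esub> x [^]\<^bsub>R\<^esub> n \<oplus>\<^bsub>R\<^esub> b | s b. s \<in> S \<and> b \<in> poly_values R S x n}"

definition adjoin :: "('a, 'b) ring_scheme \<Rightarrow> 'a set \<Rightarrow> 'a \<Rightarrow> 'a set" where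
  "adjoin R S x = (\<Union>n. poly_values R S x n)"

context cring begin

context
  fixes S x
  assumes S: "subring S R" and x: "x \<in> carrier R"
begin

lemma subring_mem_carrier: "s \<in> S \<Longrightarrow> s \<in> carrier R"
  using subringE(1)[OF S] by blast

lemma poly_values_closed: "p \<in> poly_values R S x n \<Longrightarrow> p \<in> carrier R"
proof (induction n arbitrary: p)
  case (Suc n)
  then obtain s b where "p = s \<otimes> x [^] n \<oplus> b" "s \<in> S" "b \<in> poly_values R S x n" by auto
  moreover from this have "b \<in> carrier R" using Suc.IH by blast
  ultimately show ?case using subring_mem_carrier x by simp
qed simp

lemma zero_mem_poly_values: "\<zero> \<in> poly_values R S x n"
proof (induction n)
  case (Suc n)
  have "\<zero> = \<zero> \<otimes> x [^] n \<oplus> \<zero>" using x by simp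
  with Suc subringE(2)[OF S] show ?case unfolding poly_values.simps by blast
qed simp

lemma poly_values_add:
  "p \<in> poly_values R S x n \<Longrightarrow> q \<in> poly_values R S x n \<Longrightarrow> p \<oplus> q \<in> poly_values R S x n"
proof (induction n arbitrary: p q)
  case (Suc n)
  then obtain s b where p: "p = s \<otimes> x [^] n \<oplus> b" "s \<in> S" "b \<in> poly_values R S x n" by auto
  from Suc obtain t c where q: "q = t \<otimes> x [^] n \<oplus> c" "t \<in> S" "c \<in> poly_values R S x n" by auto
  have cl: "s \<in> carrier R" "t \<in> carrier R" "b \<in> carrier R" "c \<in> carrier R" "x [^] n \<in> carrier R"
    using p q subring_mem_carrier poly_values_closed x by auto
  have "p \<oplus> q = (s \<oplus> t) \<otimes> x [^] n \<oplus> (b \<oplus> c)"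
    using cl p(1) q(1) by (simp add: l_distr a_ac)
  moreover have "s \<oplus> t \<in> S" "b \<oplus> c \<in> poly_values R S x n"
    using p q Suc.IH subringE(7)[OF S] by auto
  ultimately show ?case unfolding poly_values.simps by blast
qed simp

lemma poly_values_smult:
  "u \<in> S \<Longrightarrow> p \<in> poly_values R S x n \<Longrightarrow> u \<otimes> p \<in> poly_values R S x n"
proof (induction n arbitrary: p)
  case 0 then show ?case using subring_mem_carrier by simp
next
  case (Suc n)
  then obtain s b where p: "p = s \<otimes> x [^] n \<oplus> b" "s \<in> S" "b \<in> poly_values R S x n" by auto
  have cl: "s \<in> carrier R" "u \<in> carrier R" "b \<in> carrier R" "x [^] n \<in> carrier R"
    using p Suc.prems subring_mem_carrier poly_values_closed x by auto
  have "u \<otimes> p = (u \<otimes> s) \<otimes> x [^] n \<oplus> u \<otimes> b"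
    using cl p(1) by (simp add: r_distr m_assoc)
  moreover have "u \<otimes> s \<in> S" "u \<otimes> b \<in> poly_values R S x n"
    using p Suc subringE(6)[OF S] by auto
  ultimately show ?case unfolding poly_values.simps by blast
qed

lemma poly_values_Suc_superset:
  assumes "p \<in> poly_values R S x n" shows "p \<in> poly_values R S x (Suc n)"
proof -
  have "p = \<zero> \<otimes> x [^] n \<oplus> p" using poly_values_closed[OF assms] x by simp
  then show ?thesis using assms subringE(2)[OF S] unfolding poly_values.simps by blast
qed

lemma poly_values_mono: "m \<le> n \<Longrightarrow> poly_values R S x m \<subseteq> poly_values R S x n"
proof (induction n rule: dec_induct)
  case (step n)
  have "poly_values R S x n \<subseteq> poly_values R S x (Suc n)"
    by (rule subsetI) (rule poly_values_Suc_superset)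
  with step.IH show ?case by (rule subset_trans)
qed (rule subset_refl)

lemma poly_values_shift: "p \<in> poly_values R S x n \<Longrightarrow> x \<otimes> p \<in> poly_values R S x (Suc n)"
proof (induction n arbitrary: p)
  case 0
  then show ?case using zero_mem_poly_values[of 1] x by simp
next
  case (Suc n)
  then obtain s b where p: "p = s \<otimes> x [^] n \<oplus> b" "s \<in> S" "b \<in> poly_values R S x n" by auto
  have cl: "s \<in> carrier R" "b \<in> carrier R" "x [^] n \<in> carrier R"
    using p subring_mem_carrier poly_values_closed x by auto
  have "x \<otimes> p = s \<otimes> x [^] Suc n \<oplus> x \<otimes> b"
    using cl x p(1) by (simp add: r_distr m_ac)
  moreover have "x \<otimes> b \<in> poly_values R S x (Suc n)" using p Suc.IH by blast
  ultimately show ?case using p(2) unfolding poly_values.simps(2)[of R S x "Suc n"] by blast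
qed

lemma poly_values_shift_pow:
  "p \<in> poly_values R S x n \<Longrightarrow> x [^] k \<otimes> p \<in> poly_values R S x (n + k)"
proof (induction k)
  case 0 then show ?case using poly_values_closed by simp
next
  case (Suc k)
  have "x [^] Suc k \<otimes> p = x \<otimes> (x [^] k \<otimes> p)"
    using x poly_values_closed[OF Suc.prems] by (simp add: m_ac)
  then show ?case using poly_values_shift Suc by auto
qed

lemma poly_values_uminus: "p \<in> poly_values R S x n \<Longrightarrow> \<ominus> p \<in> poly_values R S x n"
  using poly_values_smult[of "\<ominus> \<one>" p n] subringE(3,5)[OF S] poly_values_closed[of p n]
  by (simp add: l_minus)

lemma adjoinI: "p \<in> poly_values R S x n \<Longrightarrow> p \<in> adjoin R S x"
  by (auto simp: adjoin_def)

lemma adjoinE: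
  assumes "p \<in> adjoin R S x" obtains n where "p \<in> poly_values R S x n"
  using assms by (auto simp: adjoin_def)

lemma adjoin_add:
  assumes "p \<in> adjoin R S x" "q \<in> adjoin R S x" shows "p \<oplus> q \<in> adjoin R S x"
proof -
  obtain m n where "p \<in> poly_values R S x m" "q \<in> poly_values R S x n"
    using assms by (elim adjoinE)
  then have "p \<in> poly_values R S x (max m n)" "q \<in> poly_values R S x (max m n)"
    using poly_values_mono[of m "max m n"] poly_values_mono[of n "max m n"] by auto
  then show ?thesis using poly_values_add adjoinI by blast
qed

lemma adjoin_mult:
  assumes q: "q \<in> adjoin R S x"
  shows "p \<in> poly_values R S x n \<Longrightarrow> p \<otimes> q \<in> adjoin R S x"
proof (induction n arbitrary: p)
  case 0
  have "q \<in> carrier R" using q poly_values_closed by (blast elim: adjoinE)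
  then show ?case using 0 zero_mem_poly_values[THEN adjoinI] by simp
next
  case (Suc n)
  then obtain s b where p: "p = s \<otimes> x [^] n \<oplus> b" "s \<in> S" "b \<in> poly_values R S x n" by auto
  obtain m where m: "q \<in> poly_values R S x m" using q by (rule adjoinE)
  have cl: "s \<in> carrier R" "b \<in> carrier R" "x [^] n \<in> carrier R" "q \<in> carrier R"
    using p m subring_mem_carrier poly_values_closed x by auto
  have "p \<otimes> q = s \<otimes> (x [^] n \<otimes> q) \<oplus> b \<otimes> q"
    using cl p(1) by (simp add: l_distr m_assoc)
  moreover have "s \<otimes> (x [^] n \<otimes> q) \<in> adjoin R S x"
    using poly_values_smult[OF p(2) poly_values_shift_pow[OF m]] by (rule adjoinI)
  moreover have "b \<otimes> q \<in> adjoin R S x" using p Suc.IH by blast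
  ultimately show ?case using adjoin_add by simp
qed

lemma adjoin_superset: "S \<subseteq> adjoin R S x"
proof
  fix s assume "s \<in> S"
  then have "s = s \<otimes> x [^] (0::nat) \<oplus> \<zero>" "s \<in> S" using subring_mem_carrier by auto
  then have "s \<in> poly_values R S x (Suc 0)" unfolding poly_values.simps by blast
  then show "s \<in> adjoin R S x" by (rule adjoinI)
qed

lemma adjoin_self: "x \<in> adjoin R S x"
proof -
  have "\<one> \<in> S" using subringE(3)[OF S] .
  moreover have "\<one> = \<one> \<otimes> x [^] (0::nat) \<oplus> \<zero>" by simp
  ultimately have "\<one> \<in> poly_values R S x (Suc 0)" unfolding poly_values.simps by blast
  then have "x \<otimes> \<one> \<in> poly_values R S x (Suc (Suc 0))" by (rule poly_values_shift)
  with x show ?thesis by (metis adjoinI r_one)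
qed

lemma subring_adjoin: "subring (adjoin R S x) R"
proof (rule subringI)
  show "adjoin R S x \<subseteq> carrier R" using poly_values_closed by (auto elim: adjoinE)
  show "\<one> \<in> adjoin R S x" using subringE(3)[OF S] adjoin_superset by blast
  show "\<ominus> h \<in> adjoin R S x" if "h \<in> adjoin R S x" for h
    using that poly_values_uminus adjoinI by (blast elim: adjoinE)
  show "h1 \<otimes> h2 \<in> adjoin R S x" if "h1 \<in> adjoin R S x" "h2 \<in> adjoin R S x" for h1 h2
    using that adjoin_mult by (blast elim: adjoinE)
qed (rule adjoin_add)

text \<open>Hilbert's argument by contradiction: if \<open>I\<close> were not finitely generated,
  one could keep picking elements \<open>g n\<close> of least degree bound outside the hull of the
  earlier ones. The ideal of \<open>S\<close> generated by the top coefficients \<open>a n\<close>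
  is generated by finitely many of them, and this makes some \<open>g m\<close> replaceable by an
  element of smaller degree.\<close>

theorem Hilbert_basis:
  assumes N: "noetherian_subring R S"
  shows "noetherian_subring R (adjoin R S x)"
  unfolding noetherian_subring_def
proof (intro conjI subring_adjoin allI impI)
  let ?A = "adjoin R S x" and ?B = "poly_values R S x"
  let ?H = "ideal_hull R ?A"
  fix I assume I: "ideal_of R ?A I"
  show "\<exists>F\<subseteq>I. finite F \<and> I \<subseteq> ?H F"
  proof (rule ccontr)
    assume "\<not> ?thesis"
    then have notfg: "\<exists>p. p \<in> I \<and> p \<notin> ?H F" if "F \<subseteq> I" "finite F" for F
      using that by blast
    have IA: "I \<subseteq> ?A" using I by (rule ideal_ofD)
    have hull: "ideal_of R ?A (?H F)" if "F \<subseteq> I" for F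
      using that IA by (intro ideal_of_ideal_hull subring_adjoin) auto
    define Q where "Q = (\<lambda>F n p. p \<in> I \<and> p \<notin> ?H F \<and> p \<in> ?B n)"
    define deg where "deg = (\<lambda>F. LEAST n. \<exists>p. Q F n p)"
    have ex: "\<exists>n p. Q F n p" if "F \<subseteq> I" "finite F" for F
      using notfg[OF that] IA unfolding Q_def by (blast elim: adjoinE)
    have deg: "\<exists>p. Q F (deg F) p" if "F \<subseteq> I" "finite F" for F
      unfolding deg_def using ex[OF that] by (rule LeastI_ex)
    have deg_le: "deg F \<le> n" if "Q F n p" for F n p
      unfolding deg_def using that by (intro Least_le) auto
    obtain pick where pick: "\<And>F. F \<subseteq> I \<Longrightarrow> finite F \<Longrightarrow> Q F (deg F) (pick F)"
      using deg by metis
    define F where "F = rec_nat {} (\<lambda>_ G. insert (pick G) G)"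
    have F0: "F 0 = {}" and FS: "\<And>n. F (Suc n) = insert (pick (F n)) (F n)"
      by (simp_all add: F_def)
    have FI: "F n \<subseteq> I \<and> finite (F n)" for n
    proof (induction n)
      case (Suc n)
      then have "Q (F n) (deg (F n)) (pick (F n))" using pick by blast
      with Suc show ?case by (simp add: FS Q_def)
    qed (simp add: F0)
    have Feq: "F n = (\<lambda>i. pick (F i)) ` {..<n}" for n
      by (induction n) (simp_all add: F0 FS lessThan_Suc)
    define g where "g = (\<lambda>n. pick (F n))"
    define d where "d = (\<lambda>n. deg (F n))"
    have g: "Q (F n) (d n) (g n)" for n using pick FI by (simp add: g_def d_def)
    have d_mono: "d i \<le> d n" if "i \<le> n" for i n
    proof -
      have "F i \<subseteq> F n" unfolding Feq[of i] Feq[of n] using that by (intro image_mono) simp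
      then have "Q (F i) (d n) (g n)" using g[of n] ideal_hull_mono[of "F i" "F n" R ?A]
        by (auto simp: Q_def)
      then show ?thesis unfolding d_def by (rule deg_le)
    qed
    have "d n \<noteq> 0" for n
    proof
      assume "d n = 0"
      then have "g n = \<zero>" "g n \<notin> ?H (F n)" using g[of n] by (auto simp: Q_def)
      then show False using hull[of "F n"] FI ideal_ofD(2) by metis
    qed
    then have "\<exists>k. d n = Suc k" for n by (metis not0_implies_Suc)
    then obtain e where e: "\<And>n. d n = Suc (e n)" by metis
    have "\<exists>a b. a \<in> S \<and> b \<in> ?B (e n) \<and> g n = a \<otimes> x [^] e n \<oplus> b" for n
      using g[of n] e[of n] by (auto simp: Q_def)
    then obtain a b where ab: "\<And>n. a n \<in> S" "\<And>n. b n \<in> ?B (e n)"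
        "\<And>n. g n = a n \<otimes> x [^] e n \<oplus> b n" by metis
    obtain G where G: "G \<subseteq> range a" "finite G" "range a \<subseteq> ideal_hull R S G"
      using noetherian_subring_finite_subset[OF N, of "range a"] ab by blast
    obtain m where m: "G \<subseteq> a ` {..<m}"
    proof -
      obtain C where C: "finite C" "G = a ` C" using G by (meson finite_subset_image)
      then obtain m where "C \<subseteq> {..<m}" using finite_nat_iff_bounded by blast
      with C that show ?thesis by blast
    qed
    have Fm: "ideal_of R ?A (?H (F m))" using hull FI by blast
    \<comment> \<open>The coefficients that occur at \<open>x ^ e m\<close> in elements of
      \<open>?H (F m)\<close>, up to terms of lower degree. They form an ideal of \<open>S\<close>,
      so containing \<open>a i\<close> for \<open>i < m\<close> forces it to contain
      \<open>a m\<close>.\<close>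
    define J where "J = {s \<in> S. \<exists>c\<in>?B (e m). s \<otimes> x [^] e m \<oplus> c \<in> ?H (F m)}"
    have xe: "x [^] e m \<in> carrier R" using x by simp
    have "ideal_of R S J"
    proof (rule ideal_ofI)
      show "J \<subseteq> S" by (auto simp: J_def)
      have "\<zero> \<otimes> x [^] e m \<oplus> \<zero> = \<zero>" using xe by simp
      with ideal_ofD(2)[OF Fm] show "\<zero> \<in> J"
        using subringE(2)[OF S] zero_mem_poly_values unfolding J_def by force
      fix s assume "s \<in> J"
      then obtain c where c: "s \<in> S" "c \<in> ?B (e m)" "s \<otimes> x [^] e m \<oplus> c \<in> ?H (F m)"
        by (auto simp: J_def)
      have sc: "s \<in> carrier R" "c \<in> carrier R" using c subring_mem_carrier poly_values_closed by auto
      { fix t assume "t \<in> J"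
        then obtain c' where c': "t \<in> S" "c' \<in> ?B (e m)" "t \<otimes> x [^] e m \<oplus> c' \<in> ?H (F m)"
          by (auto simp: J_def)
        have tc: "t \<in> carrier R" "c' \<in> carrier R" using c' subring_mem_carrier poly_values_closed by auto
        have "(s \<oplus> t) \<otimes> x [^] e m \<oplus> (c \<oplus> c') = (s \<otimes> x [^] e m \<oplus> c) \<oplus> (t \<otimes> x [^] e m \<oplus> c')"
          using sc tc xe by (simp add: l_distr a_ac)
        also have "\<dots> \<in> ?H (F m)" using c c' ideal_ofD(3)[OF Fm] by blast
        finally show "s \<oplus> t \<in> J" using subringE(7)[OF S] c c' poly_values_add
          unfolding J_def by blast }
      { fix u assume u: "u \<in> S"
        have uc: "u \<in> carrier R" "u \<in> ?A" using u subring_mem_carrier adjoin_superset by auto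
        have "(u \<otimes> s) \<otimes> x [^] e m \<oplus> u \<otimes> c = u \<otimes> (s \<otimes> x [^] e m \<oplus> c)"
          using sc uc xe by (simp add: r_distr m_assoc)
        also have "\<dots> \<in> ?H (F m)" using c uc ideal_ofD(4)[OF Fm] by blast
        finally show "u \<otimes> s \<in> J" using subringE(6)[OF S] c u poly_values_smult
          unfolding J_def by blast }
    qed
    moreover have "a ` {..<m} \<subseteq> J"
    proof
      fix z assume "z \<in> a ` {..<m}"
      then obtain i where i: "i < m" "z = a i" by auto
      have gi: "g i \<in> ?H (F m)" using ideal_hull_superset[of "F m" R ?A] i
        by (auto simp: Feq[of m] g_def)
      \<comment> \<open>The degrees \<open>d n\<close> do not decrease, so \<open>g i\<close> can be
        multiplied up to degree \<open>e m\<close>.\<close>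
      define k where "k = e m - e i"
      have ek: "e m = e i + k" using d_mono[of i m] i e by (simp add: k_def)
      have "x [^] k \<in> ?A"
        by (induction k) (use subring_adjoin adjoin_self in \<open>auto intro: subringE(3,6)\<close>)
      then have "x [^] k \<otimes> g i \<in> ?H (F m)" using gi ideal_ofD(4)[OF Fm] by blast
      moreover have "x [^] k \<otimes> g i = a i \<otimes> x [^] e m \<oplus> x [^] k \<otimes> b i"
      proof -
        have "a i \<in> carrier R" "b i \<in> carrier R" "x [^] k \<in> carrier R" "x [^] e i \<in> carrier R"
          using subring_mem_carrier[OF ab(1)] poly_values_closed[OF ab(2)] x by auto
        moreover have "x [^] e m = x [^] e i \<otimes> x [^] k" using x by (simp add: ek nat_pow_mult)
        ultimately show ?thesis using ab(3)[of i] by (simp add: r_distr m_ac)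
      qed
      moreover have "x [^] k \<otimes> b i \<in> ?B (e m)" using poly_values_shift_pow[OF ab(2)] ek by simp
      ultimately show "z \<in> J" using i ab unfolding J_def by auto
    qed
    ultimately have "ideal_hull R S G \<subseteq> J" using m by (intro ideal_hull_minimal) auto
    with G have "a m \<in> J" by blast
    then obtain c where c: "c \<in> ?B (e m)" "a m \<otimes> x [^] e m \<oplus> c \<in> ?H (F m)"
      by (auto simp: J_def)
    let ?p = "a m \<otimes> x [^] e m \<oplus> c"
    have cl: "a m \<in> carrier R" "b m \<in> carrier R" "c \<in> carrier R"
      using subring_mem_carrier[OF ab(1)] poly_values_closed[OF ab(2)] poly_values_closed[OF c(1)] by auto
    have gm: "g m \<in> I" "g m \<notin> ?H (F m)" using g[of m] by (auto simp: Q_def)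
    have "?H (F m) \<subseteq> I" using FI I by (intro ideal_hull_minimal) auto
    have min1: "\<ominus> \<one> \<in> ?A" using subringE(3,5)[OF subring_adjoin] by blast
    \<comment> \<open>This is \<open>g m\<close> minus an element of the hull with the same top
      term, so it is still in \<open>I\<close> and outside the hull, but below the minimal degree
      \<open>d m\<close>.\<close>
    let ?q = "b m \<oplus> \<ominus> c"
    have "a m \<otimes> x [^] e m \<oplus> b m = ?p \<oplus> ?q" "?q = (a m \<otimes> x [^] e m \<oplus> b m) \<oplus> \<ominus> \<one> \<otimes> ?p"
      using cl xe by algebra+
    then have gq: "g m = ?p \<oplus> ?q" "?q = g m \<oplus> \<ominus> \<one> \<otimes> ?p"
      unfolding ab(3)[of m] .
    have "?q \<notin> ?H (F m)" using gm c gq(1) ideal_ofD(3)[OF Fm] by metis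
    moreover have "?q \<in> I"
      using gm c gq(2) ideal_ofD(3,4)[OF I] min1 \<open>?H (F m) \<subseteq> I\<close> by (metis subsetD)
    moreover have "?q \<in> ?B (e m)"
      using ab c by (intro poly_values_add poly_values_uminus)
    ultimately have "Q (F m) (e m) ?q" by (simp add: Q_def)
    then have "d m \<le> e m" unfolding d_def by (rule deg_le)
    with e[of m] show False by simp
  qed
qed

end

lemma noetherian_subring_adjoin_finite:
  assumes "noetherian_subring R S" "finite F" "F \<subseteq> carrier R"
  shows "\<exists>C. noetherian_subring R C \<and> S \<union> F \<subseteq> C"
  using assms(2,3)
proof (induction F)
  case empty
  then show ?case using assms(1) by auto
next
  case (insert x F)
  then obtain C where C: "noetherian_subring R C" "S \<union> F \<subseteq> C" by auto
  then have sub: "subring C R" by (simp add: noetherian_subring_def)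
  have "noetherian_subring R (adjoin R C x)" "C \<subseteq> adjoin R C x" "x \<in> adjoin R C x"
    using insert.prems C sub by (auto intro!: Hilbert_basis adjoin_self dest: adjoin_superset[THEN subsetD, rotated 2])
  with C show ?case by blast
qed

end

section \<open>Kernels of matrix representations\<close>

definition prod_ring :: "'x set \<Rightarrow> ('x \<Rightarrow> ('l, 'm) ring_scheme) \<Rightarrow> ('x \<Rightarrow> 'l) ring" where
  "prod_ring Y L = \<lparr>carrier = (\<Pi>\<^sub>E x\<in>Y. carrier (L x)),
     monoid.mult = (\<lambda>f g. \<lambda>x\<in>Y. f x \<otimes>\<^bsub>L x\<^esub> g x), one = (\<lambda>x\<in>Y. \<one>\<^bsub>L x\<^esub>),
     ring.zero = (\<lambda>x\<in>Y. \<zero>\<^bsub>L x\<^esub>), ring.add = (\<lambda>f g. \<lambda>x\<in>Y. f x \<oplus>\<^bsub>L x\<^esub> g x)\<rparr>"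

lemma prod_ring_simps:
  "carrier (prod_ring Y L) = (\<Pi>\<^sub>E x\<in>Y. carrier (L x))"
  "f \<otimes>\<^bsub>prod_ring Y L\<^esub> g = (\<lambda>x\<in>Y. f x \<otimes>\<^bsub>L x\<^esub> g x)"
  "f \<oplus>\<^bsub>prod_ring Y L\<^esub> g = (\<lambda>x\<in>Y. f x \<oplus>\<^bsub>L x\<^esub> g x)"
  "\<one>\<^bsub>prod_ring Y L\<^esub> = (\<lambda>x\<in>Y. \<one>\<^bsub>L x\<^esub>)"
  "\<zero>\<^bsub>prod_ring Y L\<^esub> = (\<lambda>x\<in>Y. \<zero>\<^bsub>L x\<^esub>)"
  by (simp_all add: prod_ring_def)

lemma cring_prod_ring:
  assumes "\<And>x. x \<in> Y \<Longrightarrow> cring (L x)"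
  shows "cring (prod_ring Y L)"
proof -
  have cr: "cring (L x)" "ring (L x)" "abelian_group (L x)" "abelian_monoid (L x)" "monoid (L x)"
    if "x \<in> Y" for x
    using assms[OF that] by (auto intro: cring.axioms ring.is_abelian_group abelian_group.axioms ring.is_monoid)
  have l_distr: "(a \<oplus>\<^bsub>L x\<^esub> b) \<otimes>\<^bsub>L x\<^esub> c = a \<otimes>\<^bsub>L x\<^esub> c \<oplus>\<^bsub>L x\<^esub> b \<otimes>\<^bsub>L x\<^esub> c"
    if "x \<in> Y" "a \<in> carrier (L x)" "b \<in> carrier (L x)" "c \<in> carrier (L x)" for x a b c
  proof -
    interpret cring "L x" using assms that(1) .
    show ?thesis using that by (intro l_distr)
  qed
  have mem: "f x \<in> carrier (L x)" if "f \<in> (\<Pi>\<^sub>E x\<in>Y. carrier (L x))" "x \<in> Y" for f x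
    using that by auto
  note cl = monoid.m_closed[OF cr(5)] abelian_monoid.a_closed[OF cr(4)]
    abelian_monoid.zero_closed[OF cr(4)] monoid.one_closed[OF cr(5)] mem
  show ?thesis
  proof (intro cringI abelian_groupI comm_monoidI; (unfold prod_ring_simps)?)
    fix f g h
    assume fgh: "f \<in> (\<Pi>\<^sub>E x\<in>Y. carrier (L x))" "g \<in> (\<Pi>\<^sub>E x\<in>Y. carrier (L x))" "h \<in> (\<Pi>\<^sub>E x\<in>Y. carrier (L x))"
    show "(\<lambda>x\<in>Y. (\<lambda>x\<in>Y. f x \<oplus>\<^bsub>L x\<^esub> g x) x \<oplus>\<^bsub>L x\<^esub> h x) = (\<lambda>x\<in>Y. f x \<oplus>\<^bsub>L x\<^esub> (\<lambda>x\<in>Y. g x \<oplus>\<^bsub>L x\<^esub> h x) x)"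
      using fgh abelian_monoid.a_assoc[OF cr(4)] by (intro restrict_ext) (simp add: cl)
    show "(\<lambda>x\<in>Y. (\<lambda>x\<in>Y. f x \<otimes>\<^bsub>L x\<^esub> g x) x \<otimes>\<^bsub>L x\<^esub> h x) = (\<lambda>x\<in>Y. f x \<otimes>\<^bsub>L x\<^esub> (\<lambda>x\<in>Y. g x \<otimes>\<^bsub>L x\<^esub> h x) x)"
      using fgh monoid.m_assoc[OF cr(5)] by (intro restrict_ext) (simp add: cl)
    show "(\<lambda>x\<in>Y. (\<lambda>x\<in>Y. f x \<oplus>\<^bsub>L x\<^esub> g x) x \<otimes>\<^bsub>L x\<^esub> h x) =
        (\<lambda>x\<in>Y. (\<lambda>x\<in>Y. f x \<otimes>\<^bsub>L x\<^esub> h x) x \<oplus>\<^bsub>L x\<^esub> (\<lambda>x\<in>Y. g x \<otimes>\<^bsub>L x\<^esub> h x) x)"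
      using fgh l_distr by (intro restrict_ext) (simp add: cl)
  next
    fix f g
    assume fg: "f \<in> (\<Pi>\<^sub>E x\<in>Y. carrier (L x))" "g \<in> (\<Pi>\<^sub>E x\<in>Y. carrier (L x))"
    show "(\<lambda>x\<in>Y. f x \<oplus>\<^bsub>L x\<^esub> g x) \<in> (\<Pi>\<^sub>E x\<in>Y. carrier (L x))" "(\<lambda>x\<in>Y. f x \<otimes>\<^bsub>L x\<^esub> g x) \<in> (\<Pi>\<^sub>E x\<in>Y. carrier (L x))"
      using fg by (auto simp: cl)
    show "(\<lambda>x\<in>Y. f x \<oplus>\<^bsub>L x\<^esub> g x) = (\<lambda>x\<in>Y. g x \<oplus>\<^bsub>L x\<^esub> f x)"
      using fg abelian_monoid.a_comm[OF cr(4)] by (intro restrict_ext) (simp add: cl)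
    show "(\<lambda>x\<in>Y. f x \<otimes>\<^bsub>L x\<^esub> g x) = (\<lambda>x\<in>Y. g x \<otimes>\<^bsub>L x\<^esub> f x)"
      using fg cring.cring_simprules(14)[OF cr(1)] by (intro restrict_ext) (simp add: cl)
  next
    show "(\<lambda>x\<in>Y. \<zero>\<^bsub>L x\<^esub>) \<in> (\<Pi>\<^sub>E x\<in>Y. carrier (L x))" "(\<lambda>x\<in>Y. \<one>\<^bsub>L x\<^esub>) \<in> (\<Pi>\<^sub>E x\<in>Y. carrier (L x))"
      by (auto simp: cl)
    fix f
    assume f: "f \<in> (\<Pi>\<^sub>E x\<in>Y. carrier (L x))"
    have eq: "(\<lambda>x\<in>Y. g x) = f" if "\<And>x. x \<in> Y \<Longrightarrow> g x = f x" for g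
      using that f by (intro extensionalityI[of _ Y]) (auto simp: PiE_def)
    show "(\<lambda>x\<in>Y. (\<lambda>x\<in>Y. \<zero>\<^bsub>L x\<^esub>) x \<oplus>\<^bsub>L x\<^esub> f x) = f" "(\<lambda>x\<in>Y. (\<lambda>x\<in>Y. \<one>\<^bsub>L x\<^esub>) x \<otimes>\<^bsub>L x\<^esub> f x) = f"
      using f abelian_monoid.l_zero[OF cr(4)] monoid.l_one[OF cr(5)] by (intro eq; simp add: cl)+
    show "\<exists>g\<in>\<Pi>\<^sub>E x\<in>Y. carrier (L x). (\<lambda>x\<in>Y. g x \<oplus>\<^bsub>L x\<^esub> f x) = (\<lambda>x\<in>Y. \<zero>\<^bsub>L x\<^esub>)"
      using f abelian_group.l_neg[OF cr(3)] abelian_group.a_inv_closed[OF cr(3)]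
      by (intro bexI[of _ "\<lambda>x\<in>Y. \<ominus>\<^bsub>L x\<^esub> f x"] restrict_ext) (auto simp: cl)
  qed
qed

text \<open>Scalars must act by scalar matrices, so that all matrix entries lie in a subring of a
  commutative ring generated over the image of \<open>K\<close> by the entries of the images of algebra
  generators.\<close>

definition matrix_rep ::
    "('k, 'c) ring_scheme \<Rightarrow> ('k, 'a, 'b) module_scheme \<Rightarrow> nat \<Rightarrow> ('l, 'm) ring_scheme \<Rightarrow>
      ('k \<Rightarrow> 'l) \<Rightarrow> ('a \<Rightarrow> nat \<Rightarrow> nat \<Rightarrow> 'l) \<Rightarrow> bool" where
  "matrix_rep K R n L \<kappa> \<rho> \<longleftrightarrow> cring L \<and> \<kappa> \<in> ring_hom K L \<and>
     (\<forall>r\<in>carrier R. \<forall>i<n. \<forall>j<n. \<rho> r i j \<in> carrier L) \<and>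
     (\<forall>r\<in>carrier R. \<forall>s\<in>carrier R. \<forall>i<n. \<forall>j<n. \<rho> (r \<oplus>\<^bsub>R\<^esub> s) i j = \<rho> r i j \<oplus>\<^bsub>L\<^esub> \<rho> s i j) \<and>
     (\<forall>r\<in>carrier R. \<forall>s\<in>carrier R. \<forall>i<n. \<forall>j<n.
        \<rho> (r \<otimes>\<^bsub>R\<^esub> s) i j = (\<Oplus>\<^bsub>L\<^esub>k\<in>{..<n}. \<rho> r i k \<otimes>\<^bsub>L\<^esub> \<rho> s k j)) \<and>
     (\<forall>c\<in>carrier K. \<forall>r\<in>carrier R. \<forall>i<n. \<forall>j<n. \<rho> (c \<odot>\<^bsub>R\<^esub> r) i j = \<kappa> c \<otimes>\<^bsub>L\<^esub> \<rho> r i j) \<and>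
     (\<forall>i<n. \<forall>j<n. \<rho> \<one>\<^bsub>R\<^esub> i j = (if i = j then \<one>\<^bsub>L\<^esub> else \<zero>\<^bsub>L\<^esub>))"

definition matrix_kernel ::
    "('a, 'b) ring_scheme \<Rightarrow> nat \<Rightarrow> ('l, 'm) ring_scheme \<Rightarrow> ('a \<Rightarrow> nat \<Rightarrow> nat \<Rightarrow> 'l) \<Rightarrow> 'a set" where
  "matrix_kernel R n L \<rho> = {r \<in> carrier R. \<forall>i<n. \<forall>j<n. \<rho> r i j = \<zero>\<^bsub>L\<^esub>}"

lemma (in cring) subring_finsum:
  assumes C: "subring C R" and f: "\<And>i. i \<in> A \<Longrightarrow> f i \<in> C"
  shows "finsum R f A \<in> C"
  using f
proof (induction A rule: infinite_finite_induct)
  case (insert x F)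
  then have "f \<in> F \<rightarrow> carrier R" "f x \<in> carrier R" using subringE(1)[OF C] by auto
  with insert subringE(7)[OF C] show ?case by simp
qed (use subringE(2)[OF C] in auto)

lemma prod_ring_finsum:
  assumes "\<And>x. x \<in> Y \<Longrightarrow> cring (L x)" "finite A"
    and "\<And>i. i \<in> A \<Longrightarrow> f i \<in> carrier (prod_ring Y L)"
  shows "finsum (prod_ring Y L) f A = (\<lambda>x\<in>Y. \<Oplus>\<^bsub>L x\<^esub>i\<in>A. f i x)"
  using assms(2,3)
proof (induction A)
  case empty
  interpret D: cring "prod_ring Y L" using assms(1) by (rule cring_prod_ring)
  have "(\<Oplus>\<^bsub>L x\<^esub>i\<in>{}. f i x) = \<zero>\<^bsub>L x\<^esub>" if "x \<in> Y" for x
  proof -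
    interpret cring "L x" using assms(1) that .
    show ?thesis by simp
  qed
  then show ?case by (simp add: prod_ring_simps cong: restrict_cong)
next
  case (insert i A)
  interpret D: cring "prod_ring Y L" using assms(1) by (rule cring_prod_ring)
  have "(\<Oplus>\<^bsub>L x\<^esub>i\<in>insert i A. f i x) = f i x \<oplus>\<^bsub>L x\<^esub> (\<Oplus>\<^bsub>L x\<^esub>i\<in>A. f i x)" if "x \<in> Y" for x
  proof -
    interpret cring "L x" using assms(1) that .
    have "f j x \<in> carrier (L x)" if "j \<in> insert i A" for j
      using insert.prems[OF that] \<open>x \<in> Y\<close> by (auto simp: prod_ring_simps)
    then show ?thesis using insert.hyps by simp
  qed
  then have eq: "(\<lambda>x\<in>Y. \<Oplus>\<^bsub>L x\<^esub>i\<in>insert i A. f i x) = (\<lambda>x\<in>Y. f i x \<oplus>\<^bsub>L x\<^esub> (\<Oplus>\<^bsub>L x\<^esub>i\<in>A. f i x))"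
    by (intro restrict_ext)
  have "finsum (prod_ring Y L) f (insert i A) = f i \<oplus>\<^bsub>prod_ring Y L\<^esub> finsum (prod_ring Y L) f A"
    using insert by (intro D.finsum_insert) auto
  also have "\<dots> = f i \<oplus>\<^bsub>prod_ring Y L\<^esub> (\<lambda>x\<in>Y. \<Oplus>\<^bsub>L x\<^esub>i\<in>A. f i x)"
    by (subst insert.IH) (use insert.prems in auto)
  also have "\<dots> = (\<lambda>x\<in>Y. f i x \<oplus>\<^bsub>L x\<^esub> (\<Oplus>\<^bsub>L x\<^esub>i\<in>A. f i x))"
    unfolding prod_ring_simps by (intro restrict_ext) simp
  finally show ?case unfolding eq .
qed

text \<open>The family is bundled into one map \<open>e\<close> to matrices over the product of the
  rings \<open>L x\<close>. As \<open>R\<close> is affine, all entries lie in a Noetherian subring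
  \<open>C\<close> obtained from the image of \<open>K\<close> by adjoining the entries of finitely
  many elements. Finitely many entries of elements of \<open>I\<close> therefore generate all of
  them, and evaluation at \<open>x\<close> preserves this relation.\<close>

theorem matrix_kernels_noetherian:
  fixes R :: "('k, 'a, 'b) module_scheme" (structure) and Y :: "'x set"
  assumes alg: "assoc_algebra K R" and aff: "affine_algebra K R"
    and rep: "\<And>x. x \<in> Y \<Longrightarrow> matrix_rep K R n (L x) (\<kappa> x) (\<rho> x)"
    and I: "I \<subseteq> carrier R"
  shows "\<exists>F\<subseteq>I. finite F \<and>
    (\<forall>x\<in>Y. F \<subseteq> matrix_kernel R n (L x) (\<rho> x) \<longrightarrow> I \<subseteq> matrix_kernel R n (L x) (\<rho> x))"
proof -
  interpret assoc_algebra K R by fact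
  let ?D = "prod_ring Y L"
  have L: "cring (L x)" if "x \<in> Y" for x using rep[OF that] by (simp add: matrix_rep_def)
  interpret D: cring ?D using L by (rule cring_prod_ring)
  have \<kappa>: "\<kappa> x \<in> ring_hom K (L x)" if "x \<in> Y" for x using rep[OF that] by (simp add: matrix_rep_def)
  define k where "k = (\<lambda>c. \<lambda>x\<in>Y. \<kappa> x c)"
  define e where "e = (\<lambda>r i j. \<lambda>x\<in>Y. \<rho> x r i j)"
  have kh: "k \<in> ring_hom K ?D"
    by (rule ring_hom_memI)
      (auto simp: k_def prod_ring_simps ring_hom_closed[OF \<kappa>] ring_hom_mult[OF \<kappa>] ring_hom_add[OF \<kappa>]
        ring_hom_one[OF \<kappa>] intro!: restrict_ext)
  interpret k: ring_hom_ring K ?D k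
    by (intro ring_hom_ringI2 kh K.is_ring D.ring_axioms)
  have "subring (k ` carrier K) ?D" by (rule k.img_is_subring[OF ring.carrier_is_subring[OF K.is_ring]])
  then have N0: "noetherian_subring ?D (k ` carrier K)"
  proof (rule D.noetherian_subring_field)
    fix s assume "s \<in> k ` carrier K" "s \<noteq> \<zero>\<^bsub>?D\<^esub>"
    moreover have "k \<zero>\<^bsub>K\<^esub> = \<zero>\<^bsub>?D\<^esub>" by (rule ring_hom_zero[OF kh K.is_ring D.ring_axioms])
    ultimately obtain c where c: "c \<in> carrier K" "s = k c" "c \<noteq> \<zero>\<^bsub>K\<^esub>" by blast
    then have "c \<in> Units K" by (simp add: K.field_Units)
    then have "inv\<^bsub>K\<^esub> c \<otimes>\<^bsub>K\<^esub> c = \<one>\<^bsub>K\<^esub>" "inv\<^bsub>K\<^esub> c \<in> carrier K" by auto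
    then have "k (inv\<^bsub>K\<^esub> c) \<otimes>\<^bsub>?D\<^esub> s = \<one>\<^bsub>?D\<^esub>"
      using c by (metis k.hom_mult k.hom_one)
    then show "\<exists>t\<in>k ` carrier K. t \<otimes>\<^bsub>?D\<^esub> s = \<one>\<^bsub>?D\<^esub>" using \<open>inv\<^bsub>K\<^esub> c \<in> carrier K\<close> by blast
  qed
  obtain G where G: "finite G" "G \<subseteq> carrier R" "generated_subalgebra K R G = carrier R"
    using aff by (auto simp: affine_algebra_def)
  let ?E = "(\<lambda>(r, i, j). e r i j) ` (G \<times> {..<n} \<times> {..<n})"
  have eD: "e r i j \<in> carrier ?D" if "r \<in> carrier R" "i < n" "j < n" for r i j
    using that rep by (auto simp: e_def prod_ring_simps matrix_rep_def)
  have "finite ?E" "?E \<subseteq> carrier ?D" using G eD by auto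
  then obtain C where C: "noetherian_subring ?D C" "k ` carrier K \<union> ?E \<subseteq> C"
    using D.noetherian_subring_adjoin_finite[OF N0] by metis
  have sub: "subring C ?D" using C by (simp add: noetherian_subring_def)
  note subE = subringE[OF sub]
  \<comment> \<open>A unital subalgebra containing the generators \<open>G\<close>, hence all of
    \<open>R\<close>. Closure under scalars is where \<open>k\<close> having its values in
    \<open>C\<close> enters.\<close>
  define A where "A = {r \<in> carrier R. \<forall>i<n. \<forall>j<n. e r i j \<in> C}"
  have esum: "e (r \<oplus> s) i j = e r i j \<oplus>\<^bsub>?D\<^esub> e s i j"
    if "r \<in> carrier R" "s \<in> carrier R" "i < n" "j < n" for r s i j
    using that rep unfolding e_def prod_ring_simps by (intro restrict_ext) (simp add: matrix_rep_def)
  have esmult: "e (c \<odot> r) i j = k c \<otimes>\<^bsub>?D\<^esub> e r i j"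
    if "c \<in> carrier K" "r \<in> carrier R" "i < n" "j < n" for c r i j
    using that rep unfolding e_def k_def prod_ring_simps by (intro restrict_ext) (simp add: matrix_rep_def)
  have emult: "e (r \<otimes> s) i j = (\<Oplus>\<^bsub>?D\<^esub>l\<in>{..<n}. e r i l \<otimes>\<^bsub>?D\<^esub> e s l j)"
    if rs: "r \<in> carrier R" "s \<in> carrier R" "i < n" "j < n" for r s i j
  proof -
    have "(\<Oplus>\<^bsub>?D\<^esub>l\<in>{..<n}. e r i l \<otimes>\<^bsub>?D\<^esub> e s l j) =
        (\<lambda>x\<in>Y. \<Oplus>\<^bsub>L x\<^esub>l\<in>{..<n}. (e r i l \<otimes>\<^bsub>?D\<^esub> e s l j) x)"
      using L rs eD by (intro prod_ring_finsum) auto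
    also have "\<dots> = e (r \<otimes> s) i j"
      unfolding e_def prod_ring_simps using rep rs
      by (intro restrict_ext) (simp add: matrix_rep_def)
    finally show ?thesis ..
  qed
  have eone: "e \<one> i j = (if i = j then \<one>\<^bsub>?D\<^esub> else \<zero>\<^bsub>?D\<^esub>)" if "i < n" "j < n" for i j
    using that rep unfolding e_def prod_ring_simps by (auto intro!: restrict_ext simp: matrix_rep_def)
  have "unital_subalgebra K R A"
    unfolding unital_subalgebra_def
  proof (intro conjI subringI ballI)
    show "A \<subseteq> carrier R" by (auto simp: A_def)
    show "\<one> \<in> A" using eone subE(2,3) by (simp add: A_def)
    fix r assume r: "r \<in> A"
    show sm: "c \<odot> r \<in> A" if "c \<in> carrier K" for c
    proof -
      have "k c \<in> C" using that C by auto
      then show ?thesis using r that esmult subE(6) by (simp add: A_def)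
    qed
    have "\<ominus> r = (\<ominus>\<^bsub>K\<^esub> \<one>\<^bsub>K\<^esub>) \<odot> r" using r by (simp add: A_def smult_l_minus)
    then show "\<ominus> r \<in> A" using sm by simp
    fix s assume s: "s \<in> A"
    show "r \<oplus> s \<in> A" using r s esum subE(7) by (simp add: A_def)
    have "e (r \<otimes> s) i j \<in> C" if "i < n" "j < n" for i j
      using r s that by (subst emult) (auto simp: A_def intro!: D.subring_finsum[OF sub] subE(6))
    then show "r \<otimes> s \<in> A" using r s by (simp add: A_def)
  qed
  moreover have "G \<subseteq> A"
  proof
    fix r assume r: "r \<in> G"
    have "e r i j \<in> ?E" if "i < n" "j < n" for i j
      using r that by (intro image_eqI[of _ _ "(r, i, j)"]) auto
    moreover have "?E \<subseteq> C" using C(2) by simp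
    ultimately have "e r i j \<in> C" if "i < n" "j < n" for i j
      using that subsetD by metis
    then show "r \<in> A" using r G(2) by (simp add: A_def subsetD)
  qed
  ultimately have "generated_subalgebra K R G \<subseteq> A" unfolding generated_subalgebra_def by blast
  then have eC: "e r i j \<in> C" if "r \<in> carrier R" "i < n" "j < n" for r i j
    using that G(3) by (auto simp: A_def)
  let ?EI = "(\<lambda>(r, i, j). e r i j) ` (I \<times> {..<n} \<times> {..<n})"
  have "?EI \<subseteq> C" using eC I by auto
  then obtain F' where F': "F' \<subseteq> ?EI" "finite F'" "?EI \<subseteq> ideal_hull ?D C F'"
    using D.noetherian_subring_finite_subset[OF C(1)] by metis
  \<comment> \<open>Each generator is an entry of some element of \<open>I\<close>; the first
    components of \<open>T\<close> are those elements.\<close>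
  obtain T where T: "T \<subseteq> I \<times> {..<n} \<times> {..<n}" "finite T" "F' = (\<lambda>(r, i, j). e r i j) ` T"
    using finite_subset_image[OF F'(2,1)] by blast
  show ?thesis
  proof (intro exI[of _ "fst ` T"] conjI ballI impI)
    show "fst ` T \<subseteq> I" using T by auto
    show "finite (fst ` T)" using T by simp
    fix x assume x: "x \<in> Y" and ker: "fst ` T \<subseteq> matrix_kernel R n (L x) (\<rho> x)"
    interpret Lx: cring "L x" using L x .
    have CD: "C \<subseteq> carrier ?D" by (rule subE(1))
    \<comment> \<open>The kernel on \<open>C\<close> of evaluation at \<open>x\<close>. Being an
      ideal that contains \<open>F'\<close>, it contains the whole hull.\<close>
    have "ideal_of ?D C {c \<in> C. c x = \<zero>\<^bsub>L x\<^esub>}"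
    proof (rule ideal_ofI)
      show "s \<otimes>\<^bsub>?D\<^esub> a \<in> {c \<in> C. c x = \<zero>\<^bsub>L x\<^esub>}" if "s \<in> C" "a \<in> {c \<in> C. c x = \<zero>\<^bsub>L x\<^esub>}" for s a
      proof -
        have "s x \<in> carrier (L x)" using that(1) CD x by (auto simp: prod_ring_simps)
        then show ?thesis using that x subE(6) by (auto simp: prod_ring_simps)
      qed
    qed (use x subE(2,7) in \<open>auto simp: prod_ring_simps\<close>)
    moreover have "F' \<subseteq> {c \<in> C. c x = \<zero>\<^bsub>L x\<^esub>}"
    proof
      fix c assume "c \<in> F'"
      then obtain r i j where rij: "(r, i, j) \<in> T" "c = e r i j" using T(3) by auto
      then have "r \<in> matrix_kernel R n (L x) (\<rho> x)" "i < n" "j < n" using ker T(1) by force+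
      then show "c \<in> {c \<in> C. c x = \<zero>\<^bsub>L x\<^esub>}" using rij eC x by (auto simp: matrix_kernel_def e_def)
    qed
    ultimately have "ideal_hull ?D C F' \<subseteq> {c \<in> C. c x = \<zero>\<^bsub>L x\<^esub>}" by (rule ideal_hull_minimal)
    then have EI: "?EI \<subseteq> {c \<in> C. c x = \<zero>\<^bsub>L x\<^esub>}" using F'(3) by (rule subset_trans[rotated])
    show "I \<subseteq> matrix_kernel R n (L x) (\<rho> x)"
    proof
      fix r assume r: "r \<in> I"
      have "\<rho> x r i j = \<zero>\<^bsub>L x\<^esub>" if ij: "i < n" "j < n" for i j
      proof -
        have "e r i j \<in> ?EI" using r ij by (intro image_eqI[of _ _ "(r, i, j)"]) auto
        then have "e r i j x = \<zero>\<^bsub>L x\<^esub>" using EI by blast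
        with x show ?thesis by (simp add: e_def)
      qed
      then show "r \<in> matrix_kernel R n (L x) (\<rho> x)" using r I by (auto simp: matrix_kernel_def)
    qed
  qed
qed

section \<open>Multilinear and standard polynomials\<close>

text \<open>The sign of the permutation with one-line notation \<open>w\<close>, extended by the
  identity to all of \<open>nat\<close>. Its value lies in an arbitrary ring because the standard
  polynomial is compared in \<open>K\<close>, in \<open>R\<close> and in an operator ring.\<close>

definition standard_coeff :: "('a, 'b) ring_scheme \<Rightarrow> nat list \<Rightarrow> 'a" where
  "standard_coeff R w =
     (if evenperm (\<lambda>i. if i < length w then w ! i else i) then \<one>\<^bsub>R\<^esub> else \<ominus>\<^bsub>R\<^esub> \<one>\<^bsub>R\<^esub>)"

text \<open>A form of extension of scalars: \<open>G\<close> holds the given elements and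
  \<open>L\<close> the new scalars, which in the applications commute with \<open>G\<close> and with
  each other. The rule \<open>add\<close> turns proofs into inductions on the number of
  summands.\<close>

inductive_set span_over :: "('a, 'b) ring_scheme \<Rightarrow> 'a set \<Rightarrow> 'a set \<Rightarrow> 'a set"
  for R :: "('a, 'b) ring_scheme" and L :: "'a set" and G :: "'a set" where
  zero: "\<zero>\<^bsub>R\<^esub> \<in> span_over R L G"
| add: "g \<in> G \<Longrightarrow> l \<in> L \<Longrightarrow> t \<in> span_over R L G \<Longrightarrow> g \<otimes>\<^bsub>R\<^esub> l \<oplus>\<^bsub>R\<^esub> t \<in> span_over R L G"

lemma permutes_of_permutations_of_set:
  assumes w: "w \<in> permutations_of_set {..<N}"
  shows "(\<lambda>i. if i < length w then w ! i else i) permutes {..<N}"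
proof -
  have "distinct w" "set w = {..<N}" using w by (auto simp: permutations_of_set_def)
  then have N: "length w = N" using distinct_card[of w] by simp
  have "bij_betw (\<lambda>i. w ! i) {..<N} {..<N}"
    using \<open>distinct w\<close> \<open>set w = {..<N}\<close> N by (intro bij_betw_nth) auto
  then have "bij_betw (\<lambda>i. if i < length w then w ! i else i) {..<N} {..<N}"
    by (rule bij_betw_cong[THEN iffD1, rotated]) (simp add: N)
  then show ?thesis by (rule bij_imp_permutes) (simp add: N)
qed

section \<open>Multilinear identities under extension of scalars, and the standard
  polynomial\<close>

context ring begin

lemma finsum_Sigma:
  assumes "finite A" "\<And>a. a \<in> A \<Longrightarrow> finite (B a)" "\<And>a b. a \<in> A \<Longrightarrow> b \<in> B a \<Longrightarrow> f a b \<in> carrier R"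
  shows "(finsum R (\<lambda>(a, b). f a b) (Sigma A B)) = (\<Oplus>a\<in>A. \<Oplus>b\<in>B a. f a b)"
proof -
  have "(finsum R (\<lambda>(a, b). f a b) (Sigma A B)) = (finsum R (\<lambda>(a, b). f a b) ((\<Union>a\<in>A. Pair a ` B a)))"
    by (rule arg_cong[where f = "finsum R _"]) auto
  also have "\<dots> = (\<Oplus>a\<in>A. finsum R (\<lambda>(a, b). f a b) (Pair a ` B a))"
    using assms by (intro add.finprod_UN_disjoint) (auto simp: pairwise_def disjnt_def)
  also have "\<dots> = (\<Oplus>a\<in>A. \<Oplus>b\<in>B a. f a b)"
  proof (intro finsum_cong' refl Pi_I)
    fix a assume a: "a \<in> A"
    show "(finsum R (\<lambda>(a, b). f a b) (Pair a ` B a)) = (\<Oplus>b\<in>B a. f a b)"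
      using assms(3)[OF a] by (subst finsum_reindex) (auto simp: inj_on_def)
    show "(\<Oplus>b\<in>B a. f a b) \<in> carrier R" using assms(3)[OF a] by (intro finsum_closed) auto
  qed
  finally show ?thesis .
qed

lemma finsum_product:
  assumes "finite A" "finite B" "f \<in> A \<rightarrow> carrier R" "g \<in> B \<rightarrow> carrier R"
  shows "finsum R f A \<otimes> finsum R g B = (finsum R (\<lambda>(a, b). f a \<otimes> g b) (A \<times> B))"
proof -
  have "finsum R f A \<otimes> finsum R g B = (\<Oplus>a\<in>A. f a \<otimes> finsum R g B)"
    using assms by (intro finsum_ldistr) auto
  also have "\<dots> = (\<Oplus>a\<in>A. \<Oplus>b\<in>B. f a \<otimes> g b)"
  proof (intro finsum_cong' refl Pi_I)
    fix a assume a: "a \<in> A"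
    show "f a \<otimes> finsum R g B = (\<Oplus>b\<in>B. f a \<otimes> g b)"
      using assms a by (intro finsum_rdistr) auto
    show "(\<Oplus>b\<in>B. f a \<otimes> g b) \<in> carrier R" using assms a by (intro finsum_closed) auto
  qed
  also have "\<dots> = (finsum R (\<lambda>(a, b). f a \<otimes> g b) (A \<times> B))"
    using assms by (intro finsum_Sigma[symmetric]) auto
  finally show ?thesis .
qed

lemma word_eval_commute:
  assumes "l \<in> carrier R" "\<And>j. j \<in> set w \<Longrightarrow> r j \<in> carrier R" "\<And>j. j \<in> set w \<Longrightarrow> l \<otimes> r j = r j \<otimes> l"
  shows "l \<otimes> word_eval R r w = word_eval R r w \<otimes> l"
  using assms
proof (induction w)
  case (Cons j w)
  have c: "l \<in> carrier R" "r j \<in> carrier R" "word_eval R r w \<in> carrier R" using Cons.prems by auto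
  have "l \<otimes> (r j \<otimes> word_eval R r w) = r j \<otimes> (l \<otimes> word_eval R r w)"
    using c Cons.prems(3)[of j] by (simp add: m_assoc[symmetric])
  also have "l \<otimes> word_eval R r w = word_eval R r w \<otimes> l" using Cons by simp
  finally show ?case using c by (simp add: m_assoc)
qed simp

lemma word_eval_update_add:
  assumes "distinct w" "i \<in> set w" "\<And>j. j \<in> set w \<Longrightarrow> r j \<in> carrier R" "x \<in> carrier R" "y \<in> carrier R"
  shows "word_eval R (r(i := x \<oplus> y)) w = word_eval R (r(i := x)) w \<oplus> word_eval R (r(i := y)) w"
  using assms
proof (induction w)
  case (Cons j w)
  show ?case
  proof (cases "j = i")
    case True
    then have "i \<notin> set w" using Cons.prems by simp
    then have "word_eval R (r(i := z)) w = word_eval R r w" for z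
      by (intro word_eval_cong) auto
    then have eq: "word_eval R (r(i := z)) (j # w) = z \<otimes> word_eval R r w" for z
      unfolding word_eval_Cons True fun_upd_same by metis
    have "word_eval R r w \<in> carrier R" using Cons.prems by auto
    then show ?thesis unfolding eq using Cons.prems by (simp add: l_distr)
  next
    case False
    have "word_eval R (r(i := x \<oplus> y)) w = word_eval R (r(i := x)) w \<oplus> word_eval R (r(i := y)) w"
      by (rule Cons.IH) (use Cons.prems False in auto)
    moreover have "word_eval R (r(i := x)) w \<in> carrier R" "word_eval R (r(i := y)) w \<in> carrier R"
      "r j \<in> carrier R" using Cons.prems by auto
    ultimately show ?thesis unfolding word_eval_Cons fun_upd_other[OF False]
      by (simp only: r_distr)
  qed
qed simp

text \<open>The factor \<open>l\<close> arises in the middle of the word and is moved to the right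
  end past the values of the later letters.\<close>

lemma word_eval_update_scale:
  assumes "distinct w" "i \<in> set w" "\<And>j. j \<in> set w \<Longrightarrow> r j \<in> carrier R" "x \<in> carrier R" "l \<in> carrier R"
    and "\<And>j. j \<in> set w \<Longrightarrow> j \<noteq> i \<Longrightarrow> l \<otimes> r j = r j \<otimes> l"
  shows "word_eval R (r(i := x \<otimes> l)) w = word_eval R (r(i := x)) w \<otimes> l"
  using assms
proof (induction w)
  case (Cons j w)
  show ?case
  proof (cases "j = i")
    case True
    then have i: "i \<notin> set w" using Cons.prems by simp
    then have "word_eval R (r(i := z)) w = word_eval R r w" for z
      by (intro word_eval_cong) auto
    then have eq: "word_eval R (r(i := z)) (j # w) = z \<otimes> word_eval R r w" for z
      unfolding word_eval_Cons True fun_upd_same by metis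
    have "word_eval R r w \<in> carrier R" using Cons.prems by auto
    moreover have "l \<otimes> word_eval R r w = word_eval R r w \<otimes> l"
      using Cons.prems i by (intro word_eval_commute) auto
    ultimately show ?thesis unfolding eq using Cons.prems by (simp add: m_assoc)
  next
    case False
    have "word_eval R (r(i := x \<otimes> l)) w = word_eval R (r(i := x)) w \<otimes> l"
      by (rule Cons.IH) (use Cons.prems False in auto)
    moreover have "word_eval R (r(i := x)) w \<in> carrier R" "r j \<in> carrier R" using Cons.prems by auto
    ultimately show ?thesis unfolding word_eval_Cons fun_upd_other[OF False]
      using Cons.prems(5) by (simp only: m_assoc)
  qed
qed simp

lemma multilin_update_add:
  assumes "i \<in> S" "\<And>w. c w \<in> carrier R" "\<And>j. j \<in> S \<Longrightarrow> r j \<in> carrier R" "x \<in> carrier R" "y \<in> carrier R"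
  shows "multilin R S c (r(i := x \<oplus> y)) = multilin R S c (r(i := x)) \<oplus> multilin R S c (r(i := y))"
proof -
  have w: "distinct w" "set w = S" if "w \<in> permutations_of_set S" for w
    using that by (auto simp: permutations_of_set_def)
  have cl: "word_eval R (r(i := z)) w \<in> carrier R" if "w \<in> permutations_of_set S" "z \<in> carrier R" for w z
    using w[OF that(1)] that(2) assms by (intro word_eval_closed) auto
  have "multilin R S c (r(i := x \<oplus> y)) =
     (\<Oplus>w\<in>permutations_of_set S. c w \<otimes> word_eval R (r(i := x)) w \<oplus> c w \<otimes> word_eval R (r(i := y)) w)"
    unfolding multilin_def
  proof (intro finsum_cong' refl Pi_I)
    fix u assume u: "u \<in> permutations_of_set S"
    have "word_eval R (r(i := x \<oplus> y)) u = word_eval R (r(i := x)) u \<oplus> word_eval R (r(i := y)) u"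
      using w[OF u] assms by (intro word_eval_update_add) auto
    then show "c u \<otimes> word_eval R (r(i := x \<oplus> y)) u =
        c u \<otimes> word_eval R (r(i := x)) u \<oplus> c u \<otimes> word_eval R (r(i := y)) u"
      using cl[OF u] assms by (simp add: r_distr)
  qed (use cl assms in auto)
  also have "\<dots> = multilin R S c (r(i := x)) \<oplus> multilin R S c (r(i := y))"
    unfolding multilin_def using cl assms by (intro finsum_addf) auto
  finally show ?thesis .
qed

lemma multilin_update_scale:
  assumes "i \<in> S" "\<And>w. c w \<in> carrier R" "\<And>j. j \<in> S \<Longrightarrow> r j \<in> carrier R" "x \<in> carrier R" "l \<in> carrier R"
    and "\<And>j. j \<in> S \<Longrightarrow> j \<noteq> i \<Longrightarrow> l \<otimes> r j = r j \<otimes> l"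
  shows "multilin R S c (r(i := x \<otimes> l)) = multilin R S c (r(i := x)) \<otimes> l"
proof -
  have w: "distinct w" "set w = S" if "w \<in> permutations_of_set S" for w
    using that by (auto simp: permutations_of_set_def)
  have cl: "word_eval R (r(i := z)) w \<in> carrier R" if "w \<in> permutations_of_set S" "z \<in> carrier R" for w z
    using w[OF that(1)] that(2) assms by (intro word_eval_closed) auto
  have "multilin R S c (r(i := x \<otimes> l)) = (\<Oplus>w\<in>permutations_of_set S. (c w \<otimes> word_eval R (r(i := x)) w) \<otimes> l)"
    unfolding multilin_def
  proof (intro finsum_cong' refl Pi_I)
    fix u assume u: "u \<in> permutations_of_set S"
    have "word_eval R (r(i := x \<otimes> l)) u = word_eval R (r(i := x)) u \<otimes> l"
      using w[OF u] assms by (intro word_eval_update_scale) auto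
    then show "c u \<otimes> word_eval R (r(i := x \<otimes> l)) u = (c u \<otimes> word_eval R (r(i := x)) u) \<otimes> l"
      using cl[OF u] assms by (simp add: m_assoc)
  qed (use cl assms in auto)
  also have "\<dots> = multilin R S c (r(i := x)) \<otimes> l"
    unfolding multilin_def using cl assms by (intro finsum_ldistr[symmetric]) auto
  finally show ?thesis .
qed

lemma span_over_closed:
  assumes "L \<subseteq> carrier R" "G \<subseteq> carrier R" "t \<in> span_over R L G"
  shows "t \<in> carrier R"
  using assms(3) by induction (use assms(1,2) in auto)

lemma span_over_commute:
  assumes "L \<subseteq> carrier R" "G \<subseteq> carrier R" "t \<in> span_over R L G" "z \<in> carrier R"
    and "\<And>l. l \<in> L \<Longrightarrow> z \<otimes> l = l \<otimes> z" "\<And>g. g \<in> G \<Longrightarrow> z \<otimes> g = g \<otimes> z"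
  shows "z \<otimes> t = t \<otimes> z"
  using assms(3)
proof induction
  case (add g l t)
  have cl: "g \<in> carrier R" "l \<in> carrier R" "t \<in> carrier R" "z \<in> carrier R"
    using add assms span_over_closed[OF assms(1,2)] by auto
  have "z \<otimes> (g \<otimes> l) = g \<otimes> (z \<otimes> l)" using cl assms(6)[OF add(1)] by (simp add: m_assoc[symmetric])
  also have "z \<otimes> l = l \<otimes> z" using add by (intro assms(5))
  finally have "z \<otimes> (g \<otimes> l) = (g \<otimes> l) \<otimes> z" using cl by (simp add: m_assoc)
  then show ?case using cl add by (simp add: r_distr l_distr)
qed (use assms(4) in simp)

lemma span_over_add:
  assumes "L \<subseteq> carrier R" "G \<subseteq> carrier R" "s \<in> span_over R L G" "t \<in> span_over R L G"
  shows "s \<oplus> t \<in> span_over R L G"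
  using assms(3)
proof induction
  case (add g l s)
  have "g \<in> carrier R" "l \<in> carrier R" "s \<in> carrier R" "t \<in> carrier R"
    using add assms span_over_closed[OF assms(1,2)] by auto
  then have "g \<otimes> l \<oplus> s \<oplus> t = g \<otimes> l \<oplus> (s \<oplus> t)" by (simp add: a_assoc)
  then show ?case using span_over.add[OF add(1,2,4)] by simp
qed (use assms span_over_closed in simp)

lemma span_over_mult:
  assumes L: "L \<subseteq> carrier R" "\<And>l m. l \<in> L \<Longrightarrow> m \<in> L \<Longrightarrow> l \<otimes> m \<in> L"
    and G: "G \<subseteq> carrier R" "\<And>g h. g \<in> G \<Longrightarrow> h \<in> G \<Longrightarrow> g \<otimes> h \<in> G"
    and c: "\<And>l g. l \<in> L \<Longrightarrow> g \<in> G \<Longrightarrow> l \<otimes> g = g \<otimes> l"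
    and s: "s \<in> span_over R L G" and t: "t \<in> span_over R L G"
  shows "s \<otimes> t \<in> span_over R L G"
proof -
  have gl: "g \<otimes> l \<otimes> t \<in> span_over R L G" if "g \<in> G" "l \<in> L" for g l
    using t
  proof induction
    case zero
    have "g \<in> carrier R" "l \<in> carrier R" using that L(1) G(1) by auto
    then show ?case using span_over.zero[of R L G] by simp
  next
    case (add h m t)
    have cl: "g \<in> carrier R" "l \<in> carrier R" "h \<in> carrier R" "m \<in> carrier R" "t \<in> carrier R"
      using add that L G span_over_closed[OF L(1) G(1)] by auto
    have "g \<otimes> l \<otimes> (h \<otimes> m) = g \<otimes> (l \<otimes> h) \<otimes> m" using cl by (simp add: m_assoc)
    also have "l \<otimes> h = h \<otimes> l" using c that add by auto
    finally have "g \<otimes> l \<otimes> (h \<otimes> m \<oplus> t) = (g \<otimes> h) \<otimes> (l \<otimes> m) \<oplus> g \<otimes> l \<otimes> t"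
      using cl by (simp add: r_distr m_assoc)
    moreover have "(g \<otimes> h) \<otimes> (l \<otimes> m) \<oplus> g \<otimes> l \<otimes> t \<in> span_over R L G"
      using that add L(2) G(2) by (intro span_over.add) auto
    ultimately show ?case by simp
  qed
  have tc: "t \<in> carrier R" using span_over_closed[OF L(1) G(1) t] .
  show ?thesis using s
  proof induction
    case zero
    then show ?case using tc span_over.zero by simp
  next
    case (add g l s)
    have cl: "g \<in> carrier R" "l \<in> carrier R" "s \<in> carrier R"
      using add L G span_over_closed[OF L(1) G(1)] by auto
    then show ?case
      using span_over_add[OF L(1) G(1) gl[OF add(1,2)] add.IH] tc by (simp add: l_distr)
  qed
qed

text \<open>The variables are released from \<open>G\<close> one at a time. The value of variable
  \<open>i\<close> is a sum of terms \<open>g l\<close>; additivity separates the terms, and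
  \<open>l\<close>, which commutes with all other values, leaves on the right. Thus a multilinear
  identity survives extension of scalars.\<close>

lemma multilin_span_over:
  assumes S: "finite S" and c: "\<And>w. c w \<in> carrier R"
    and L: "L \<subseteq> carrier R" and G: "G \<subseteq> carrier R"
    and LG: "\<And>l g. l \<in> L \<Longrightarrow> g \<in> G \<Longrightarrow> l \<otimes> g = g \<otimes> l"
    and LL: "\<And>l m. l \<in> L \<Longrightarrow> m \<in> L \<Longrightarrow> l \<otimes> m = m \<otimes> l"
    and id: "\<And>r. (\<And>i. i \<in> S \<Longrightarrow> r i \<in> G) \<Longrightarrow> multilin R S c r = \<zero>"
    and r: "\<And>i. i \<in> S \<Longrightarrow> r i \<in> span_over R L G"
  shows "multilin R S c r = \<zero>"
proof -
  have Gc: "g \<in> carrier R" if "g \<in> G" for g using that G by auto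
  note cc = span_over_closed[OF L G]
  \<comment> \<open>\<open>U\<close> is the set of variables already allowed to range over the span;
    the others still take values in \<open>G\<close>.\<close>
  have claim: "multilin R S c r = \<zero>" if "finite U" "U \<subseteq> S" "\<And>i. i \<in> U \<Longrightarrow> r i \<in> span_over R L G"
    "\<And>i. i \<in> S - U \<Longrightarrow> r i \<in> G" for U r
    using that
  proof (induction U arbitrary: r)
    case empty
    then show ?case using id by auto
  next
    case (insert i U)
    have i: "i \<in> S" "U \<subseteq> S" "i \<notin> U" using insert by auto
    have rc: "r j \<in> carrier R" if "j \<in> S" for j
    proof (cases "j \<in> insert i U")
      case True then show ?thesis using insert.prems(2) cc by blast
    next
      case False then show ?thesis using insert.prems(3) that Gc by blast
    qed
    have comm: "l \<otimes> r j = r j \<otimes> l" if "l \<in> L" "j \<in> S" for l j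
    proof (cases "j \<in> insert i U")
      case True
      have "l \<in> carrier R" using that L by auto
      with span_over_commute[OF L G insert.prems(2)[OF True]] LG LL that show ?thesis by blast
    next
      case False then show ?thesis using insert.prems(3) that LG by blast
    qed
    have "multilin R S c (r(i := x)) = \<zero>" if "x \<in> span_over R L G" for x
      using that
    proof induction
      case zero
      \<comment> \<open>Vanishing at the value zero is read off the scaling law with
        \<open>l\<close> zero.\<close>
      have "multilin R S c (r(i := \<zero> \<otimes> \<zero>)) = multilin R S c (r(i := \<zero>)) \<otimes> \<zero>"
        using i(1) c rc by (intro multilin_update_scale) simp_all
      then have "multilin R S c (r(i := \<zero>)) = multilin R S c (r(i := \<zero>)) \<otimes> \<zero>"
        unfolding r_null[OF zero_closed] .
      moreover have "multilin R S c (r(i := \<zero>)) \<in> carrier R"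
        using c rc by (intro multilin_closed) simp_all
      ultimately show ?case using r_null by metis
    next
      case (add g l t)
      have g: "g \<in> carrier R" "l \<in> carrier R" "t \<in> carrier R" using add L Gc cc by auto
      have "multilin R S c (r(i := g)) = \<zero>"
      proof (rule insert.IH[OF i(2)])
        show "(r(i := g)) j \<in> span_over R L G" if "j \<in> U" for j
          using that i(3) insert.prems(2)[of j] by auto
        show "(r(i := g)) j \<in> G" if "j \<in> S - U" for j
          using that add(1) insert.prems(3)[of j] by auto
      qed
      moreover have "multilin R S c (r(i := g \<otimes> l)) = multilin R S c (r(i := g)) \<otimes> l"
        using i(1) c rc g comm[OF add(2)] by (intro multilin_update_scale) simp_all
      moreover have "multilin R S c (r(i := g \<otimes> l \<oplus> t)) = multilin R S c (r(i := g \<otimes> l)) \<oplus> multilin R S c (r(i := t))"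
        using i(1) c rc g by (intro multilin_update_add) simp_all
      ultimately show ?case using add.IH g(2) by (metis l_null l_zero zero_closed)
    qed
    from this[OF insert.prems(2)[OF insertI1]]
    show ?case unfolding fun_upd_triv .
  qed
  show ?thesis by (rule claim[OF S subset_refl]) (use r in auto)
qed

text \<open>Exchanging the letters \<open>k\<close> and \<open>l\<close> maps even permutations
  bijectively onto odd ones and does not change the value of the monomial, so terms cancel in pairs.
  Pairing, in contrast to comparing the sum with its negative, also works in characteristic
  2.\<close>

lemma multilin_standard_alternating:
  assumes kl: "k < N" "l < N" "k \<noteq> l" "r k = r l" and r: "\<And>i. i < N \<Longrightarrow> r i \<in> carrier R"
  shows "multilin R {..<N} (standard_coeff R) r = \<zero>"
proof -
  let ?P = "permutations_of_set {..<N}"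
  let ?p = "\<lambda>w i. if i < length w then w ! i else (i::nat)"
  let ?\<tau> = "transpose k l"
  define E where "E = {w \<in> ?P. evenperm (?p w)}"
  define D where "D = {w \<in> ?P. \<not> evenperm (?p w)}"
  have w: "distinct w" "set w = {..<N}" "length w = N" if "w \<in> ?P" for w
    using that distinct_card[of w] by (auto simp: permutations_of_set_def)
  have fin: "finite E" "finite D" by (simp_all add: E_def D_def)
  have \<tau>: "?\<tau> i < N \<longleftrightarrow> i < N" for i using kl by (auto simp: transpose_def)
  have mapP: "map ?\<tau> w \<in> ?P" if "w \<in> ?P" for w
  proof -
    have "?\<tau> ` {..<N} = {..<N}"
      using kl permutes_image[OF permutes_swap_id[of k "{..<N}" l]] by simp
    then show ?thesis using w[OF that] by (simp add: permutations_of_set_def distinct_map)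
  qed
  have sgn: "evenperm (?p (map ?\<tau> w)) \<longleftrightarrow> \<not> evenperm (?p w)" if "w \<in> ?P" for w
  proof -
    have "?p (map ?\<tau> w) = ?\<tau> \<circ> ?p w"
      using w[OF that] kl by (auto simp: fun_eq_iff transpose_def)
    moreover have "permutation (?p w)"
      using permutes_of_permutations_of_set[OF that] by (auto simp: permutation_permutes)
    ultimately show ?thesis using kl by (simp add: evenperm_comp permutation_swap_id evenperm_swap)
  qed
  have inv: "map ?\<tau> (map ?\<tau> w) = w" for w by (simp add: comp_def)
  have inj: "inj_on (map ?\<tau>) E" by (rule inj_on_inverseI[of _ "map ?\<tau>"]) (rule inv)
  have D: "D = map ?\<tau> ` E"
  proof
    show "map ?\<tau> ` E \<subseteq> D" using mapP sgn by (auto simp: D_def E_def)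
    show "D \<subseteq> map ?\<tau> ` E"
    proof
      fix v assume v: "v \<in> D"
      then have "map ?\<tau> v \<in> E" using mapP sgn by (simp add: D_def E_def)
      then show "v \<in> map ?\<tau> ` E" using inv[of v] by (metis imageI)
    qed
  qed
  have wc: "word_eval R r v \<in> carrier R" if "v \<in> ?P" for v
    using w[OF that] r by (intro word_eval_closed) auto
  have rt: "r (?\<tau> i) = r i" for i using kl by (auto simp: transpose_def)
  have "multilin R {..<N} (standard_coeff R) r = (\<Oplus>w\<in>E \<union> D. standard_coeff R w \<otimes> word_eval R r w)"
    unfolding multilin_def by (rule arg_cong[where f = "finsum R _"]) (auto simp: E_def D_def)
  also have "\<dots> = (\<Oplus>w\<in>E. standard_coeff R w \<otimes> word_eval R r w) \<oplus> (\<Oplus>w\<in>D. standard_coeff R w \<otimes> word_eval R r w)"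
    using fin wc by (intro finsum_Un_disjoint) (auto simp: E_def D_def standard_coeff_def)
  also have "(\<Oplus>w\<in>D. standard_coeff R w \<otimes> word_eval R r w) =
      (\<Oplus>w\<in>E. standard_coeff R (map ?\<tau> w) \<otimes> word_eval R r (map ?\<tau> w))"
    unfolding D
  proof (intro finsum_reindex inj Pi_I m_closed)
    fix w assume "w \<in> map ?\<tau> ` E"
    then have "w \<in> ?P" using D by (auto simp: D_def)
    then show "word_eval R r w \<in> carrier R" by (rule wc)
  qed (simp add: standard_coeff_def)
  also have "(\<Oplus>w\<in>E. standard_coeff R w \<otimes> word_eval R r w) \<oplus> \<dots> =
      (\<Oplus>w\<in>E. standard_coeff R w \<otimes> word_eval R r w \<oplus> standard_coeff R (map ?\<tau> w) \<otimes> word_eval R r (map ?\<tau> w))"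
    using wc mapP by (intro finsum_addf[symmetric]) (auto simp: E_def standard_coeff_def)
  also have "\<dots> = \<zero>"
  proof (rule add.finprod_one_eqI)
    fix v assume "v \<in> E"
    then have v: "v \<in> ?P" "evenperm (?p v)" by (auto simp: E_def)
    have 1: "standard_coeff R v = \<one>" using v by (simp add: standard_coeff_def)
    have "\<not> evenperm (?p (map ?\<tau> v))" using sgn[OF v(1)] v(2) by simp
    then have 2: "standard_coeff R (map ?\<tau> v) = \<ominus> \<one>" unfolding standard_coeff_def by (rule if_not_P)
    show "standard_coeff R v \<otimes> word_eval R r v \<oplus> standard_coeff R (map ?\<tau> v) \<otimes> word_eval R r (map ?\<tau> v) = \<zero>"
      unfolding 1 2 word_eval_map rt using wc[OF v(1)] by (simp add: l_minus r_neg)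
  qed
  finally show ?thesis .
qed

end

section \<open>Linearization of polynomial identities\<close>

definition multilin_identity ::
    "('k, 'c) ring_scheme \<Rightarrow> ('k, 'a, 'b) module_scheme \<Rightarrow> 'a set \<Rightarrow> nat \<Rightarrow> (nat list \<Rightarrow> 'k) \<Rightarrow> bool" where
  "multilin_identity K R I d c \<longleftrightarrow> range c \<subseteq> carrier K \<and>
     (\<forall>y. (\<forall>i<d. y i \<in> carrier R) \<longrightarrow> multilin R {..<d} (\<lambda>w. c w \<odot>\<^bsub>R\<^esub> \<one>\<^bsub>R\<^esub>) y \<in> I)"

context assoc_algebra begin

lemma smult_eq_mult: "c \<in> carrier K \<Longrightarrow> x \<in> carrier R \<Longrightarrow> c \<odot> x = (c \<odot> \<one>) \<otimes> x"
  by (simp add: smult_assoc_l)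

lemma scalar_central: "c \<in> carrier K \<Longrightarrow> c \<odot> \<one> \<in> center R"
  by (simp add: center_def smult_assoc_l smult_assoc_r)

lemma nc_eval_quotient:
  assumes I: "ideal I R" and f: "f \<in> nc_polys K" and r: "\<And>i. r i \<in> carrier R"
  shows "nc_eval K (alg_quot R I) (\<lambda>i. I +> r i) f = I +> nc_eval K R r f"
proof -
  let ?Q = "alg_quot R I"
  interpret I: ideal I R by fact
  interpret Q: assoc_algebra K ?Q using I by (rule assoc_algebra_alg_quot)
  have carr: "carrier ?Q = a_rcosets I"
    by (simp add: alg_quot_def ring.defs module.defs FactRing_def)
  have mem: "I +> x \<in> carrier ?Q" if "x \<in> carrier R" for x
    using that unfolding carr A_RCOSETS_def' by auto
  have add: "(I +> x) \<oplus>\<^bsub>?Q\<^esub> (I +> y) = I +> (x \<oplus> y)" if "x \<in> carrier R" "y \<in> carrier R" for x y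
    using that by (simp add: alg_quot_def ring.defs module.defs FactRing_def I.a_rcos_sum)
  have mult: "(I +> x) \<otimes>\<^bsub>?Q\<^esub> (I +> y) = I +> (x \<otimes> y)" if "x \<in> carrier R" "y \<in> carrier R" for x y
    using that by (simp add: alg_quot_def ring.defs module.defs FactRing_def I.rcoset_mult_add)
  have one: "\<one>\<^bsub>?Q\<^esub> = I +> \<one>"
    by (simp add: alg_quot_def ring.defs module.defs FactRing_def)
  have zero: "\<zero>\<^bsub>?Q\<^esub> = I +> \<zero>"
    by (simp add: alg_quot_def ring.defs module.defs FactRing_def I.a_rcos_const)
  have word: "word_eval ?Q (\<lambda>i. I +> r i) w = I +> word_eval R r w" for w
  proof (induction w)
    case (Cons i w)
    have "word_eval R r w \<in> carrier R" by (intro word_eval_closed r)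
    with Cons r show ?case by (simp add: mult)
  qed (simp add: one)
  have c: "f w \<in> carrier K" for w using f by (auto simp: nc_polys_def)
  have wc: "word_eval R r w \<in> carrier R" for w by (intro word_eval_closed r)
  have "(\<Oplus>\<^bsub>?Q\<^esub>w\<in>A. I +> f w \<odot> word_eval R r w) = I +> (\<Oplus>w\<in>A. f w \<odot> word_eval R r w)" if "finite A" for A
    using that
  proof induction
    case (insert w A)
    have "(\<Oplus>w\<in>A. f w \<odot> word_eval R r w) \<in> carrier R" using c wc by (intro finsum_closed) auto
    with insert c wc show ?case by (simp add: mem add)
  qed (simp add: zero)
  moreover have "finite {w. f w \<noteq> \<zero>\<^bsub>K\<^esub>}" using f by (simp add: nc_polys_def)
  ultimately show ?thesis
    unfolding nc_eval_def word alg_quot_smult[OF I c wc] by blast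
qed

text \<open>Expanding a product of sums chooses for each letter \<open>i\<close> of \<open>w\<close>
  an index \<open>j\<close> with \<open>p j = i\<close>; the word \<open>g\<close> records these
  choices.\<close>

lemma word_eval_sum_substitution:
  assumes U: "finite U" and y: "\<And>j. j \<in> U \<Longrightarrow> y j \<in> carrier R"
  shows "word_eval R (\<lambda>i. \<Oplus>j\<in>{j \<in> U. p j = i}. y j) w =
    (\<Oplus>g\<in>{g. set g \<subseteq> U \<and> map p g = w}. word_eval R y g)"
proof (induction w)
  case Nil
  have "{g. set g \<subseteq> U \<and> map p g = []} = {[]}" by auto
  then show ?case by simp
next
  case (Cons i w)
  let ?J = "{j \<in> U. p j = i}" and ?G = "{g. set g \<subseteq> U \<and> map p g = w}"
  have fin: "finite ?G"
    by (rule finite_subset[OF _ finite_lists_length_eq[OF U, of "length w"]]) auto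
  have gc: "word_eval R y g \<in> carrier R" if "set g \<subseteq> U" for g using that y by (intro word_eval_closed) auto
  have eq: "{g. set g \<subseteq> U \<and> map p g = i # w} = (\<lambda>(j, g). j # g) ` (?J \<times> ?G)"
  proof
    show "{g. set g \<subseteq> U \<and> map p g = i # w} \<subseteq> (\<lambda>(j, g). j # g) ` (?J \<times> ?G)"
    proof
      fix h assume "h \<in> {g. set g \<subseteq> U \<and> map p g = i # w}"
      then obtain j g where "h = j # g" "j \<in> U" "p j = i" "set g \<subseteq> U" "map p g = w"
        by (auto simp: map_eq_Cons_conv)
      then show "h \<in> (\<lambda>(j, g). j # g) ` (?J \<times> ?G)" by (intro image_eqI[of _ _ "(j, g)"]) auto
    qed
  qed auto
  have "word_eval R (\<lambda>i. \<Oplus>j\<in>{j \<in> U. p j = i}. y j) (i # w) = (\<Oplus>j\<in>?J. y j) \<otimes> (\<Oplus>g\<in>?G. word_eval R y g)"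
    unfolding word_eval_Cons Cons ..
  also have "\<dots> = finsum R (\<lambda>(j, g). y j \<otimes> word_eval R y g) (?J \<times> ?G)"
    using U fin y gc by (intro finsum_product) auto
  also have "\<dots> = finsum R (\<lambda>x. word_eval R y ((\<lambda>(j, g). j # g) x)) (?J \<times> ?G)"
    using y gc by (intro finsum_cong') auto
  also have "\<dots> = (\<Oplus>g\<in>(\<lambda>(j, g). j # g) ` (?J \<times> ?G). word_eval R y g)"
    using y gc by (intro finsum_reindex[symmetric]) (auto simp: inj_on_def)
  finally show ?case unfolding eq .
qed

text \<open>Substituting \<open>X\<^sub>i \<mapsto> \<Sum>{y\<^sub>j. j \<in> U, w j = i}\<close>, where \<open>w\<close> is a longest monomial of \<open>f\<close>, and
  isolating by induction on \<open>U\<close> the part in which every \<open>y\<^sub>j\<close> occurs gives a multilinear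
  identity, because no monomial of \<open>f\<close> is longer than \<open>w\<close>.\<close>

lemma PI_quotient_multilin_identity:
  assumes I: "ideal I R" and PI: "PI_algebra K (alg_quot R I)"
  shows "\<exists>d c. multilin_identity K R I d c \<and> c [0..<d] \<noteq> \<zero>\<^bsub>K\<^esub>"
proof -
  interpret I: ideal I R by fact
  obtain f where f: "f \<in> nc_polys K" "f \<noteq> (\<lambda>w. \<zero>\<^bsub>K\<^esub>)"
    and f0: "\<And>r. range r \<subseteq> carrier (alg_quot R I) \<Longrightarrow> nc_eval K (alg_quot R I) r f = \<zero>\<^bsub>alg_quot R I\<^esub>"
    using PI by (auto simp: PI_algebra_def)
  have fc: "f w \<in> carrier K" for w using f by (auto simp: nc_polys_def)
  have fI: "nc_eval K R r f \<in> I" if r: "\<And>i. r i \<in> carrier R" for r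
  proof -
    have "range (\<lambda>i. I +> r i) \<subseteq> carrier (alg_quot R I)"
      using r by (auto simp: alg_quot_def ring.defs module.defs FactRing_def A_RCOSETS_def')
    from f0[OF this] have "I +> nc_eval K R r f = I"
      unfolding nc_eval_quotient[OF I f(1) r] by (simp add: alg_quot_def ring.defs module.defs FactRing_def)
    moreover have "nc_eval K R r f \<in> carrier R"
      unfolding nc_eval_def using fc r by (intro finsum_closed) auto
    ultimately show ?thesis using I.a_rcos_self by metis
  qed
  let ?W = "{w. f w \<noteq> \<zero>\<^bsub>K\<^esub>}"
  have W: "finite ?W" "?W \<noteq> {}" using f by (auto simp: nc_polys_def)
  define d where "d = Max (length ` ?W)"
  have "d \<in> length ` ?W" unfolding d_def using W by (intro Max_in) auto
  then obtain w where w: "f w \<noteq> \<zero>\<^bsub>K\<^esub>" "length w = d" by auto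
  have len: "length v \<le> d" if "f v \<noteq> \<zero>\<^bsub>K\<^esub>" for v
    unfolding d_def using that W by (intro Max_ge) auto
  \<comment> \<open>The coefficient that a word \<open>g\<close> in the \<open>y j\<close> receives:
    under the substitution, \<open>g\<close> arises from exactly one word, namely \<open>g\<close>
    with each letter \<open>j\<close> replaced by \<open>w ! j\<close>. In particular
    \<open>c [0..<d]\<close> is \<open>f w\<close>.\<close>
  define c where "c = (\<lambda>g. f (map ((!) w) g))"
  have cc: "c g \<in> carrier K" for g using fc by (simp add: c_def)
  have clen: "length g \<le> d" if "c g \<noteq> \<zero>\<^bsub>K\<^esub>" for g
    using len[of "map ((!) w) g"] that by (simp add: c_def)
  have "multilin R {..<d} (\<lambda>w. c w \<odot> \<one>) y \<in> I" if y: "\<And>i. i < d \<Longrightarrow> y i \<in> carrier R" for y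
  proof -
    define t where "t = (\<lambda>g. (c g \<odot> \<one>) \<otimes> word_eval R y g)"
    have wc: "word_eval R y g \<in> carrier R" if "set g \<subseteq> {..<d}" for g
      using that y by (intro word_eval_closed) auto
    have tc: "t g \<in> carrier R" if "set g \<subseteq> {..<d}" for g
      unfolding t_def using wc[OF that] cc by simp
    define A where "A = (\<lambda>U. {g. set g \<subseteq> U \<and> c g \<noteq> \<zero>\<^bsub>K\<^esub>})"
    define B where "B = (\<lambda>U. {g. set g = U \<and> c g \<noteq> \<zero>\<^bsub>K\<^esub>})"
    have finA: "finite (A U)" if "U \<subseteq> {..<d}" for U
      by (rule finite_subset[OF _ finite_lists_length_le[of U d]])
        (use that finite_subset clen in \<open>auto simp: A_def\<close>)
    have finB: "finite (B U)" if "U \<subseteq> {..<d}" for U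
      by (rule finite_subset[OF _ finA[OF that]]) (auto simp: A_def B_def)
    have FI: "(\<Oplus>g\<in>A U. t g) \<in> I" if U: "U \<subseteq> {..<d}" for U
    proof -
      have finU: "finite U" using U by (rule finite_subset) simp
      define r where "r = (\<lambda>i. \<Oplus>j\<in>{j \<in> U. w ! j = i}. y j)"
      let ?G = "\<lambda>v. {g. set g \<subseteq> U \<and> map ((!) w) g = v}"
      have finG: "finite (?G v)" for v
        by (rule finite_subset[OF _ finite_lists_length_eq[OF finU, of "length v"]]) auto
      have yU: "y j \<in> carrier R" if "j \<in> U" for j using that U y by auto
      have wU: "word_eval R y g \<in> carrier R" if "g \<in> ?G v" for g v using that U by (intro wc) auto
      have tU: "t g \<in> carrier R" if "g \<in> ?G v" for g v using that U by (intro tc) auto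
      have "nc_eval K R r f = (\<Oplus>v\<in>?W. \<Oplus>g\<in>?G v. t g)"
        unfolding nc_eval_def
      proof (intro finsum_cong' refl Pi_I)
        fix v
        show "(\<Oplus>g\<in>?G v. t g) \<in> carrier R" using tU by (intro finsum_closed) blast
        have "f v \<odot> word_eval R r v = (f v \<odot> \<one>) \<otimes> (\<Oplus>g\<in>?G v. word_eval R y g)"
          unfolding r_def using word_eval_sum_substitution[OF finU yU, where p = "(!) w" and w = v] fc wU
          by (subst smult_eq_mult[symmetric]) (auto intro!: finsum_closed)
        also have "\<dots> = (\<Oplus>g\<in>?G v. (f v \<odot> \<one>) \<otimes> word_eval R y g)"
          using finG wU fc by (intro finsum_rdistr) auto
        also have "\<dots> = (\<Oplus>g\<in>?G v. t g)"
          using tU by (intro finsum_cong') (auto simp: t_def c_def)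
        finally show "f v \<odot> word_eval R r v = (\<Oplus>g\<in>?G v. t g)" .
      qed
      also have "\<dots> = (\<Oplus>g\<in>(\<Union>v\<in>?W. ?G v). t g)"
        using W finG tU by (intro add.finprod_UN_disjoint[symmetric]) (auto simp: pairwise_def disjnt_def)
      also have "(\<Union>v\<in>?W. ?G v) = A U" by (auto simp: A_def c_def)
      finally have "nc_eval K R r f = (\<Oplus>g\<in>A U. t g)" .
      moreover have "r i \<in> carrier R" for i unfolding r_def using yU by (intro finsum_closed) auto
      ultimately show ?thesis using fI by metis
    qed
    \<comment> \<open>Words over \<open>U\<close> are sorted by the set \<open>V\<close> of letters
      that occur in them. Subtracting the parts with \<open>V\<close> a proper subset, which lie in
      \<open>I\<close> by induction, leaves the part that uses every letter.\<close>
    have HI: "(\<Oplus>g\<in>B U. t g) \<in> I" if "finite U" "U \<subseteq> {..<d}" for U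
      using that
    proof (induction U rule: finite_psubset_induct)
      case (psubset U)
      have BU: "t g \<in> carrier R" if "V \<subseteq> U" "g \<in> B V" for g V
        using that psubset.prems by (intro tc) (auto simp: B_def)
      have Hc: "(\<Oplus>g\<in>B V. t g) \<in> carrier R" if "V \<subseteq> U" for V
        using BU[OF that] by (intro finsum_closed) auto
      have "(\<Oplus>g\<in>A U. t g) = (\<Oplus>g\<in>(\<Union>V\<in>Pow U. B V). t g)"
        by (rule arg_cong[where f = "finsum R _"]) (auto simp: A_def B_def)
      also have "\<dots> = (\<Oplus>V\<in>Pow U. \<Oplus>g\<in>B V. t g)"
      proof (rule add.finprod_UN_disjoint)
        show "finite (B V)" if "V \<in> Pow U" for V using that psubset.prems by (intro finB) auto
        show "pairwise (\<lambda>i j. disjnt (B i) (B j)) (Pow U)" by (auto simp: pairwise_def disjnt_def B_def)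
      qed (use psubset.hyps BU in auto)
      also have "\<dots> = (\<Oplus>V\<in>insert U (Pow U - {U}). \<Oplus>g\<in>B V. t g)"
        by (rule arg_cong[where f = "finsum R _"]) auto
      also have "\<dots> = (\<Oplus>g\<in>B U. t g) \<oplus> (\<Oplus>V\<in>Pow U - {U}. \<Oplus>g\<in>B V. t g)"
        using psubset.hyps Hc by (intro finsum_insert) auto
      finally have eq: "(\<Oplus>g\<in>A U. t g) = (\<Oplus>g\<in>B U. t g) \<oplus> (\<Oplus>V\<in>Pow U - {U}. \<Oplus>g\<in>B V. t g)" .
      have rest: "(\<Oplus>V\<in>Pow U - {U}. \<Oplus>g\<in>B V. t g) \<in> I"
      proof (rule I.finsum_mem[OF ring_axioms])
        show "(\<Oplus>g\<in>B V. t g) \<in> I" if "V \<in> Pow U - {U}" for V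
          using that psubset.prems by (intro psubset.IH) auto
      qed
      have "(\<Oplus>g\<in>B U. t g) = (\<Oplus>g\<in>A U. t g) \<oplus> \<ominus> (\<Oplus>V\<in>Pow U - {U}. \<Oplus>g\<in>B V. t g)"
        unfolding eq using Hc[of U] I.a_Hcarr[OF rest] by (simp add: a_assoc r_neg)
      also have "\<dots> \<in> I" using FI[OF psubset.prems] rest by (intro I.a_closed I.a_inv_closed)
      finally show ?case .
    qed
    have "(\<Oplus>g\<in>B {..<d}. t g) = (\<Oplus>g\<in>permutations_of_set {..<d}. t g)"
    proof (rule add.finprod_mono_neutral_cong_left)
      show "B {..<d} \<subseteq> permutations_of_set {..<d}"
      proof
        fix g assume "g \<in> B {..<d}"
        then have "set g = {..<d}" "length g \<le> d" using clen by (auto simp: B_def)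
        then have "distinct g" using card_length[of g] by (intro card_distinct) simp
        with \<open>set g = {..<d}\<close> show "g \<in> permutations_of_set {..<d}" by (simp add: permutations_of_set_def)
      qed
      show "t g = \<zero>" if "g \<in> permutations_of_set {..<d} - B {..<d}" for g
        using that wc[of g] by (auto simp: B_def permutations_of_set_def t_def)
      show "finite (permutations_of_set {..<d})" by simp
    qed (auto simp: permutations_of_set_def intro!: tc)
    with HI[of "{..<d}"] show ?thesis unfolding multilin_def t_def by simp
  qed
  moreover have "c [0..<d] = f w" using w(2) by (auto simp: c_def map_nth)
  ultimately show ?thesis unfolding multilin_identity_def using cc w(1) by (intro exI[of _ d] exI[of _ c]) auto
qed

text \<open>Allows any finite set of words, not only permutations: the proof that zero is prime uses
  the empty word and concatenations of two permutations.\<close>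

lemma PI_algebraI:
  assumes A: "finite A" "u \<in> A" and c: "\<And>w. c w \<in> carrier K" "c u \<noteq> \<zero>\<^bsub>K\<^esub>"
    and id: "\<And>r. (\<And>i. r i \<in> carrier R) \<Longrightarrow> (\<Oplus>w\<in>A. (c w \<odot> \<one>) \<otimes> word_eval R r w) = \<zero>"
  shows "PI_algebra K R"
proof -
  define f where "f = (\<lambda>w. if w \<in> A then c w else \<zero>\<^bsub>K\<^esub>)"
  have "finite {w. f w \<noteq> \<zero>\<^bsub>K\<^esub>}"
    by (rule finite_subset[OF _ A(1)]) (auto simp: f_def)
  then have "f \<in> nc_polys K" using c by (auto simp: nc_polys_def f_def)
  moreover have "f \<noteq> (\<lambda>w. \<zero>\<^bsub>K\<^esub>)"
    using A c by (auto simp: f_def fun_eq_iff intro!: exI[of _ u])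
  moreover have "nc_eval K R r f = \<zero>" if "range r \<subseteq> carrier R" for r
  proof -
    have r: "r i \<in> carrier R" for i using that by auto
    have wc: "word_eval R r w \<in> carrier R" for w by (intro word_eval_closed r)
    have "nc_eval K R r f = (\<Oplus>w\<in>A. (c w \<odot> \<one>) \<otimes> word_eval R r w)"
      unfolding nc_eval_def
    proof (rule add.finprod_mono_neutral_cong_left)
      show "(c w \<odot> \<one>) \<otimes> word_eval R r w = \<zero>" if "w \<in> A - {w. f w \<noteq> \<zero>\<^bsub>K\<^esub>}" for w
        using that wc by (auto simp: f_def)
    qed (use A c wc in \<open>auto simp: f_def smult_assoc_l split: if_splits\<close>)
    then show ?thesis using id[OF r] by simp
  qed
  ultimately show ?thesis unfolding PI_algebra_def by blast
qed

text \<open>If \<open>I J = 0\<close> with both factors nonzero, multiply an identity modulo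
  \<open>I\<close> by one modulo \<open>J\<close>: the product takes values in \<open>I J\<close>,
  so it would be an identity of \<open>R\<close>.\<close>

lemma almost_PI_zero_prime:
  assumes "almost_PI K R"
  shows "nc_prime_ideal R {\<zero>}"
  unfolding nc_prime_ideal_def
proof (intro conjI allI impI)
  show "ideal {\<zero>} R" by (rule zeroideal)
  show "{\<zero>} \<noteq> carrier R"
  proof
    assume "{\<zero>} = carrier R"
    then have "\<one> = \<zero>" using one_closed by blast
    \<comment> \<open>In the zero ring the constant polynomial \<open>1\<close> is an
      identity.\<close>
    have "PI_algebra K R"
      by (rule PI_algebraI[of "{[]}" "[]" "\<lambda>_. \<one>\<^bsub>K\<^esub>"]) (simp_all add: \<open>\<one> = \<zero>\<close>)
    then show False using assms by (simp add: almost_PI_def)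
  qed
  fix I J assume IJ: "ideal I R \<and> ideal J R \<and> I \<cdot> J \<subseteq> {\<zero>}"
  show "I \<subseteq> {\<zero>} \<or> J \<subseteq> {\<zero>}"
  proof (rule ccontr)
    assume "\<not> ?thesis"
    then have "PI_algebra K (alg_quot R I)" "PI_algebra K (alg_quot R J)"
      using assms IJ by (auto simp: almost_PI_def)
    then obtain d c e b where c: "multilin_identity K R I d c" "c [0..<d] \<noteq> \<zero>\<^bsub>K\<^esub>"
      and b: "multilin_identity K R J e b" "b [0..<e] \<noteq> \<zero>\<^bsub>K\<^esub>"
      using PI_quotient_multilin_identity IJ by metis
    have cc: "c w \<in> carrier K" "b w \<in> carrier K" for w using c b by (auto simp: multilin_identity_def)
    let ?P = "permutations_of_set {..<d}" and ?Q = "permutations_of_set {..<e}"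
    have lenP: "length w = d" if "w \<in> ?P" for w
      using that distinct_card[of w] by (auto simp: permutations_of_set_def)
    \<comment> \<open>All words of the first factor have length \<open>d\<close>, so a concatenation
      can be split again by \<open>take d\<close> and \<open>drop d\<close>. Hence no two products
      of monomials merge, although both factors use the same variables.\<close>
    define a where "a = (\<lambda>w. c (take d w) \<otimes>\<^bsub>K\<^esub> b (drop d w))"
    have "PI_algebra K R"
    proof (rule PI_algebraI[of "(\<lambda>(u, v). u @ v) ` (?P \<times> ?Q)" "[0..<d] @ [0..<e]" a])
      have "[0..<d] \<in> ?P" "[0..<e] \<in> ?Q" by (auto simp: permutations_of_set_def)
      then show "[0..<d] @ [0..<e] \<in> (\<lambda>(u, v). u @ v) ` (?P \<times> ?Q)"
        by (intro image_eqI[of _ _ "([0..<d], [0..<e])"]) auto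
      show "a w \<in> carrier K" for w using cc by (simp add: a_def)
      show "a ([0..<d] @ [0..<e]) \<noteq> \<zero>\<^bsub>K\<^esub>"
        using c(2) b(2) cc K.integral_iff by (simp add: a_def)
      fix r assume r: "\<And>i::nat. r i \<in> carrier R"
      have wc: "word_eval R r w \<in> carrier R" for w by (intro word_eval_closed r)
      let ?f = "\<lambda>w. (a w \<odot> \<one>) \<otimes> word_eval R r w"
      have fc: "?f w \<in> carrier R" for w using cc wc by (simp add: a_def)
      have "inj_on (\<lambda>(u, v). u @ v) (?P \<times> ?Q)"
        using lenP by (auto simp: inj_on_def)
      then have "(\<Oplus>w\<in>(\<lambda>(u, v). u @ v) ` (?P \<times> ?Q). ?f w) = finsum R (\<lambda>x. ?f ((\<lambda>(u, v). u @ v) x)) (?P \<times> ?Q)"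
        using fc by (intro finsum_reindex) auto
      also have "\<dots> = finsum R (\<lambda>(u, v). ((c u \<odot> \<one>) \<otimes> word_eval R r u) \<otimes> ((b v \<odot> \<one>) \<otimes> word_eval R r v)) (?P \<times> ?Q)"
      proof (intro finsum_cong' refl)
        fix x assume "x \<in> ?P \<times> ?Q"
        then obtain u v where x: "x = (u, v)" "u \<in> ?P" by auto
        have comm: "c u \<odot> (b v \<odot> z) = b v \<odot> (c u \<odot> z)" if "z \<in> carrier R" for z
          using that cc R.m_comm[of "c u" "b v"] by (simp add: smult_assoc1[symmetric])
        have "?f (u @ v) = ((c u \<otimes>\<^bsub>K\<^esub> b v) \<odot> \<one>) \<otimes> (word_eval R r u \<otimes> word_eval R r v)"
          using lenP[OF x(2)] r by (simp add: a_def word_eval_append)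
        also have "\<dots> = ((c u \<odot> \<one>) \<otimes> word_eval R r u) \<otimes> ((b v \<odot> \<one>) \<otimes> word_eval R r v)"
          using cc wc by (simp add: smult_assoc_l smult_assoc_r smult_assoc1 comm)
        finally show "?f ((\<lambda>(u, v). u @ v) x) =
            (case x of (u, v) \<Rightarrow> ((c u \<odot> \<one>) \<otimes> word_eval R r u) \<otimes> ((b v \<odot> \<one>) \<otimes> word_eval R r v))"
          using x by simp
      qed (use cc wc in auto)
      also have "\<dots> = multilin R {..<d} (\<lambda>w. c w \<odot> \<one>) r \<otimes> multilin R {..<e} (\<lambda>w. b w \<odot> \<one>) r"
        unfolding multilin_def using cc wc by (intro finsum_product[symmetric]) auto
      also have "\<dots> \<in> I \<cdot> J"
        using c(1) b(1) r by (intro ideal_prod.prod) (auto simp: multilin_identity_def)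
      finally show "(\<Oplus>w\<in>(\<lambda>(u, v). u @ v) ` (?P \<times> ?Q). ?f w) = \<zero>" using IJ by blast
    qed auto
    then show False using assms by (simp add: almost_PI_def)
  qed
qed

end

section \<open>Operators on a simple module\<close>

text \<open>Elements are extensional, so operators that agree on \<open>V\<close> are equal. A
  module over a ring appears below as a ring homomorphism into this ring.\<close>

definition End_ring :: "('v, 'm) ring_scheme \<Rightarrow> ('v \<Rightarrow> 'v) ring" where
  "End_ring V = \<lparr>carrier = {f \<in> carrier V \<rightarrow>\<^sub>E carrier V. \<forall>x\<in>carrier V. \<forall>y\<in>carrier V.
        f (x \<oplus>\<^bsub>V\<^esub> y) = f x \<oplus>\<^bsub>V\<^esub> f y},
     monoid.mult = (\<lambda>f g. \<lambda>x\<in>carrier V. f (g x)), monoid.one = (\<lambda>x\<in>carrier V. x),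
     ring.zero = (\<lambda>x\<in>carrier V. \<zero>\<^bsub>V\<^esub>), ring.add = (\<lambda>f g. \<lambda>x\<in>carrier V. f x \<oplus>\<^bsub>V\<^esub> g x)\<rparr>"

lemma End_ring_eqI:
  assumes "f \<in> carrier (End_ring V)" "g \<in> carrier (End_ring V)" "\<And>x. x \<in> carrier V \<Longrightarrow> f x = g x"
  shows "f = g"
  using assms by (intro extensionalityI[of f "carrier V" g]) (auto simp: End_ring_def PiE_def)

lemma End_ring_apply:
  "x \<in> carrier V \<Longrightarrow> (f \<otimes>\<^bsub>End_ring V\<^esub> g) x = f (g x)"
  "x \<in> carrier V \<Longrightarrow> (f \<oplus>\<^bsub>End_ring V\<^esub> g) x = f x \<oplus>\<^bsub>V\<^esub> g x"
  "x \<in> carrier V \<Longrightarrow> \<one>\<^bsub>End_ring V\<^esub> x = x"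
  "x \<in> carrier V \<Longrightarrow> \<zero>\<^bsub>End_ring V\<^esub> x = \<zero>\<^bsub>V\<^esub>"
  by (simp_all add: End_ring_def)

lemma End_ring_closed:
  "f \<in> carrier (End_ring V) \<Longrightarrow> x \<in> carrier V \<Longrightarrow> f x \<in> carrier V"
  by (auto simp: End_ring_def)

lemma End_ring_additive:
  "f \<in> carrier (End_ring V) \<Longrightarrow> x \<in> carrier V \<Longrightarrow> y \<in> carrier V \<Longrightarrow> f (x \<oplus>\<^bsub>V\<^esub> y) = f x \<oplus>\<^bsub>V\<^esub> f y"
  by (auto simp: End_ring_def)

lemma End_ring_memI:
  assumes "\<And>x. x \<in> carrier V \<Longrightarrow> f x \<in> carrier V"
    and "\<And>x y. x \<in> carrier V \<Longrightarrow> y \<in> carrier V \<Longrightarrow> f (x \<oplus>\<^bsub>V\<^esub> y) = f x \<oplus>\<^bsub>V\<^esub> f y"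
    and "f \<in> extensional (carrier V)"
  shows "f \<in> carrier (End_ring V)"
  using assms by (auto simp: End_ring_def PiE_def)

lemma (in abelian_group) ring_End_ring: "ring (End_ring G)"
proof -
  let ?E = "End_ring G"
  note eqI = End_ring_eqI[of _ G]
  note cl = End_ring_closed and ad = End_ring_additive and ap = End_ring_apply
  have ext: "f \<otimes>\<^bsub>?E\<^esub> g \<in> extensional (carrier G)" "f \<oplus>\<^bsub>?E\<^esub> g \<in> extensional (carrier G)"
    "\<one>\<^bsub>?E\<^esub> \<in> extensional (carrier G)" "\<zero>\<^bsub>?E\<^esub> \<in> extensional (carrier G)" for f g
    by (simp_all add: End_ring_def)
  have mult: "f \<otimes>\<^bsub>?E\<^esub> g \<in> carrier ?E" if "f \<in> carrier ?E" "g \<in> carrier ?E" for f g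
    using that by (intro End_ring_memI ext) (simp_all add: ap cl ad)
  have add: "f \<oplus>\<^bsub>?E\<^esub> g \<in> carrier ?E" if "f \<in> carrier ?E" "g \<in> carrier ?E" for f g
    using that by (intro End_ring_memI ext) (simp_all add: ap cl ad a_ac)
  have one: "\<one>\<^bsub>?E\<^esub> \<in> carrier ?E" by (intro End_ring_memI ext) (simp_all add: ap)
  have zero: "\<zero>\<^bsub>?E\<^esub> \<in> carrier ?E" by (intro End_ring_memI ext) (simp_all add: ap)
  show ?thesis
  proof (intro ringI abelian_groupI monoidI mult add one zero)
    fix f assume f: "f \<in> carrier ?E"
    define g where "g = (\<lambda>x\<in>carrier G. \<ominus> f x)"
    have g: "g \<in> carrier ?E"
      using f by (intro End_ring_memI) (simp_all add: g_def cl ad minus_add)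
    have "g \<oplus>\<^bsub>?E\<^esub> f = \<zero>\<^bsub>?E\<^esub>"
      using f by (intro eqI[OF add[OF g f] zero]) (simp add: ap g_def cl l_neg)
    with g show "\<exists>g\<in>carrier ?E. g \<oplus>\<^bsub>?E\<^esub> f = \<zero>\<^bsub>?E\<^esub>" by blast
    show "\<zero>\<^bsub>?E\<^esub> \<oplus>\<^bsub>?E\<^esub> f = f"
      using f by (intro eqI[OF add[OF zero f] f]) (simp add: ap cl)
    show "\<one>\<^bsub>?E\<^esub> \<otimes>\<^bsub>?E\<^esub> f = f"
      using f by (intro eqI[OF mult[OF one f] f]) (simp add: ap cl)
    show "f \<otimes>\<^bsub>?E\<^esub> \<one>\<^bsub>?E\<^esub> = f"
      using f by (intro eqI[OF mult[OF f one] f]) (simp add: ap cl)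
    fix g assume g: "g \<in> carrier ?E"
    show "f \<oplus>\<^bsub>?E\<^esub> g = g \<oplus>\<^bsub>?E\<^esub> f"
      using f g by (intro eqI[OF add[OF f g] add[OF g f]]) (simp add: ap cl a_comm)
    fix h assume h: "h \<in> carrier ?E"
    show "f \<oplus>\<^bsub>?E\<^esub> g \<oplus>\<^bsub>?E\<^esub> h = f \<oplus>\<^bsub>?E\<^esub> (g \<oplus>\<^bsub>?E\<^esub> h)"
      using f g h by (intro eqI add) (simp_all add: ap cl a_assoc)
    show "f \<otimes>\<^bsub>?E\<^esub> g \<otimes>\<^bsub>?E\<^esub> h = f \<otimes>\<^bsub>?E\<^esub> (g \<otimes>\<^bsub>?E\<^esub> h)"
      using f g h by (intro eqI mult) (simp_all add: ap cl)
    show "(f \<oplus>\<^bsub>?E\<^esub> g) \<otimes>\<^bsub>?E\<^esub> h = f \<otimes>\<^bsub>?E\<^esub> h \<oplus>\<^bsub>?E\<^esub> g \<otimes>\<^bsub>?E\<^esub> h"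
      using f g h by (intro eqI mult add) (simp_all add: ap cl)
    show "h \<otimes>\<^bsub>?E\<^esub> (f \<oplus>\<^bsub>?E\<^esub> g) = h \<otimes>\<^bsub>?E\<^esub> f \<oplus>\<^bsub>?E\<^esub> h \<otimes>\<^bsub>?E\<^esub> g"
      using f g h by (intro eqI mult add) (simp_all add: ap cl ad)
  qed
qed

definition centralizer :: "('a, 'b) ring_scheme \<Rightarrow> 'a set \<Rightarrow> 'a set" where
  "centralizer R S = {z \<in> carrier R. \<forall>x\<in>S. z \<otimes>\<^bsub>R\<^esub> x = x \<otimes>\<^bsub>R\<^esub> z}"

text \<open>Transitivity on nonzero vectors together with \<open>nontrivial\<close> says that
  \<open>V\<close> is a simple module over the operator ring \<open>S\<close>.\<close>

locale simple_operators = abelian_group V for V (structure) +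
  fixes E S
  defines E_def: "E \<equiv> End_ring V"
  assumes S: "subring S E"
    and simple: "\<lbrakk>v \<in> carrier V; v \<noteq> \<zero>; u \<in> carrier V\<rbrakk> \<Longrightarrow> \<exists>T\<in>S. T v = u"
    and nontrivial: "carrier V \<noteq> {\<zero>}"
begin

sublocale E: ring E unfolding E_def by (rule ring_End_ring)

lemma S_E: "T \<in> S \<Longrightarrow> T \<in> carrier E"
  using subringE(1)[OF S] by blast

lemmas E_eqI = End_ring_eqI[of _ V, folded E_def]
lemmas E_apply [simp] = End_ring_apply[of _ V, folded E_def]
lemmas E_closed = End_ring_closed[of _ V, folded E_def]
lemmas E_additive = End_ring_additive[of _ V, folded E_def]

lemma E_zero [simp]: "f \<in> carrier E \<Longrightarrow> f \<zero> = \<zero>"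
  using E_additive[of f \<zero> \<zero>] E_closed[of f \<zero>] by simp

lemma E_minus [simp]:
  assumes "f \<in> carrier E" "x \<in> carrier V" shows "(\<ominus>\<^bsub>E\<^esub> f) x = \<ominus> f x"
proof -
  have "(\<ominus>\<^bsub>E\<^esub> f) x \<oplus> f x = (\<ominus>\<^bsub>E\<^esub> f \<oplus>\<^bsub>E\<^esub> f) x" using assms by simp
  also have "\<dots> = \<zero>" using assms by (simp add: E.l_neg)
  finally show ?thesis using assms E_closed by (intro minus_equality[symmetric]) auto
qed

lemma E_finsum:
  assumes "finite A" "\<And>a. a \<in> A \<Longrightarrow> f a \<in> carrier E" "x \<in> carrier V"
  shows "(finsum E f A) x = (\<Oplus>a\<in>A. f a x)"
  using assms
proof (induction A)
  case (insert a A)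
  then have "f \<in> A \<rightarrow> carrier E" "(\<lambda>a. f a x) \<in> A \<rightarrow> carrier V" "f a x \<in> carrier V"
    using E_closed by auto
  with insert show ?case by simp
qed simp

text \<open>By Jacobson's density theorem this is linear independence of finitely many vectors over
  the division ring of endomorphisms commuting with \<open>S\<close>. Separating operators express
  it without that division ring.\<close>

definition indep :: "'a set \<Rightarrow> bool" where
  "indep B \<longleftrightarrow> finite B \<and> B \<subseteq> carrier V \<and>
     (\<forall>b\<in>B. \<exists>T\<in>S. T b \<noteq> \<zero> \<and> (\<forall>b'\<in>B - {b}. T b' = \<zero>))"

text \<open>An operator \<open>P\<close> separating \<open>b\<close> inside \<open>B\<close> may
  fail to kill \<open>u\<close>. As \<open>T u\<close> is nonzero, simplicity gives \<open>Q\<close>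
  with \<open>Q (T u) = P u\<close>, and \<open>P - Q T\<close> kills \<open>u\<close> without
  changing \<open>P\<close> on \<open>B\<close>, where \<open>T\<close> vanishes.\<close>

lemma indep_insert:
  assumes B: "indep B" and u: "u \<in> carrier V" and T: "T \<in> S" "T u \<noteq> \<zero>" "\<And>b. b \<in> B \<Longrightarrow> T b = \<zero>"
  shows "indep (insert u B)"
  unfolding indep_def
proof (intro conjI ballI)
  have BV: "B \<subseteq> carrier V" using B by (simp add: indep_def)
  show "finite (insert u B)" "insert u B \<subseteq> carrier V" using B u by (auto simp: indep_def)
  fix b assume b: "b \<in> insert u B"
  show "\<exists>T\<in>S. T b \<noteq> \<zero> \<and> (\<forall>b'\<in>insert u B - {b}. T b' = \<zero>)"
  proof (cases "b = u")
    case True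
    then show ?thesis using T by (intro bexI[of _ T]) auto
  next
    case False
    then have bB: "b \<in> B" using b by simp
    then obtain P where P: "P \<in> S" "P b \<noteq> \<zero>" "\<forall>b'\<in>B - {b}. P b' = \<zero>"
      using B unfolding indep_def by blast
    obtain Q where Q: "Q \<in> S" "Q (T u) = P u"
      using simple[of "T u" "P u"] T(1,2) P(1) u S_E E_closed by blast
    have PE: "P \<in> carrier E" "Q \<in> carrier E" "T \<in> carrier E" using P Q T S_E by auto
    let ?W = "P \<oplus>\<^bsub>E\<^esub> \<ominus>\<^bsub>E\<^esub> (Q \<otimes>\<^bsub>E\<^esub> T)"
    have W: "?W x = P x \<oplus> \<ominus> Q (T x)" if "x \<in> carrier V" for x
      using that PE by simp
    have "?W \<in> S"
      by (rule subringE(7)[OF S P(1) subringE(5)[OF S subringE(6)[OF S Q(1) T(1)]]])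
    moreover have "?W u = \<zero>" using W[OF u] Q(2) u PE E_closed by (simp add: r_neg)
    moreover have "?W b' = P b'" if "b' \<in> B" for b'
    proof -
      have b': "b' \<in> carrier V" using that BV by auto
      show ?thesis using W[OF b'] T(3)[OF that] PE E_closed[OF PE(1) b'] by simp
    qed
    ultimately show ?thesis using P(2,3) bB by (intro bexI[of _ ?W]) auto
  qed
qed

text \<open>Take an independent set of largest size: an operator killing it but not some
  \<open>u\<close> would allow \<open>u\<close> to be added. Operators in \<open>S\<close> are then
  determined by their values on \<open>B\<close>.\<close>

lemma ex_complete_indep:
  assumes bound: "\<And>B. indep B \<Longrightarrow> card B < d"
  obtains B where "indep B" "\<And>T. T \<in> S \<Longrightarrow> (\<And>b. b \<in> B \<Longrightarrow> T b = \<zero>) \<Longrightarrow> T = \<zero>\<^bsub>E\<^esub>"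
proof -
  have "indep {}" by (simp add: indep_def)
  moreover have "\<forall>B. indep B \<longrightarrow> card B < d" using bound by blast
  ultimately have "\<exists>B. indep B \<and> (\<forall>B'. indep B' \<longrightarrow> card B' \<le> card B)"
    by (rule ex_has_greatest_nat)
  then obtain B where B: "indep B" "\<And>B'. indep B' \<Longrightarrow> card B' \<le> card B" by blast
  show thesis
  proof (rule that[OF B(1)])
    fix T assume T: "T \<in> S" "\<And>b. b \<in> B \<Longrightarrow> T b = \<zero>"
    show "T = \<zero>\<^bsub>E\<^esub>"
    proof (rule E_eqI)
      fix u assume u: "u \<in> carrier V"
      have "T u = \<zero>"
      proof (rule ccontr)
        assume Tu: "T u \<noteq> \<zero>"
        then have "u \<notin> B" using T by auto
        moreover have "indep (insert u B)" using indep_insert[OF B(1) u T(1) Tu T(2)] .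
        ultimately show False using B(2)[of "insert u B"] B(1) by (simp add: indep_def)
      qed
      then show "T u = \<zero>\<^bsub>E\<^esub> u" using u by simp
    qed (use T S_E in auto)
  qed
qed

text \<open>A word acts from its right end, so on \<open>e k\<close> its last letter must be
  \<open>k\<close>, the one before it \<open>k - 1\<close>, and so on. Truncated subtraction makes
  \<open>T 0\<close> fix \<open>e 0\<close>, which is the final value.\<close>

lemma word_eval_shift:
  assumes e: "\<And>i. i < d \<Longrightarrow> e i \<in> carrier V"
    and T: "\<And>i. i < d \<Longrightarrow> T i \<in> carrier E"
    and Te: "\<And>i j. i < d \<Longrightarrow> j < d \<Longrightarrow> T i (e j) = (if i = j then e (i - 1) else \<zero>)"
    and "k < d" "distinct w" "set w = {..k}"
  shows "(word_eval E T w) (e k) = (if w = [0..<Suc k] then e 0 else \<zero>)"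
  using assms(4-)
proof (induction k arbitrary: w)
  case 0
  then have "length w = 1" using distinct_card[of w] by simp
  then obtain x where "w = [x]" by (auto simp: length_Suc_conv)
  with 0 have "w = [0]" by simp
  then show ?case using e[of 0] T[of 0] Te[of 0 0] 0 by simp
next
  case (Suc k)
  from Suc.prems have "w \<noteq> []" by auto
  then obtain u x where w: "w = u @ [x]" by (metis append_butlast_last_id)
  have xk: "x \<le> Suc k" and uk: "set u = {..Suc k} - {x}" using Suc.prems w by auto
  have uc: "word_eval E T u \<in> carrier E" using uk Suc.prems(1) T by (intro E.word_eval_closed) auto
  have xd: "x < d" using xk Suc.prems(1) by simp
  have "word_eval E T w = word_eval E T u \<otimes>\<^bsub>E\<^esub> T x"
    unfolding w using uk Suc.prems(1) T xd by (subst E.word_eval_append) auto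
  then have ev: "(word_eval E T w) (e (Suc k)) = (word_eval E T u) (T x (e (Suc k)))"
    using e[OF Suc.prems(1)] by simp
  show ?case
  proof (cases "x = Suc k")
    case True
    have "T x (e (Suc k)) = e k" using Te[OF xd Suc.prems(1)] True by simp
    moreover have "set u = {..k}"
    proof -
      have "{..Suc k} - {Suc k} = {..k}" by auto
      with uk True show ?thesis by simp
    qed
    ultimately have "(word_eval E T w) (e (Suc k)) = (if u = [0..<Suc k] then e 0 else \<zero>)"
      using ev Suc.IH[of u] Suc.prems w by simp
    then show ?thesis using w True by simp
  next
    case False
    then have "T x (e (Suc k)) = \<zero>" using Te[OF xd Suc.prems(1)] by simp
    moreover have "w \<noteq> [0..<Suc (Suc k)]" using w False by simp
    ultimately show ?thesis using ev uc by simp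
  qed
qed

text \<open>Kaplansky's argument: on a vector \<open>e\<^sub>k\<close>, operators shifting \<open>e\<^sub>i\<close> to \<open>e\<^sub>i\<^sub>-\<^sub>1\<close> separate the
  monomial \<open>X\<^sub>0 \<dots> X\<^sub>k\<close> of a multilinear identity from all others.\<close>

lemma indep_card_less:
  assumes c: "\<And>w. c w \<in> carrier E" "\<And>v. v \<in> carrier V \<Longrightarrow> c [0..<d] v = \<zero> \<Longrightarrow> v = \<zero>"
    and id: "\<And>r. (\<And>i. i < d \<Longrightarrow> r i \<in> S) \<Longrightarrow> multilin E {..<d} c r = \<zero>\<^bsub>E\<^esub>"
    and B: "indep B"
  shows "card B < d"
proof (cases d)
  case 0
  \<comment> \<open>For \<open>d = 0\<close> the identity is the constant \<open>c []\<close>;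
    injectivity of its action forces \<open>V\<close> to be zero.\<close>
  have "multilin E {} c undefined = \<zero>\<^bsub>E\<^esub>" using id 0 by auto
  then have c0: "c [] = \<zero>\<^bsub>E\<^esub>" using c(1) by (simp add: multilin_def)
  have "v = \<zero>" if "v \<in> carrier V" for v using c(2)[OF that] c0 0 that by simp
  then show ?thesis using nontrivial by auto
next
  case (Suc k)
  show ?thesis
  proof (rule ccontr)
    assume "\<not> card B < d"
    then obtain C where C: "C \<subseteq> B" "card C = d" by (metis not_less obtain_subset_with_card_n)
    have "finite C" using C B finite_subset by (auto simp: indep_def)
    then obtain e where e: "bij_betw e {..<d} C"
      using C(2) ex_bij_betw_nat_finite by (metis atLeast0LessThan)
    have eB: "e i \<in> B" if "i < d" for i using bij_betwE[OF e] C that by auto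
    have eV: "e i \<in> carrier V" if "i < d" for i using eB[OF that] B by (auto simp: indep_def)
    have "\<exists>T\<in>S. \<forall>j<d. T (e j) = (if i = j then e (i - 1) else \<zero>)" if i: "i < d" for i
    proof -
      obtain P where P: "P \<in> S" "P (e i) \<noteq> \<zero>" "\<forall>b'\<in>B - {e i}. P b' = \<zero>"
        using B eB[OF i] unfolding indep_def by blast
      have PV: "P (e i) \<in> carrier V" using P eV[OF i] S_E E_closed by blast
      have "i - 1 < d" using i by simp
      then obtain Q where Q: "Q \<in> S" "Q (P (e i)) = e (i - 1)"
        using simple[OF PV P(2) eV] by blast
      \<comment> \<open>\<open>P\<close> isolates \<open>e i\<close> among the chosen vectors, and
        \<open>Q\<close> moves its image to \<open>e (i - 1)\<close>.\<close>
      have "Q \<otimes>\<^bsub>E\<^esub> P \<in> S" using P Q subringE(6)[OF S] by blast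
      moreover have "(Q \<otimes>\<^bsub>E\<^esub> P) (e j) = (if i = j then e (i - 1) else \<zero>)" if j: "j < d" for j
      proof (cases "i = j")
        case False
        then have "e j \<noteq> e i" using e i j by (auto simp: bij_betw_def inj_on_def)
        then have "P (e j) = \<zero>" using P(3) eB[OF j] by simp
        then show ?thesis using False eV[OF j] Q(1) S_E by simp
      qed (use Q eV[OF j] in simp)
      ultimately show ?thesis by blast
    qed
    then obtain T where T: "\<And>i. i < d \<Longrightarrow> T i \<in> S"
      "\<And>i j. i < d \<Longrightarrow> j < d \<Longrightarrow> T i (e j) = (if i = j then e (i - 1) else \<zero>)"
      by metis
    have TE: "T i \<in> carrier E" if "i < d" for i using T(1)[OF that] S_E by blast
    let ?P = "permutations_of_set {..<d}"
    have ek: "e k \<in> carrier V" and e0: "e 0 \<in> carrier V" using eV Suc by auto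
    have P: "distinct w" "set w = {..<d}" if "w \<in> ?P" for w using that by (auto simp: permutations_of_set_def)
    have wE: "word_eval E T w \<in> carrier E" if "w \<in> ?P" for w
      using P[OF that] TE by (intro E.word_eval_closed) auto
    have "\<zero> = (multilin E {..<d} c T) (e k)" using id[of T] T(1) ek by simp
    also have "\<dots> = (\<Oplus>w\<in>?P. (c w \<otimes>\<^bsub>E\<^esub> word_eval E T w) (e k))"
      unfolding multilin_def using wE c(1) ek by (intro E_finsum) auto
    also have "\<dots> = (\<Oplus>w\<in>?P. if w = [0..<d] then c w (e 0) else \<zero>)"
    proof (intro finsum_cong' refl)
      fix w assume w: "w \<in> ?P"
      have "(word_eval E T w) (e k) = (if w = [0..<d] then e 0 else \<zero>)"
        using word_eval_shift[of d e T k w] eV TE T(2) P[OF w] Suc by (simp add: lessThan_Suc_atMost)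
      then show "(c w \<otimes>\<^bsub>E\<^esub> word_eval E T w) (e k) = (if w = [0..<d] then c w (e 0) else \<zero>)"
        using ek c(1) by simp
    qed (use c(1) e0 E_closed in auto)
    also have "\<dots> = c [0..<d] (e 0)"
    proof (rule add.finprod_singleton_swap)
      show "[0..<d] \<in> ?P" by (auto simp: permutations_of_set_def)
      show "(\<lambda>w. c w (e 0)) \<in> ?P \<rightarrow> carrier V" using c(1) e0 E_closed by auto
    qed simp
    finally have "e 0 = \<zero>" using c(2)[OF e0] by simp
    obtain P where "P \<in> S" "P (e 0) \<noteq> \<zero>" using B eB[of 0] Suc unfolding indep_def by blast
    then show False using \<open>e 0 = \<zero>\<close> S_E by simp
  qed
qed

end

section \<open>Matrix units\<close>

lemma (in ring) span_over_finsum: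
  assumes "L \<subseteq> carrier R" "G \<subseteq> carrier R" "\<And>a. a \<in> A \<Longrightarrow> f a \<in> span_over R L G"
  shows "finsum R f A \<in> span_over R L G"
  using assms(3)
proof (induction A rule: infinite_finite_induct)
  case (insert x F)
  then have "f \<in> F \<rightarrow> carrier R" "f x \<in> carrier R" using span_over_closed[OF assms(1,2)] by auto
  with insert span_over_add[OF assms(1,2)] show ?case by simp
qed (auto intro: span_over.zero)

text \<open>\<open>centralizer_subset\<close> makes the centralizer the centre of \<open>S\<close>,
  and \<open>lift\<close> says that every element of the corner at \<open>T 0 0\<close> comes from
  the centre. Thus \<open>S\<close> is a full matrix ring of size \<open>n\<close> over a
  commutative ring.\<close>

locale matrix_units = ring R for R (structure) +
  fixes S :: "'a set" and n :: nat and T :: "nat \<Rightarrow> nat \<Rightarrow> 'a"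
  assumes S: "subring S R" and n: "0 < n"
    and T: "\<lbrakk>i < n; j < n\<rbrakk> \<Longrightarrow> T i j \<in> S"
    and T_mult: "\<lbrakk>i < n; j < n; k < n; l < n\<rbrakk> \<Longrightarrow> T i j \<otimes> T k l = (if j = k then T i l else \<zero>)"
    and T_sum: "(\<Oplus>i\<in>{..<n}. T i i) = \<one>"
    and lift: "\<lbrakk>M \<in> S; T 0 0 \<otimes> M \<otimes> T 0 0 = M\<rbrakk> \<Longrightarrow> \<exists>z\<in>centralizer R S. z \<otimes> T 0 0 = M"
    and centralizer_subset: "centralizer R S \<subseteq> S"
begin

lemma S_carrier: "M \<in> S \<Longrightarrow> M \<in> carrier R"
  using subringE(1)[OF S] by blast

lemma T_carrier [simp]: "i < n \<Longrightarrow> j < n \<Longrightarrow> T i j \<in> carrier R"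
  using T S_carrier by blast

lemma T_mult_left:
  assumes "i < n" "j < n" "k < n" "l < n" "x \<in> carrier R"
  shows "T i j \<otimes> (T k l \<otimes> x) = (if j = k then T i l \<otimes> x else \<zero>)"
  using assms T_mult by (simp add: m_assoc[symmetric])

lemma centralizerD:
  assumes "z \<in> centralizer R S"
  shows "z \<in> carrier R" "z \<in> S" "x \<in> S \<Longrightarrow> z \<otimes> x = x \<otimes> z"
  using assms centralizer_subset by (auto simp: centralizer_def)

text \<open>The Peirce decomposition, with every component transported to the single corner at index
  0 so that one ring contains all matrix entries.\<close>

lemma decompose:
  assumes M: "M \<in> carrier R"
  shows "M = (\<Oplus>i\<in>{..<n}. \<Oplus>j\<in>{..<n}. T i 0 \<otimes> (T 0 i \<otimes> M \<otimes> T j 0) \<otimes> T 0 j)"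
proof -
  have "M = (\<Oplus>i\<in>{..<n}. T i i) \<otimes> M" using M T_sum by simp
  also have "\<dots> = (\<Oplus>i\<in>{..<n}. T i i \<otimes> M)" using M by (intro finsum_ldistr) auto
  also have "\<dots> = (\<Oplus>i\<in>{..<n}. \<Oplus>j\<in>{..<n}. T i 0 \<otimes> (T 0 i \<otimes> M \<otimes> T j 0) \<otimes> T 0 j)"
  proof (intro finsum_cong' refl Pi_I)
    fix i assume i: "i \<in> {..<n}"
    show "(\<Oplus>j\<in>{..<n}. T i 0 \<otimes> (T 0 i \<otimes> M \<otimes> T j 0) \<otimes> T 0 j) \<in> carrier R"
      using i n M by (intro finsum_closed) auto
    have "T i i \<otimes> M = (T i i \<otimes> M) \<otimes> (\<Oplus>j\<in>{..<n}. T j j)" using M T_sum i by simp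
    also have "\<dots> = (\<Oplus>j\<in>{..<n}. (T i i \<otimes> M) \<otimes> T j j)" using M i by (intro finsum_rdistr) auto
    also have "\<dots> = (\<Oplus>j\<in>{..<n}. T i 0 \<otimes> (T 0 i \<otimes> M \<otimes> T j 0) \<otimes> T 0 j)"
      using M i n by (intro finsum_cong') (auto simp: m_assoc T_mult T_mult_left)
    finally show "T i i \<otimes> M = (\<Oplus>j\<in>{..<n}. T i 0 \<otimes> (T 0 i \<otimes> M \<otimes> T j 0) \<otimes> T 0 j)" .
  qed
  finally show ?thesis .
qed

lemma corner_fixed:
  assumes "i < n" "j < n" "M \<in> S"
  shows "T 0 i \<otimes> M \<otimes> T j 0 \<in> S"
    and "T 0 0 \<otimes> (T 0 i \<otimes> M \<otimes> T j 0) \<otimes> T 0 0 = T 0 i \<otimes> M \<otimes> T j 0"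
  using assms n T S_carrier[OF assms(3)]
  by (auto intro!: subringE(6)[OF S] simp: m_assoc T_mult T_mult_left)

text \<open>Each corner entry in the Peirce decomposition lifts to a central \<open>z\<close>, and
  \<open>T i 0 (z T 0 0) T 0 j\<close> is \<open>T i j z\<close>.\<close>

lemma span_over_units:
  assumes M: "M \<in> S"
  shows "M \<in> span_over R (centralizer R S) {T i j | i j. i < n \<and> j < n}"
proof -
  let ?G = "{T i j | i j. i < n \<and> j < n}" and ?Z = "centralizer R S"
  have G: "?G \<subseteq> carrier R" and Z: "?Z \<subseteq> carrier R" by (auto simp: centralizer_def)
  have "T i 0 \<otimes> (T 0 i \<otimes> M \<otimes> T j 0) \<otimes> T 0 j \<in> span_over R ?Z ?G" if ij: "i < n" "j < n" for i j
  proof -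
    obtain z where z: "z \<in> ?Z" "z \<otimes> T 0 0 = T 0 i \<otimes> M \<otimes> T j 0"
      using lift[OF corner_fixed[OF ij M]] by blast
    have "T i 0 \<otimes> (T 0 i \<otimes> M \<otimes> T j 0) \<otimes> T 0 j = T i 0 \<otimes> (z \<otimes> T 0 0) \<otimes> T 0 j"
      by (simp only: z(2))
    also have "z \<otimes> T 0 0 = T 0 0 \<otimes> z" using centralizerD(3)[OF z(1)] T n by simp
    also have "T i 0 \<otimes> (T 0 0 \<otimes> z) \<otimes> T 0 j = T i 0 \<otimes> (z \<otimes> T 0 j)"
      using ij n centralizerD(1)[OF z(1)] by (simp add: m_assoc T_mult_left)
    also have "z \<otimes> T 0 j = T 0 j \<otimes> z" using centralizerD(3)[OF z(1)] T ij n by simp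
    also have "T i 0 \<otimes> (T 0 j \<otimes> z) = T i j \<otimes> z \<oplus> \<zero>"
      using ij n centralizerD(1)[OF z(1)] by (simp add: T_mult_left)
    also have "\<dots> \<in> span_over R ?Z ?G" using ij z(1) by (intro span_over.intros) auto
    finally show ?thesis .
  qed
  then show ?thesis
    by (subst decompose[OF S_carrier[OF M]]) (intro span_over_finsum[OF Z G], simp)
qed

text \<open>Multilinearity reduces the arguments to matrix units. There are at most
  \<open>n * n\<close> of these, so two of the \<open>N\<close> arguments coincide and the
  alternating property applies.\<close>

lemma standard_identity:
  assumes N: "n * n < N" and r: "\<And>i. i < N \<Longrightarrow> r i \<in> S"
  shows "multilin R {..<N} (standard_coeff R) r = \<zero>"
proof (rule multilin_span_over)
  let ?G = "{T i j | i j. i < n \<and> j < n}" and ?Z = "centralizer R S"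
  have G: "?G = (\<lambda>(i, j). T i j) ` ({..<n} \<times> {..<n})" by auto
  show "finite {..<N}" by simp
  show "standard_coeff R w \<in> carrier R" for w by (simp add: standard_coeff_def)
  show "?Z \<subseteq> carrier R" "?G \<subseteq> carrier R" by (auto simp: centralizer_def)
  show "l \<otimes> g = g \<otimes> l" if "l \<in> ?Z" "g \<in> ?G" for l g
    using that T by (auto simp: centralizer_def)
  show "l \<otimes> m = m \<otimes> l" if "l \<in> ?Z" "m \<in> ?Z" for l m
    using centralizerD(3)[OF that(1) centralizerD(2)[OF that(2)]] .
  show "r i \<in> span_over R ?Z ?G" if "i \<in> {..<N}" for i using span_over_units r that by simp
  fix s assume s: "\<And>i. i \<in> {..<N} \<Longrightarrow> s i \<in> ?G"
  have "card ?G \<le> card ({..<n} \<times> {..<n})" unfolding G by (intro card_image_le) simp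
  then have "card ?G < card {..<N}" using N by (simp add: card_cartesian_product)
  moreover have "s ` {..<N} \<subseteq> ?G" using s by blast
  moreover have "finite ?G" unfolding G by simp
  ultimately have "\<not> inj_on s {..<N}" using card_inj_on_le[of s "{..<N}" ?G] by fastforce
  then obtain k l where "k < N" "l < N" "k \<noteq> l" "s k = s l" by (auto simp: inj_on_def)
  moreover have "s i \<in> carrier R" if "i < N" for i using s[of i] that by auto
  ultimately show "multilin R {..<N} (standard_coeff R) s = \<zero>"
    by (rule multilin_standard_alternating)
qed

text \<open>The ring that will hold the matrix entries; its unit is the idempotent
  \<open>T 0 0\<close>.\<close>

definition corner :: "'a ring" where
  "corner = \<lparr>carrier = {M \<in> S. T 0 0 \<otimes> M \<otimes> T 0 0 = M}, monoid.mult = (\<otimes>), monoid.one = T 0 0,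
     ring.zero = \<zero>, ring.add = (\<oplus>)\<rparr>"

lemma corner_simps [simp]:
  "x \<otimes>\<^bsub>corner\<^esub> y = x \<otimes> y" "x \<oplus>\<^bsub>corner\<^esub> y = x \<oplus> y" "\<one>\<^bsub>corner\<^esub> = T 0 0" "\<zero>\<^bsub>corner\<^esub> = \<zero>"
  by (simp_all add: corner_def)

lemma cornerI: "M \<in> S \<Longrightarrow> T 0 0 \<otimes> M \<otimes> T 0 0 = M \<Longrightarrow> M \<in> carrier corner"
  by (simp add: corner_def)

lemma cornerD:
  assumes "M \<in> carrier corner"
  shows "M \<in> S" "M \<in> carrier R" "T 0 0 \<otimes> M = M" "M \<otimes> T 0 0 = M"
proof -
  have M: "M \<in> S" "M \<in> carrier R" "T 0 0 \<otimes> M \<otimes> T 0 0 = M" using assms S_carrier by (auto simp: corner_def)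
  then show "M \<in> S" "M \<in> carrier R" by auto
  have "T 0 0 \<otimes> (T 0 0 \<otimes> M \<otimes> T 0 0) = T 0 0 \<otimes> M \<otimes> T 0 0"
    "T 0 0 \<otimes> M \<otimes> T 0 0 \<otimes> T 0 0 = T 0 0 \<otimes> M \<otimes> T 0 0"
    using M(2) n by (simp_all add: m_assoc T_mult T_mult_left)
  then show "T 0 0 \<otimes> M = M" "M \<otimes> T 0 0 = M" unfolding M(3) .
qed

lemma cring_corner: "cring corner"
proof (intro cringI abelian_groupI comm_monoidI)
  fix x y assume x: "x \<in> carrier corner" and y: "y \<in> carrier corner"
  note xD = cornerD[OF x] and yD = cornerD[OF y]
  have p: "T 0 0 \<in> carrier R" using n by simp
  show "x \<oplus>\<^bsub>corner\<^esub> y \<in> carrier corner"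
    using xD yD p subringE(7)[OF S] by (simp add: corner_def l_distr r_distr)
  show "x \<otimes>\<^bsub>corner\<^esub> y \<in> carrier corner"
    using xD yD p subringE(6)[OF S] by (auto intro!: cornerI simp: m_assoc[symmetric]) (simp add: m_assoc)
  show "x \<oplus>\<^bsub>corner\<^esub> y = y \<oplus>\<^bsub>corner\<^esub> x" using xD yD by (simp add: a_comm)
  \<comment> \<open>Commutativity: \<open>x = z T 0 0\<close> with \<open>z\<close> central in
    \<open>S\<close>, hence \<open>x y = z y = y z = y x\<close>.\<close>
  obtain z where z: "z \<in> centralizer R S" "z \<otimes> T 0 0 = x" using lift[of x] x by (auto simp: corner_def)
  obtain w where w: "w \<in> centralizer R S" "w \<otimes> T 0 0 = y" using lift[of y] y by (auto simp: corner_def)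
  note zD = centralizerD[OF z(1)]
  have "x \<otimes> y = z \<otimes> T 0 0 \<otimes> y" by (simp only: z(2))
  also have "\<dots> = z \<otimes> (T 0 0 \<otimes> y)" by (intro m_assoc zD(1) p yD(2))
  also have "\<dots> = y \<otimes> z" unfolding yD(3) by (rule zD(3)[OF yD(1)])
  also have "\<dots> = y \<otimes> (T 0 0 \<otimes> z)" using m_assoc[OF yD(2) p zD(1)] unfolding yD(4) .
  also have "T 0 0 \<otimes> z = x" using zD(3)[of "T 0 0"] z(2) T n by simp
  finally show "x \<otimes>\<^bsub>corner\<^esub> y = y \<otimes>\<^bsub>corner\<^esub> x" by simp
  fix v assume v: "v \<in> carrier corner"
  note vD = cornerD[OF v]
  show "x \<oplus>\<^bsub>corner\<^esub> y \<oplus>\<^bsub>corner\<^esub> v = x \<oplus>\<^bsub>corner\<^esub> (y \<oplus>\<^bsub>corner\<^esub> v)"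
    using xD yD vD by (simp add: a_assoc)
  show "x \<otimes>\<^bsub>corner\<^esub> y \<otimes>\<^bsub>corner\<^esub> v = x \<otimes>\<^bsub>corner\<^esub> (y \<otimes>\<^bsub>corner\<^esub> v)"
    using xD yD vD by (simp add: m_assoc)
  show "(x \<oplus>\<^bsub>corner\<^esub> y) \<otimes>\<^bsub>corner\<^esub> v = x \<otimes>\<^bsub>corner\<^esub> v \<oplus>\<^bsub>corner\<^esub> y \<otimes>\<^bsub>corner\<^esub> v"
    using xD yD vD by (simp add: l_distr)
next
  show "\<zero>\<^bsub>corner\<^esub> \<in> carrier corner" using subringE(2)[OF S] n by (simp add: corner_def)
  show "\<one>\<^bsub>corner\<^esub> \<in> carrier corner" using n T T_mult by (simp add: corner_def)
next
  fix x assume x: "x \<in> carrier corner"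
  note xD = cornerD[OF x]
  show "\<zero>\<^bsub>corner\<^esub> \<oplus>\<^bsub>corner\<^esub> x = x" using xD by simp
  show "\<one>\<^bsub>corner\<^esub> \<otimes>\<^bsub>corner\<^esub> x = x" using xD by simp
  have "\<ominus> x \<in> carrier corner" using xD subringE(5)[OF S] n by (simp add: corner_def l_minus r_minus)
  then show "\<exists>y\<in>carrier corner. y \<oplus>\<^bsub>corner\<^esub> x = \<zero>\<^bsub>corner\<^esub>"
    using xD by (intro bexI[of _ "\<ominus> x"]) (simp_all add: l_neg)
qed

lemma corner_finsum:
  assumes "finite A" "\<And>a. a \<in> A \<Longrightarrow> f a \<in> carrier corner"
  shows "finsum corner f A = finsum R f A"
proof -
  interpret C: cring corner by (rule cring_corner)
  show ?thesis using assms
  proof (induction A)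
    case (insert a A)
    then have "f \<in> A \<rightarrow> carrier R" "f a \<in> carrier R" using cornerD by auto
    with insert show ?case by (simp add: Pi_iff)
  qed simp
qed

text \<open>Entry \<open>(i, j)\<close> of \<open>r\<close> is the Peirce component of
  \<open>h r\<close> moved to the corner. Images of scalars are central in \<open>S\<close>, so they
  act by scalar matrices, and the Peirce decomposition recovers \<open>h r\<close> from its
  entries.\<close>

theorem matrix_rep_corner:
  assumes alg: "assoc_algebra K A" and h: "h \<in> ring_hom A R" "\<And>r. r \<in> carrier A \<Longrightarrow> h r \<in> S"
    and sc: "\<And>c. c \<in> carrier K \<Longrightarrow> h (c \<odot>\<^bsub>A\<^esub> \<one>\<^bsub>A\<^esub>) \<in> centralizer R S"
  defines "\<kappa> \<equiv> \<lambda>c. h (c \<odot>\<^bsub>A\<^esub> \<one>\<^bsub>A\<^esub>) \<otimes> T 0 0" and "\<rho> \<equiv> \<lambda>r i j. T 0 i \<otimes> h r \<otimes> T j 0"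
  shows "matrix_rep K A n corner \<kappa> \<rho>"
    and "matrix_kernel A n corner \<rho> = {r \<in> carrier A. h r = \<zero>}"
proof -
  interpret A: assoc_algebra K A by fact
  have hc: "h r \<in> carrier R" if "r \<in> carrier A" for r using h(2) S_carrier that by blast
  note hm = ring_hom_mult[OF h(1)] and ha = ring_hom_add[OF h(1)]
  have p: "T 0 0 \<in> carrier R" "T 0 0 \<in> S" "T 0 0 \<otimes> T 0 0 = T 0 0" using n T T_mult by auto
  have h0: "h \<zero>\<^bsub>A\<^esub> = \<zero>" by (rule ring_hom_zero[OF h(1) A.ring_axioms ring_axioms])
  have \<rho>c: "\<rho> r i j \<in> carrier corner" if "r \<in> carrier A" "i < n" "j < n" for r i j
    unfolding \<rho>_def using that h(2) by (intro cornerI corner_fixed)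
  show "matrix_rep K A n corner \<kappa> \<rho>"
    unfolding matrix_rep_def
  proof (intro conjI allI ballI impI cring_corner \<rho>c)
    show "\<kappa> \<in> ring_hom K corner"
    proof (rule ring_hom_memI)
      fix c assume c: "c \<in> carrier K"
      let ?z = "h (c \<odot>\<^bsub>A\<^esub> \<one>\<^bsub>A\<^esub>)"
      note z = centralizerD[OF sc[OF c]]
      have zp: "?z \<otimes> T 0 0 = T 0 0 \<otimes> ?z" using z(3) p by simp
      show "\<kappa> c \<in> carrier corner"
        unfolding \<kappa>_def
      proof (rule cornerI)
        show "?z \<otimes> T 0 0 \<in> S" using z p subringE(6)[OF S] by simp
        have "?z \<otimes> T 0 0 \<otimes> T 0 0 = ?z \<otimes> T 0 0" using m_assoc[OF z(1) p(1) p(1)] p(3) by simp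
        then show "T 0 0 \<otimes> (?z \<otimes> T 0 0) \<otimes> T 0 0 = ?z \<otimes> T 0 0"
          using m_assoc[OF p(1) z(1) p(1)] zp by metis
      qed
      fix d assume d: "d \<in> carrier K"
      let ?w = "h (d \<odot>\<^bsub>A\<^esub> \<one>\<^bsub>A\<^esub>)"
      note w = centralizerD[OF sc[OF d]]
      have wp: "?w \<otimes> T 0 0 = T 0 0 \<otimes> ?w" using w(3) p by simp
      have "h ((c \<otimes>\<^bsub>K\<^esub> d) \<odot>\<^bsub>A\<^esub> \<one>\<^bsub>A\<^esub>) = ?z \<otimes> ?w"
        using c d hm[of "c \<odot>\<^bsub>A\<^esub> \<one>\<^bsub>A\<^esub>" "d \<odot>\<^bsub>A\<^esub> \<one>\<^bsub>A\<^esub>"]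
        by (simp add: A.smult_assoc_l A.smult_assoc1)
      moreover have "(?z \<otimes> T 0 0) \<otimes> (?w \<otimes> T 0 0) = ?z \<otimes> (T 0 0 \<otimes> ?w) \<otimes> T 0 0"
        using z(1) w(1) p by (simp add: m_assoc)
      moreover have "\<dots> = ?z \<otimes> ?w \<otimes> T 0 0"
        unfolding wp[symmetric] using z(1) w(1) p by (simp add: m_assoc)
      ultimately show "\<kappa> (c \<otimes>\<^bsub>K\<^esub> d) = \<kappa> c \<otimes>\<^bsub>corner\<^esub> \<kappa> d" by (simp add: \<kappa>_def)
      show "\<kappa> (c \<oplus>\<^bsub>K\<^esub> d) = \<kappa> c \<oplus>\<^bsub>corner\<^esub> \<kappa> d"
        using c d z(1) w(1) p by (simp add: \<kappa>_def A.smult_l_distr ha l_distr)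
    next
      show "\<kappa> \<one>\<^bsub>K\<^esub> = \<one>\<^bsub>corner\<^esub>" using p by (simp add: \<kappa>_def ring_hom_one[OF h(1)])
    qed
  next
    fix r s i j assume rs: "r \<in> carrier A" "s \<in> carrier A" and ij: "i < n" "j < n"
    show "\<rho> (r \<oplus>\<^bsub>A\<^esub> s) i j = \<rho> r i j \<oplus>\<^bsub>corner\<^esub> \<rho> s i j"
      using rs ij n hc by (simp add: \<rho>_def ha l_distr r_distr)
    \<comment> \<open>Matrix multiplication appears on inserting \<open>1\<close> as the sum of the
      \<open>T k k\<close>.\<close>
    have "\<rho> (r \<otimes>\<^bsub>A\<^esub> s) i j = T 0 i \<otimes> h r \<otimes> (\<Oplus>k\<in>{..<n}. T k k) \<otimes> (h s \<otimes> T j 0)"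
      unfolding T_sum using rs ij n hc by (simp add: \<rho>_def hm m_assoc)
    also have "T 0 i \<otimes> h r \<otimes> (\<Oplus>k\<in>{..<n}. T k k) = (\<Oplus>k\<in>{..<n}. T 0 i \<otimes> h r \<otimes> T k k)"
      using rs ij n hc by (intro finsum_rdistr) auto
    also have "\<dots> \<otimes> (h s \<otimes> T j 0) = (\<Oplus>k\<in>{..<n}. T 0 i \<otimes> h r \<otimes> T k k \<otimes> (h s \<otimes> T j 0))"
      using rs ij n hc by (intro finsum_ldistr) auto
    also have "\<dots> = (\<Oplus>k\<in>{..<n}. \<rho> r i k \<otimes> \<rho> s k j)"
      using rs ij n hc by (intro finsum_cong') (auto simp: \<rho>_def m_assoc T_mult_left)
    also have "\<dots> = (\<Oplus>\<^bsub>corner\<^esub>k\<in>{..<n}. \<rho> r i k \<otimes>\<^bsub>corner\<^esub> \<rho> s k j)"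
      using rs ij \<rho>c cring.cring_simprules(5)[OF cring_corner]
      by (subst corner_finsum) auto
    finally show "\<rho> (r \<otimes>\<^bsub>A\<^esub> s) i j = (\<Oplus>\<^bsub>corner\<^esub>k\<in>{..<n}. \<rho> r i k \<otimes>\<^bsub>corner\<^esub> \<rho> s k j)" .
  next
    fix c r i j assume c: "c \<in> carrier K" and r: "r \<in> carrier A" and ij: "i < n" "j < n"
    let ?z = "h (c \<odot>\<^bsub>A\<^esub> \<one>\<^bsub>A\<^esub>)"
    note z = centralizerD[OF sc[OF c]]
    have "c \<odot>\<^bsub>A\<^esub> r = (c \<odot>\<^bsub>A\<^esub> \<one>\<^bsub>A\<^esub>) \<otimes>\<^bsub>A\<^esub> r" using c r by (simp add: A.smult_assoc_l)
    then have "\<rho> (c \<odot>\<^bsub>A\<^esub> r) i j = T 0 i \<otimes> ?z \<otimes> (h r \<otimes> T j 0)"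
      using c r ij n hc by (simp add: \<rho>_def hm m_assoc)
    also have "T 0 i \<otimes> ?z = ?z \<otimes> T 0 i" using z(3) T ij n by simp
    also have "?z \<otimes> T 0 i \<otimes> (h r \<otimes> T j 0) = \<kappa> c \<otimes> \<rho> r i j"
      using z(1) r ij n hc by (simp add: \<kappa>_def \<rho>_def m_assoc T_mult_left)
    finally show "\<rho> (c \<odot>\<^bsub>A\<^esub> r) i j = \<kappa> c \<otimes>\<^bsub>corner\<^esub> \<rho> r i j" by simp
  next
    fix i j assume ij: "i < n" "j < n"
    show "\<rho> \<one>\<^bsub>A\<^esub> i j = (if i = j then \<one>\<^bsub>corner\<^esub> else \<zero>\<^bsub>corner\<^esub>)"
      using ij n by (simp add: \<rho>_def ring_hom_one[OF h(1)] T_mult)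
  qed
  show "matrix_kernel A n corner \<rho> = {r \<in> carrier A. h r = \<zero>}"
  proof (intro equalityI subsetI)
    fix r assume r: "r \<in> matrix_kernel A n corner \<rho>"
    then have rc: "r \<in> carrier A" and r0: "\<And>i j. i < n \<Longrightarrow> j < n \<Longrightarrow> T 0 i \<otimes> h r \<otimes> T j 0 = \<zero>"
      by (auto simp: matrix_kernel_def \<rho>_def)
    have "h r = (\<Oplus>i\<in>{..<n}. \<Oplus>j\<in>{..<n}. T i 0 \<otimes> (T 0 i \<otimes> h r \<otimes> T j 0) \<otimes> T 0 j)"
      using hc[OF rc] by (rule decompose)
    also have "\<dots> = \<zero>"
      using r0 n by (intro add.finprod_one_eqI) auto
    finally show "r \<in> {r \<in> carrier A. h r = \<zero>}" using rc by simp
  next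
    fix r assume "r \<in> {r \<in> carrier A. h r = \<zero>}"
    then show "r \<in> matrix_kernel A n corner \<rho>" using n by (auto simp: matrix_kernel_def \<rho>_def)
  qed
qed

end

section \<open>Matrix units from a complete independent set of vectors\<close>

context simple_operators begin

text \<open>A complete independent set \<open>e 0, ..., e (n - 1)\<close> behaves like a basis:
  operators in \<open>S\<close> are determined by their values on it, and \<open>T i j\<close> sends
  \<open>e j\<close> to \<open>e i\<close> and kills the rest. For \<open>lift\<close>, a corner
  element \<open>M\<close> gives the operator sending \<open>P (e 0)\<close> to
  \<open>P (M (e 0))\<close>, which commutes with \<open>S\<close> and so lies in \<open>S\<close>
  by \<open>cent\<close>.\<close>

lemma ex_matrix_units:
  assumes bound: "\<And>B. indep B \<Longrightarrow> card B < d" and cent: "centralizer E S \<subseteq> S"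
  shows "\<exists>n T. n < d \<and> matrix_units E S n T"
proof -
  obtain B where B: "indep B" "\<And>T. T \<in> S \<Longrightarrow> (\<And>b. b \<in> B \<Longrightarrow> T b = \<zero>) \<Longrightarrow> T = \<zero>\<^bsub>E\<^esub>"
    using ex_complete_indep[OF bound] by blast
  define n where "n = card B"
  have "finite B" using B(1) by (simp add: indep_def)
  then obtain e where e: "bij_betw e {..<n} B"
    unfolding n_def using ex_bij_betw_nat_finite by (metis atLeast0LessThan)
  have eB: "e i \<in> B" if "i < n" for i using bij_betwE[OF e] that by auto
  have eV [simp]: "e i \<in> carrier V" if "i < n" for i using eB[OF that] B(1) by (auto simp: indep_def)
  have Be: "\<exists>i<n. b = e i" if "b \<in> B" for b using e that by (auto simp: bij_betw_def)
  have ext: "M = Y" if "M \<in> S" "Y \<in> S" "\<And>i. i < n \<Longrightarrow> M (e i) = Y (e i)" for M Y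
  proof -
    have MY: "M \<in> carrier E" "Y \<in> carrier E" using that S_E by auto
    have "M \<oplus>\<^bsub>E\<^esub> \<ominus>\<^bsub>E\<^esub> Y = \<zero>\<^bsub>E\<^esub>"
    proof (rule B(2))
      show "M \<oplus>\<^bsub>E\<^esub> \<ominus>\<^bsub>E\<^esub> Y \<in> S" using that subringE(5,7)[OF S] by simp
      fix b assume "b \<in> B"
      then obtain i where i: "i < n" "b = e i" using Be by blast
      then show "(M \<oplus>\<^bsub>E\<^esub> \<ominus>\<^bsub>E\<^esub> Y) b = \<zero>" using MY that(3)[OF i(1)] E_closed[OF MY(2) eV[OF i(1)]] by (simp add: r_neg)
    qed
    then have "Y = (M \<oplus>\<^bsub>E\<^esub> \<ominus>\<^bsub>E\<^esub> Y) \<oplus>\<^bsub>E\<^esub> Y" using MY by simp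
    also have "\<dots> = M" using MY by (simp add: E.a_assoc E.l_neg)
    finally show ?thesis by simp
  qed
  \<comment> \<open>If the set were empty, all operators in \<open>S\<close> would agree, in
    particular \<open>1\<close> and \<open>0\<close>.\<close>
  have n0: "0 < n"
  proof (rule ccontr)
    assume "\<not> 0 < n"
    then have "\<one>\<^bsub>E\<^esub> = \<zero>\<^bsub>E\<^esub>" using ext[OF subringE(3,2)[OF S]] by simp
    then have "v = \<zero>" if "v \<in> carrier V" for v using E_apply(3,4)[OF that] by simp
    then show False using nontrivial by auto
  qed
  have "\<exists>M\<in>S. \<forall>k<n. M (e k) = (if j = k then e i else \<zero>)" if ij: "i < n" "j < n" for i j
  proof -
    obtain P where P: "P \<in> S" "P (e j) \<noteq> \<zero>" "\<forall>b'\<in>B - {e j}. P b' = \<zero>"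
      using B(1) eB[OF ij(2)] unfolding indep_def by blast
    have PV: "P (e j) \<in> carrier V" using P eV[OF ij(2)] S_E E_closed by blast
    obtain Q where Q: "Q \<in> S" "Q (P (e j)) = e i" using simple[OF PV P(2) eV[OF ij(1)]] by blast
    have "Q \<otimes>\<^bsub>E\<^esub> P \<in> S" using P Q subringE(6)[OF S] by blast
    moreover have "(Q \<otimes>\<^bsub>E\<^esub> P) (e k) = (if j = k then e i else \<zero>)" if k: "k < n" for k
    proof (cases "j = k")
      case False
      then have "e k \<noteq> e j" using e ij k by (auto simp: bij_betw_def inj_on_def)
      then have "P (e k) = \<zero>" using P(3) eB[OF k] by simp
      then show ?thesis using False eV[OF k] Q(1) S_E by simp
    qed (use Q eV[OF k] in simp)
    ultimately show ?thesis by blast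
  qed
  then obtain T where T: "\<And>i j. i < n \<Longrightarrow> j < n \<Longrightarrow> T i j \<in> S"
    "\<And>i j k. i < n \<Longrightarrow> j < n \<Longrightarrow> k < n \<Longrightarrow> T i j (e k) = (if j = k then e i else \<zero>)"
    by metis
  have TE: "T i j \<in> carrier E" if "i < n" "j < n" for i j using T(1)[OF that] S_E by blast
  have "matrix_units E S n T"
  proof (intro matrix_units.intro matrix_units_axioms.intro E.ring_axioms S n0 T(1) cent)
    fix i j k l assume ijkl: "i < n" "j < n" "k < n" "l < n"
    show "T i j \<otimes>\<^bsub>E\<^esub> T k l = (if j = k then T i l else \<zero>\<^bsub>E\<^esub>)"
    proof (rule ext)
      show "T i j \<otimes>\<^bsub>E\<^esub> T k l \<in> S" using ijkl T subringE(6)[OF S] by simp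
      show "(if j = k then T i l else \<zero>\<^bsub>E\<^esub>) \<in> S" using ijkl T subringE(2)[OF S] by simp
      show "(T i j \<otimes>\<^bsub>E\<^esub> T k l) (e m) = (if j = k then T i l else \<zero>\<^bsub>E\<^esub>) (e m)" if "m < n" for m
        using ijkl that T(2) TE by simp
    qed
  next
    show "(\<Oplus>\<^bsub>E\<^esub>i\<in>{..<n}. T i i) = \<one>\<^bsub>E\<^esub>"
    proof (rule ext)
      show "(\<Oplus>\<^bsub>E\<^esub>i\<in>{..<n}. T i i) \<in> S"
      proof -
        interpret SS: additive_subgroup S E
          by (rule additive_subgroup.intro[OF subring.axioms(1)[OF S]])
        show ?thesis using T(1) by (intro SS.finsum_mem E.ring_axioms) auto
      qed
      show "\<one>\<^bsub>E\<^esub> \<in> S" using subringE(3)[OF S] .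
      fix k assume k: "k < n"
      have "(\<Oplus>\<^bsub>E\<^esub>i\<in>{..<n}. T i i) (e k) = (\<Oplus>i\<in>{..<n}. T i i (e k))"
        using TE k by (intro E_finsum) auto
      also have "\<dots> = (\<Oplus>i\<in>{..<n}. if i = k then e i else \<zero>)"
        using T(2) k by (intro finsum_cong') auto
      also have "\<dots> = e k" using k by (intro add.finprod_singleton_swap) auto
      finally show "(\<Oplus>\<^bsub>E\<^esub>i\<in>{..<n}. T i i) (e k) = \<one>\<^bsub>E\<^esub> (e k)" using k by simp
    qed
  next
    fix M assume M: "M \<in> S" "T 0 0 \<otimes>\<^bsub>E\<^esub> M \<otimes>\<^bsub>E\<^esub> T 0 0 = M"
    note ME = S_E[OF M(1)]
    have Xe: "M (e 0) \<in> carrier V" by (rule E_closed[OF ME eV[OF n0]])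
    have Xe': "T 0 0 (M (e 0)) = M (e 0)"
    proof -
      have "M (e 0) = (T 0 0 \<otimes>\<^bsub>E\<^esub> M \<otimes>\<^bsub>E\<^esub> T 0 0) (e 0)" by (simp only: M(2))
      also have "\<dots> = T 0 0 (M (e 0))" using n0 T(2) by simp
      finally show ?thesis by simp
    qed
    have Xk: "M (e k) = \<zero>" if "k < n" "k \<noteq> 0" for k
    proof -
      have "M (e k) = (T 0 0 \<otimes>\<^bsub>E\<^esub> M \<otimes>\<^bsub>E\<^esub> T 0 0) (e k)" by (simp only: M(2))
      also have "\<dots> = \<zero>" using that n0 T(2) TE ME by simp
      finally show ?thesis .
    qed
    \<comment> \<open>\<open>P T 0 0\<close> and \<open>Q T 0 0\<close> agree on all
      \<open>e k\<close>, hence are equal; evaluation at \<open>M (e 0)\<close>, which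
      \<open>T 0 0\<close> fixes, gives the claim. It makes \<open>z\<close> below independent of
      the choice of \<open>P\<close>.\<close>
    have wd: "P (M (e 0)) = Q (M (e 0))" if PQ: "P \<in> S" "Q \<in> S" "P (e 0) = Q (e 0)" for P Q
    proof -
      have "P \<otimes>\<^bsub>E\<^esub> T 0 0 = Q \<otimes>\<^bsub>E\<^esub> T 0 0"
      proof (rule ext)
        show "P \<otimes>\<^bsub>E\<^esub> T 0 0 \<in> S" "Q \<otimes>\<^bsub>E\<^esub> T 0 0 \<in> S" using PQ n0 T subringE(6)[OF S] by auto
        show "(P \<otimes>\<^bsub>E\<^esub> T 0 0) (e k) = (Q \<otimes>\<^bsub>E\<^esub> T 0 0) (e k)" if "k < n" for k
          using that n0 T(2) PQ S_E by simp
      qed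
      then have "(P \<otimes>\<^bsub>E\<^esub> T 0 0) (M (e 0)) = (Q \<otimes>\<^bsub>E\<^esub> T 0 0) (M (e 0))" by simp
      then show ?thesis using Xe Xe' by simp
    qed
    have e0: "e 0 \<noteq> \<zero>"
    proof
      assume "e 0 = \<zero>"
      obtain P where "P \<in> S" "P (e 0) \<noteq> \<zero>" using B(1) eB[OF n0] unfolding indep_def by blast
      then show False using \<open>e 0 = \<zero>\<close> S_E by simp
    qed
    have "\<exists>P\<in>S. P (e 0) = v" if "v \<in> carrier V" for v using simple[OF eV[OF n0] e0 that] .
    then obtain P where P: "\<And>v. v \<in> carrier V \<Longrightarrow> P v \<in> S" "\<And>v. v \<in> carrier V \<Longrightarrow> (P v) (e 0) = v"
      by metis
    define z where "z = (\<lambda>v\<in>carrier V. (P v) (M (e 0)))"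
    have zP: "z (Q (e 0)) = Q (M (e 0))" if "Q \<in> S" for Q
    proof -
      have "Q (e 0) \<in> carrier V" by (rule E_closed[OF S_E[OF that] eV[OF n0]])
      then show ?thesis using wd[OF P(1) that P(2)] by (simp add: z_def)
    qed
    have zE: "z \<in> carrier E"
      unfolding E_def
    proof (rule End_ring_memI)
      show "z v \<in> carrier V" if "v \<in> carrier V" for v
        using that P(1) S_E Xe E_closed by (simp add: z_def)
      show "z \<in> extensional (carrier V)" by (simp add: z_def)
      fix v w assume vw: "v \<in> carrier V" "w \<in> carrier V"
      have PS: "P v \<oplus>\<^bsub>E\<^esub> P w \<in> S" using P vw subringE(7)[OF S] by simp
      have "v \<oplus> w = (P v \<oplus>\<^bsub>E\<^esub> P w) (e 0)" using vw P n0 by simp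
      then have "z (v \<oplus> w) = (P v \<oplus>\<^bsub>E\<^esub> P w) (M (e 0))" using zP[OF PS] by simp
      also have "\<dots> = z v \<oplus> z w" using vw Xe by (simp add: z_def)
      finally show "z (v \<oplus> w) = z v \<oplus> z w" .
    qed
    have "z \<otimes>\<^bsub>E\<^esub> Y = Y \<otimes>\<^bsub>E\<^esub> z" if Y: "Y \<in> S" for Y
    proof (rule E_eqI)
      fix v assume v: "v \<in> carrier V"
      have YP: "Y \<otimes>\<^bsub>E\<^esub> P v \<in> S" using Y P v subringE(6)[OF S] by simp
      have "Y v = (Y \<otimes>\<^bsub>E\<^esub> P v) (e 0)" using v P n0 by simp
      then have "z (Y v) = (Y \<otimes>\<^bsub>E\<^esub> P v) (M (e 0))" using zP[OF YP] by simp
      also have "\<dots> = Y (z v)" using v Xe by (simp add: z_def)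
      finally show "(z \<otimes>\<^bsub>E\<^esub> Y) v = (Y \<otimes>\<^bsub>E\<^esub> z) v" using v by simp
    qed (use zE Y S_E in auto)
    then have zC: "z \<in> centralizer E S" using zE by (simp add: centralizer_def)
    then have zS: "z \<in> S" using cent by blast
    have "z \<otimes>\<^bsub>E\<^esub> T 0 0 = M"
    proof (rule ext)
      show "z \<otimes>\<^bsub>E\<^esub> T 0 0 \<in> S" using zS n0 T subringE(6)[OF S] by simp
      fix k assume k: "k < n"
      have "z (e 0) = M (e 0)" using zP[OF subringE(3)[OF S]] n0 Xe by simp
      then show "(z \<otimes>\<^bsub>E\<^esub> T 0 0) (e k) = M (e k)" using k n0 T(2) Xk[of k] zE by auto
    qed (rule M(1))
    with zC show "\<exists>z\<in>centralizer E S. z \<otimes>\<^bsub>E\<^esub> T 0 0 = M" by blast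
  qed
  moreover have "n < d" using bound[OF B(1)] by (simp add: n_def)
  ultimately show ?thesis by blast
qed

end

section \<open>Simple modules with a maximal commuting set of endomorphisms\<close>

definition left_ideal :: "('a, 'b) ring_scheme \<Rightarrow> 'a set \<Rightarrow> bool" where
  "left_ideal R M \<longleftrightarrow> M \<subseteq> carrier R \<and> \<zero>\<^bsub>R\<^esub> \<in> M \<and> (\<forall>x\<in>M. \<forall>y\<in>M. x \<oplus>\<^bsub>R\<^esub> y \<in> M) \<and>
     (\<forall>r\<in>carrier R. \<forall>x\<in>M. r \<otimes>\<^bsub>R\<^esub> x \<in> M)"

lemma left_idealI:
  assumes "M \<subseteq> carrier R" "\<zero>\<^bsub>R\<^esub> \<in> M" "\<And>x y. x \<in> M \<Longrightarrow> y \<in> M \<Longrightarrow> x \<oplus>\<^bsub>R\<^esub> y \<in> M"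
    "\<And>r x. r \<in> carrier R \<Longrightarrow> x \<in> M \<Longrightarrow> r \<otimes>\<^bsub>R\<^esub> x \<in> M"
  shows "left_ideal R M"
  using assms by (simp add: left_ideal_def)

lemma left_idealD:
  assumes "left_ideal R M"
  shows "x \<in> M \<Longrightarrow> x \<in> carrier R" "\<zero>\<^bsub>R\<^esub> \<in> M" "x \<in> M \<Longrightarrow> y \<in> M \<Longrightarrow> x \<oplus>\<^bsub>R\<^esub> y \<in> M"
    "r \<in> carrier R \<Longrightarrow> x \<in> M \<Longrightarrow> r \<otimes>\<^bsub>R\<^esub> x \<in> M"
  using assms by (auto simp: left_ideal_def)

definition maximal_left_ideal :: "('a, 'b) ring_scheme \<Rightarrow> 'a set \<Rightarrow> bool" where
  "maximal_left_ideal R M \<longleftrightarrow> left_ideal R M \<and> \<one>\<^bsub>R\<^esub> \<notin> M \<and>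
     (\<forall>N. left_ideal R N \<longrightarrow> M \<subseteq> N \<longrightarrow> \<one>\<^bsub>R\<^esub> \<notin> N \<longrightarrow> N = M)"

lemma ex_maximal_left_ideal:
  assumes N: "left_ideal R N" "\<one>\<^bsub>R\<^esub> \<notin> N"
  shows "\<exists>M. maximal_left_ideal R M \<and> N \<subseteq> M"
proof -
  let ?A = "{M. left_ideal R M \<and> N \<subseteq> M \<and> \<one>\<^bsub>R\<^esub> \<notin> M}"
  have "\<exists>M\<in>?A. \<forall>Y\<in>?A. M \<subseteq> Y \<longrightarrow> Y = M"
  proof (rule subset_Zorn_nonempty)
    show "?A \<noteq> {}" using N by auto
    fix C assume C: "C \<noteq> {}" "subset.chain ?A C"
    then have CA: "\<And>M. M \<in> C \<Longrightarrow> left_ideal R M \<and> N \<subseteq> M \<and> \<one>\<^bsub>R\<^esub> \<notin> M"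
      and ch: "\<And>M M'. M \<in> C \<Longrightarrow> M' \<in> C \<Longrightarrow> M \<subseteq> M' \<or> M' \<subseteq> M"
      by (auto simp: subset_chain_def)
    have "left_ideal R (\<Union>C)"
    proof (rule left_idealI)
      show "\<Union>C \<subseteq> carrier R" using CA by (auto dest: left_idealD(1))
      show "\<zero>\<^bsub>R\<^esub> \<in> \<Union>C" using CA C(1) left_idealD(2) by blast
      show "r \<otimes>\<^bsub>R\<^esub> x \<in> \<Union>C" if "r \<in> carrier R" "x \<in> \<Union>C" for r x
        using that CA left_idealD(4) by (metis Union_iff)
      show "x \<oplus>\<^bsub>R\<^esub> y \<in> \<Union>C" if xy: "x \<in> \<Union>C" "y \<in> \<Union>C" for x y
      proof -
        obtain M M' where M: "M \<in> C" "x \<in> M" "M' \<in> C" "y \<in> M'" using xy by blast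
        then obtain M'' where "M'' \<in> C" "x \<in> M''" "y \<in> M''" using ch[OF M(1,3)] by blast
        then show ?thesis using CA left_idealD(3) by (metis Union_iff)
      qed
    qed
    then show "\<Union>C \<in> ?A" using CA C(1) by blast
  qed
  then obtain M where "M \<in> ?A" and max: "\<forall>Y\<in>?A. M \<subseteq> Y \<longrightarrow> Y = M" by (rule bexE)
  then have M: "left_ideal R M" "N \<subseteq> M" "\<one>\<^bsub>R\<^esub> \<notin> M" by simp_all
  have "maximal_left_ideal R M"
    unfolding maximal_left_ideal_def
  proof (intro conjI allI impI M)
    fix Y assume "left_ideal R Y" "M \<subseteq> Y" "\<one>\<^bsub>R\<^esub> \<notin> Y"
    with bspec[OF max, of Y] M(2) show "Y = M" by simp
  qed
  with M(2) show ?thesis by blast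
qed

context ring begin

text \<open>Provides \<open>R / M\<close> as an abelian group with an action of \<open>R\<close>;
  the properties of the map \<open>\<pi>\<close> listed here stand in for any later computation with
  cosets.\<close>

lemma left_quotient_module:
  assumes M: "left_ideal R M"
  obtains V :: "'a set ring" and h \<pi> where "abelian_group V" "h \<in> ring_hom R (End_ring V)"
    "\<pi> ` carrier R = carrier V"
    "\<And>x y. x \<in> carrier R \<Longrightarrow> y \<in> carrier R \<Longrightarrow> \<pi> (x \<oplus> y) = \<pi> x \<oplus>\<^bsub>V\<^esub> \<pi> y"
    "\<And>r x. r \<in> carrier R \<Longrightarrow> x \<in> carrier R \<Longrightarrow> h r (\<pi> x) = \<pi> (r \<otimes> x)"
    "\<And>x. x \<in> carrier R \<Longrightarrow> \<pi> x = \<zero>\<^bsub>V\<^esub> \<longleftrightarrow> x \<in> M"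
proof -
  note MD = left_idealD[OF M]
  have minus: "\<ominus> x \<in> M" if "x \<in> M" for x
    using MD(4)[of "\<ominus> \<one>" x] MD(1)[OF that] that by (simp add: l_minus)
  define \<pi> where "\<pi> = (\<lambda>x. {y \<in> carrier R. y \<oplus> \<ominus> x \<in> M})"
  have \<pi>_eq: "\<pi> x = \<pi> y \<longleftrightarrow> x \<oplus> \<ominus> y \<in> M" if xy: "x \<in> carrier R" "y \<in> carrier R" for x y
  proof
    assume "\<pi> x = \<pi> y"
    moreover have "x \<in> \<pi> x" using xy MD(2) by (simp add: \<pi>_def r_neg)
    ultimately show "x \<oplus> \<ominus> y \<in> M" by (auto simp: \<pi>_def)
  next
    assume m: "x \<oplus> \<ominus> y \<in> M"
    have "z \<oplus> \<ominus> x \<in> M \<longleftrightarrow> z \<oplus> \<ominus> y \<in> M" if z: "z \<in> carrier R" for z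
    proof -
      have "z \<oplus> \<ominus> y = (z \<oplus> \<ominus> x) \<oplus> (x \<oplus> \<ominus> y)" "z \<oplus> \<ominus> x = (z \<oplus> \<ominus> y) \<oplus> \<ominus> (x \<oplus> \<ominus> y)"
        using xy z by (simp_all add: a_assoc r_neg1 r_neg2 minus_add a_comm[of "\<ominus> x" y])
      then show ?thesis using m minus[OF m] MD(3) by metis
    qed
    then show "\<pi> x = \<pi> y" by (auto simp: \<pi>_def)
  qed
  define rep where "rep = (\<lambda>A. SOME x. x \<in> carrier R \<and> A = \<pi> x)"
  have rep: "rep (\<pi> x) \<in> carrier R \<and> \<pi> x = \<pi> (rep (\<pi> x))" if "x \<in> carrier R" for x
    unfolding rep_def using that by (intro someI_ex[of "\<lambda>y. y \<in> carrier R \<and> \<pi> x = \<pi> y"]) blast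
  have rep_diff: "x \<oplus> \<ominus> rep (\<pi> x) \<in> M" if "x \<in> carrier R" for x
    using rep[OF that] \<pi>_eq that by metis
  \<comment> \<open>Addition goes through chosen representatives. By \<open>rep_diff\<close> a
    representative differs from the given element by an element of \<open>M\<close>, so the choice
    does not affect the coset obtained.\<close>
  define V :: "'a set ring" where "V = \<lparr>carrier = \<pi> ` carrier R, monoid.mult = (\<lambda>_ _. {}), monoid.one = {},
     ring.zero = \<pi> \<zero>, ring.add = (\<lambda>A B. \<pi> (rep A \<oplus> rep B))\<rparr>"
  have carr: "carrier V = \<pi> ` carrier R" and zero: "\<zero>\<^bsub>V\<^esub> = \<pi> \<zero>" by (simp_all add: V_def)
  have add: "\<pi> x \<oplus>\<^bsub>V\<^esub> \<pi> y = \<pi> (x \<oplus> y)" if xy: "x \<in> carrier R" "y \<in> carrier R" for x y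
  proof -
    let ?x = "rep (\<pi> x)" and ?y = "rep (\<pi> y)"
    have c: "?x \<in> carrier R" "?y \<in> carrier R" using rep xy by auto
    have "(x \<oplus> \<ominus> ?x) \<oplus> (y \<oplus> \<ominus> ?y) \<in> M" using rep_diff xy MD(3) by blast
    also have "(x \<oplus> \<ominus> ?x) \<oplus> (y \<oplus> \<ominus> ?y) = (x \<oplus> y) \<oplus> \<ominus> (?x \<oplus> ?y)"
      using xy c by (simp add: minus_add a_ac)
    finally have "\<pi> (x \<oplus> y) = \<pi> (?x \<oplus> ?y)" using xy c by (subst \<pi>_eq) auto
    then show ?thesis by (simp add: V_def)
  qed
  have V: "abelian_group V"
  proof (rule abelian_groupI)
    show "\<zero>\<^bsub>V\<^esub> \<in> carrier V" by (simp add: carr zero)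
    fix A assume "A \<in> carrier V"
    then obtain x where x: "x \<in> carrier R" "A = \<pi> x" by (auto simp: carr)
    show "\<zero>\<^bsub>V\<^esub> \<oplus>\<^bsub>V\<^esub> A = A" using x by (simp add: zero add)
    show "\<exists>B\<in>carrier V. B \<oplus>\<^bsub>V\<^esub> A = \<zero>\<^bsub>V\<^esub>"
      using x by (intro bexI[of _ "\<pi> (\<ominus> x)"]) (simp_all add: add zero carr l_neg)
    fix B assume "B \<in> carrier V"
    then obtain y where y: "y \<in> carrier R" "B = \<pi> y" by (auto simp: carr)
    show "A \<oplus>\<^bsub>V\<^esub> B \<in> carrier V" using x y by (simp add: add carr)
    show "A \<oplus>\<^bsub>V\<^esub> B = B \<oplus>\<^bsub>V\<^esub> A" using x y by (simp add: add a_comm)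
    fix C assume "C \<in> carrier V"
    then obtain z where z: "z \<in> carrier R" "C = \<pi> z" by (auto simp: carr)
    show "A \<oplus>\<^bsub>V\<^esub> B \<oplus>\<^bsub>V\<^esub> C = A \<oplus>\<^bsub>V\<^esub> (B \<oplus>\<^bsub>V\<^esub> C)" using x y z by (simp add: add a_assoc)
  qed
  define h where "h = (\<lambda>r. \<lambda>A\<in>carrier V. \<pi> (r \<otimes> rep A))"
  have h: "h r (\<pi> x) = \<pi> (r \<otimes> x)" if rx: "r \<in> carrier R" "x \<in> carrier R" for r x
  proof -
    have c: "rep (\<pi> x) \<in> carrier R" using rep rx by auto
    have "r \<otimes> (x \<oplus> \<ominus> rep (\<pi> x)) \<in> M" using rep_diff rx MD(4) by blast
    also have "r \<otimes> (x \<oplus> \<ominus> rep (\<pi> x)) = r \<otimes> x \<oplus> \<ominus> (r \<otimes> rep (\<pi> x))"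
      using rx c by (simp add: r_distr r_minus)
    finally have "\<pi> (r \<otimes> x) = \<pi> (r \<otimes> rep (\<pi> x))" using rx c by (subst \<pi>_eq) auto
    then show ?thesis using rx by (simp add: h_def carr)
  qed
  interpret V: abelian_group V by fact
  interpret E: ring "End_ring V" by (rule V.ring_End_ring)
  have hE: "h r \<in> carrier (End_ring V)" if r: "r \<in> carrier R" for r
  proof (rule End_ring_memI)
    show "h r \<in> extensional (carrier V)" by (simp add: h_def)
    show "h r A \<in> carrier V" if "A \<in> carrier V" for A using that r h by (auto simp: carr)
    show "h r (A \<oplus>\<^bsub>V\<^esub> B) = h r A \<oplus>\<^bsub>V\<^esub> h r B" if "A \<in> carrier V" "B \<in> carrier V" for A B
      using that r by (auto simp: carr add h r_distr)
  qed
  note ap = End_ring_apply[of _ V]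
  have "h \<in> ring_hom R (End_ring V)"
  proof (rule ring_hom_memI)
    fix r s assume rs: "r \<in> carrier R" "s \<in> carrier R"
    show "h r \<in> carrier (End_ring V)" using hE rs by simp
    show "h (r \<otimes> s) = h r \<otimes>\<^bsub>End_ring V\<^esub> h s"
    proof (rule End_ring_eqI[of _ V])
      show "h (r \<otimes> s) A = (h r \<otimes>\<^bsub>End_ring V\<^esub> h s) A" if A: "A \<in> carrier V" for A
        unfolding ap(1)[OF A] using A rs by (auto simp: carr h m_assoc)
    qed (use hE rs in auto)
    show "h (r \<oplus> s) = h r \<oplus>\<^bsub>End_ring V\<^esub> h s"
    proof (rule End_ring_eqI[of _ V])
      show "h (r \<oplus> s) A = (h r \<oplus>\<^bsub>End_ring V\<^esub> h s) A" if A: "A \<in> carrier V" for A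
        unfolding ap(2)[OF A] using A rs by (auto simp: carr h add l_distr)
    qed (use hE rs in auto)
  next
    show "h \<one> = \<one>\<^bsub>End_ring V\<^esub>"
    proof (rule End_ring_eqI[of _ V])
      show "h \<one> A = \<one>\<^bsub>End_ring V\<^esub> A" if A: "A \<in> carrier V" for A
        unfolding ap(3)[OF A] using A by (auto simp: carr h)
    qed (use hE in auto)
  qed
  moreover have "\<pi> x = \<zero>\<^bsub>V\<^esub> \<longleftrightarrow> x \<in> M" if "x \<in> carrier R" for x using that by (simp add: zero \<pi>_eq)
  ultimately show thesis
    by (intro that[OF V _ carr[symmetric] add[symmetric] h])
qed

text \<open>\<open>M + R x\<close> is a left ideal properly containing \<open>M\<close>, so
  \<open>1 = m + r x\<close> with \<open>m\<close> in \<open>M\<close>; multiply by \<open>y\<close>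
  on the left. This is the simplicity of the module \<open>R / M\<close>.\<close>

lemma maximal_left_ideal_transitive:
  assumes M: "maximal_left_ideal R M" and x: "x \<in> carrier R" "x \<notin> M" and y: "y \<in> carrier R"
  shows "\<exists>r\<in>carrier R. y \<oplus> \<ominus> (r \<otimes> x) \<in> M"
proof -
  have Ml: "left_ideal R M" using M by (simp add: maximal_left_ideal_def)
  note MD = left_idealD[OF Ml]
  define N where "N = {m \<oplus> r \<otimes> x | m r. m \<in> M \<and> r \<in> carrier R}"
  have NI: "m \<oplus> r \<otimes> x \<in> N" if "m \<in> M" "r \<in> carrier R" for m r using that by (auto simp: N_def)
  have "left_ideal R N"
  proof (rule left_idealI)
    show "N \<subseteq> carrier R" using MD(1) x by (auto simp: N_def)
    show "\<zero> \<in> N" using NI[OF MD(2) zero_closed] x by simp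
    fix a assume "a \<in> N"
    then obtain m r where a: "a = m \<oplus> r \<otimes> x" "m \<in> M" "r \<in> carrier R" by (auto simp: N_def)
    have mc: "m \<in> carrier R" using a MD(1) by simp
    show "s \<otimes> a \<in> N" if s: "s \<in> carrier R" for s
    proof -
      have "s \<otimes> a = s \<otimes> m \<oplus> (s \<otimes> r) \<otimes> x" using a s mc x by (simp add: r_distr m_assoc)
      then show ?thesis using NI[of "s \<otimes> m" "s \<otimes> r"] a s MD(4) by simp
    qed
    fix b assume "b \<in> N"
    then obtain m' r' where b: "b = m' \<oplus> r' \<otimes> x" "m' \<in> M" "r' \<in> carrier R" by (auto simp: N_def)
    have mc': "m' \<in> carrier R" using b MD(1) by simp
    have "a \<oplus> b = (m \<oplus> m') \<oplus> (r \<oplus> r') \<otimes> x" using a b mc mc' x by (simp add: l_distr a_ac)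
    then show "a \<oplus> b \<in> N" using NI[of "m \<oplus> m'" "r \<oplus> r'"] a b MD(3) by simp
  qed
  moreover have "M \<subseteq> N"
  proof
    fix m assume "m \<in> M"
    then show "m \<in> N" using NI[of m \<zero>] MD(1) x by simp
  qed
  moreover have "N \<noteq> M" using NI[of \<zero> \<one>] MD(2) x by auto
  ultimately have "\<one> \<in> N" using M unfolding maximal_left_ideal_def by blast
  then obtain m r where mr: "\<one> = m \<oplus> r \<otimes> x" "m \<in> M" "r \<in> carrier R" by (auto simp: N_def)
  have mc: "m \<in> carrier R" using mr MD(1) by simp
  have "m = \<one> \<oplus> \<ominus> (r \<otimes> x)" unfolding mr(1) using mr(3) mc x by (simp add: a_assoc r_neg)
  then have "y \<otimes> m = y \<otimes> (\<one> \<oplus> \<ominus> (r \<otimes> x))" by (rule arg_cong)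
  also have "\<dots> = y \<oplus> \<ominus> ((y \<otimes> r) \<otimes> x)" using y x mr(3) by (simp add: r_distr r_minus m_assoc)
  finally have "y \<otimes> m = y \<oplus> \<ominus> ((y \<otimes> r) \<otimes> x)" .
  moreover have "y \<otimes> m \<in> M" using y mr MD(4) by simp
  ultimately show ?thesis using y mr by (intro bexI[of _ "y \<otimes> r"]) auto
qed

text \<open>Zorn's lemma. Maximality under inclusion takes the form that \<open>L\<close> contains
  everything in \<open>D\<close> commuting with it, because adding such a \<open>z\<close> keeps the
  set commuting.\<close>

lemma ex_maximal_commuting:
  assumes D: "D \<subseteq> carrier R"
  obtains L where "L \<subseteq> D" "\<And>l m. l \<in> L \<Longrightarrow> m \<in> L \<Longrightarrow> l \<otimes> m = m \<otimes> l"
    "\<And>z. z \<in> D \<Longrightarrow> (\<And>l. l \<in> L \<Longrightarrow> z \<otimes> l = l \<otimes> z) \<Longrightarrow> z \<in> L"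
proof -
  let ?A = "{L. L \<subseteq> D \<and> (\<forall>l\<in>L. \<forall>m\<in>L. l \<otimes> m = m \<otimes> l)}"
  have "\<exists>M\<in>?A. \<forall>Y\<in>?A. M \<subseteq> Y \<longrightarrow> Y = M"
  proof (rule subset_Zorn_nonempty)
    show "?A \<noteq> {}" by blast
    fix C assume C: "C \<noteq> {}" "subset.chain ?A C"
    then have CA: "\<And>M. M \<in> C \<Longrightarrow> M \<subseteq> D \<and> (\<forall>l\<in>M. \<forall>m\<in>M. l \<otimes> m = m \<otimes> l)"
      and ch: "\<And>M M'. M \<in> C \<Longrightarrow> M' \<in> C \<Longrightarrow> M \<subseteq> M' \<or> M' \<subseteq> M"
      by (auto simp: subset_chain_def)
    have "l \<otimes> m = m \<otimes> l" if lm: "l \<in> \<Union>C" "m \<in> \<Union>C" for l m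
    proof -
      obtain M M' where M: "M \<in> C" "l \<in> M" "M' \<in> C" "m \<in> M'" using lm by blast
      then obtain M'' where "M'' \<in> C" "l \<in> M''" "m \<in> M''" using ch[OF M(1,3)] by blast
      then show ?thesis using CA by blast
    qed
    moreover have "\<Union>C \<subseteq> D" using CA by blast
    ultimately show "\<Union>C \<in> ?A" by simp
  qed
  then obtain L where L: "L \<in> ?A" and max: "\<forall>Y\<in>?A. L \<subseteq> Y \<longrightarrow> Y = L" by (rule bexE)
  show thesis
  proof (rule that)
    show "l \<otimes> m = m \<otimes> l" if "l \<in> L" "m \<in> L" for l m using L that by simp
    show "L \<subseteq> D" using L by simp
    fix z assume z: "z \<in> D" "\<And>l. l \<in> L \<Longrightarrow> z \<otimes> l = l \<otimes> z"
    have ins: "insert z L \<in> ?A" using L z by simp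
    have "insert z L = L" using bspec[OF max ins] by (simp add: subset_insertI)
    then show "z \<in> L" by blast
  qed
qed

end

text \<open>A maximal commuting set \<open>\<Lambda>\<close> of \<open>W\<close>-endomorphisms of a simple \<open>W\<close>-module plays the role of
  a maximal subfield of the endomorphism division ring: the operators generated by \<open>W\<close> and \<open>\<Lambda>\<close>
  have centralizer \<open>\<Lambda>\<close>, and the identities of \<open>G\<close> persist for them.\<close>

lemma simple_operators_maximal_commuting:
  fixes V :: "('v, 'm) ring_scheme"
  assumes V: "abelian_group V" "carrier V \<noteq> {\<zero>\<^bsub>V\<^esub>}"
    and W: "ring W" and h: "h \<in> ring_hom W (End_ring V)"
    and simple: "\<And>v u. v \<in> carrier V \<Longrightarrow> v \<noteq> \<zero>\<^bsub>V\<^esub> \<Longrightarrow> u \<in> carrier V \<Longrightarrow> \<exists>w\<in>carrier W. h w v = u"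
    and G: "G \<subseteq> carrier W" "\<one>\<^bsub>W\<^esub> \<in> G" "\<And>x y. x \<in> G \<Longrightarrow> y \<in> G \<Longrightarrow> x \<otimes>\<^bsub>W\<^esub> y \<in> G"
    and gen: "carrier W \<subseteq> span_over W (center W) G"
  obtains L where "L \<subseteq> carrier (End_ring V)" "\<And>l m. l \<in> L \<Longrightarrow> m \<in> L \<Longrightarrow> l \<otimes>\<^bsub>End_ring V\<^esub> m = m \<otimes>\<^bsub>End_ring V\<^esub> l"
    "\<And>l w. l \<in> L \<Longrightarrow> w \<in> carrier W \<Longrightarrow> l \<otimes>\<^bsub>End_ring V\<^esub> h w = h w \<otimes>\<^bsub>End_ring V\<^esub> l"
    "simple_operators V (span_over (End_ring V) L (h ` G))"
    "centralizer (End_ring V) (span_over (End_ring V) L (h ` G)) \<subseteq> span_over (End_ring V) L (h ` G)"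
    "h ` carrier W \<subseteq> span_over (End_ring V) L (h ` G)"
proof -
  let ?E = "End_ring V"
  interpret V: abelian_group V by fact
  interpret W: ring W by fact
  interpret E: ring ?E by (rule V.ring_End_ring)
  have hE: "h w \<in> carrier ?E" if "w \<in> carrier W" for w using ring_hom_closed[OF h that] .
  note hm = ring_hom_mult[OF h] and ha = ring_hom_add[OF h] and h1 = ring_hom_one[OF h]
  have h0: "h \<zero>\<^bsub>W\<^esub> = \<zero>\<^bsub>?E\<^esub>" by (rule ring_hom_zero[OF h W E.ring_axioms])
  \<comment> \<open>The endomorphism ring of the \<open>W\<close>-module \<open>V\<close>.\<close>
  define D where "D = centralizer ?E (h ` carrier W)"
  have DE: "D \<subseteq> carrier ?E" by (auto simp: D_def centralizer_def)
  have Dh: "d \<otimes>\<^bsub>?E\<^esub> h w = h w \<otimes>\<^bsub>?E\<^esub> d" if "d \<in> D" "w \<in> carrier W" for d w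
    using that by (auto simp: D_def centralizer_def)
  have DI: "d \<in> D" if "d \<in> carrier ?E" "\<And>w. w \<in> carrier W \<Longrightarrow> d \<otimes>\<^bsub>?E\<^esub> h w = h w \<otimes>\<^bsub>?E\<^esub> d" for d
    using that by (auto simp: D_def centralizer_def)
  obtain L where LD: "L \<subseteq> D" and LL: "\<And>l m. l \<in> L \<Longrightarrow> m \<in> L \<Longrightarrow> l \<otimes>\<^bsub>?E\<^esub> m = m \<otimes>\<^bsub>?E\<^esub> l"
    and Lmax: "\<And>z. z \<in> D \<Longrightarrow> (\<And>l. l \<in> L \<Longrightarrow> z \<otimes>\<^bsub>?E\<^esub> l = l \<otimes>\<^bsub>?E\<^esub> z) \<Longrightarrow> z \<in> L"
    using E.ex_maximal_commuting[OF DE] by blast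
  have LE: "L \<subseteq> carrier ?E" using LD DE by blast
  have LEc: "l \<in> carrier ?E" if "l \<in> L" for l using that LE by blast
  have Lh: "l \<otimes>\<^bsub>?E\<^esub> h w = h w \<otimes>\<^bsub>?E\<^esub> l" if "l \<in> L" "w \<in> carrier W" for l w
    using that LD Dh by blast
  \<comment> \<open>Central elements of \<open>W\<close> act as \<open>W\<close>-endomorphisms
    commuting with all of \<open>L\<close>, so maximality puts them into \<open>L\<close>. For
    \<open>R[t]\<close> this absorbs the powers of \<open>t\<close> into the new scalars.\<close>
  have hL: "h z \<in> L" if z: "z \<in> center W" for z
  proof (rule Lmax)
    note zD = centerD[OF z]
    show "h z \<in> D" using zD hE by (intro DI) (simp_all add: hm[symmetric])
    show "h z \<otimes>\<^bsub>?E\<^esub> l = l \<otimes>\<^bsub>?E\<^esub> h z" if "l \<in> L" for l using Lh[OF that zD(1)] by simp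
  qed
  have L_minus_one: "\<ominus>\<^bsub>?E\<^esub> \<one>\<^bsub>?E\<^esub> \<in> L"
    using LEc hE by (intro Lmax DI) (simp_all add: E.l_minus E.r_minus)
  have L_one: "\<one>\<^bsub>?E\<^esub> \<in> L" using LEc hE by (intro Lmax DI) simp_all
  have L_mult: "l \<otimes>\<^bsub>?E\<^esub> m \<in> L" if lm: "l \<in> L" "m \<in> L" for l m
  proof (rule Lmax)
    have c: "l \<in> carrier ?E" "m \<in> carrier ?E" using lm LEc by auto
    have comm: "l \<otimes>\<^bsub>?E\<^esub> m \<otimes>\<^bsub>?E\<^esub> x = x \<otimes>\<^bsub>?E\<^esub> (l \<otimes>\<^bsub>?E\<^esub> m)"
      if x: "x \<in> carrier ?E" "l \<otimes>\<^bsub>?E\<^esub> x = x \<otimes>\<^bsub>?E\<^esub> l" "m \<otimes>\<^bsub>?E\<^esub> x = x \<otimes>\<^bsub>?E\<^esub> m" for x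
      using E.m_assoc[OF c x(1)] E.m_assoc[OF c(1) x(1) c(2)] E.m_assoc[OF x(1) c] x(2,3) by simp
    show "l \<otimes>\<^bsub>?E\<^esub> m \<in> D" using c lm hE Lh by (intro DI comm) auto
    show "l \<otimes>\<^bsub>?E\<^esub> m \<otimes>\<^bsub>?E\<^esub> x = x \<otimes>\<^bsub>?E\<^esub> (l \<otimes>\<^bsub>?E\<^esub> m)" if "x \<in> L" for x
      using that lm LEc LL by (intro comm) auto
  qed
  define S where "S = span_over ?E L (h ` G)"
  have GE: "h ` G \<subseteq> carrier ?E" using G(1) hE by blast
  have GG: "x \<otimes>\<^bsub>?E\<^esub> y \<in> h ` G" if "x \<in> h ` G" "y \<in> h ` G" for x y
  proof -
    from that obtain u v where "u \<in> G" "v \<in> G" "x = h u" "y = h v" by blast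
    then show ?thesis using G hm[of u v] by (metis image_eqI subsetD)
  qed
  have LG: "l \<otimes>\<^bsub>?E\<^esub> g = g \<otimes>\<^bsub>?E\<^esub> l" if "l \<in> L" "g \<in> h ` G" for l g using that Lh G(1) by blast
  have Gone: "\<one>\<^bsub>?E\<^esub> \<in> h ` G" using G(2) h1 by (metis image_eqI)
  have L_sub: "l \<in> S" if "l \<in> L" for l
  proof -
    have "\<one>\<^bsub>?E\<^esub> \<otimes>\<^bsub>?E\<^esub> l \<oplus>\<^bsub>?E\<^esub> \<zero>\<^bsub>?E\<^esub> \<in> S" unfolding S_def using Gone that by (intro span_over.intros)
    then show ?thesis using LEc[OF that] by simp
  qed
  have h_span_over: "h w \<in> S" if "w \<in> span_over W (center W) G" for w
    using that
  proof induction
    case zero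
    then show ?case unfolding S_def h0 by (rule span_over.zero)
  next
    case (add g l t)
    have c: "g \<in> carrier W" "l \<in> carrier W" "t \<in> carrier W"
      using add G(1) centerD(1)[of l W] W.span_over_closed[of "center W" G t] by (auto simp: center_def)
    have "h (g \<otimes>\<^bsub>W\<^esub> l \<oplus>\<^bsub>W\<^esub> t) = h g \<otimes>\<^bsub>?E\<^esub> h l \<oplus>\<^bsub>?E\<^esub> h t" using c by (simp add: ha hm)
    also have "\<dots> \<in> S" unfolding S_def using add hL by (intro span_over.add) (auto simp: S_def)
    finally show ?case .
  qed
  have hS: "h ` carrier W \<subseteq> S" using gen h_span_over by blast
  have S_mult: "x \<otimes>\<^bsub>?E\<^esub> y \<in> S" if "x \<in> S" "y \<in> S" for x y
    using E.span_over_mult[OF LE L_mult GE GG LG] that unfolding S_def by blast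
  have S: "subring S ?E"
  proof (rule E.subringI)
    show "S \<subseteq> carrier ?E" using E.span_over_closed[OF LE GE] by (auto simp: S_def)
    show "\<one>\<^bsub>?E\<^esub> \<in> S" using L_sub[OF L_one] .
    fix x assume x: "x \<in> S"
    have xc: "x \<in> carrier ?E" using x E.span_over_closed[OF LE GE] by (simp add: S_def)
    show "\<ominus>\<^bsub>?E\<^esub> x \<in> S" using S_mult[OF L_sub[OF L_minus_one] x] xc by (simp add: E.l_minus)
    fix y assume y: "y \<in> S"
    show "x \<oplus>\<^bsub>?E\<^esub> y \<in> S" using E.span_over_add[OF LE GE] x y by (simp add: S_def)
    show "x \<otimes>\<^bsub>?E\<^esub> y \<in> S" using S_mult x y .
  qed
  show thesis
  proof (rule that[OF LE LL Lh])
    show "simple_operators V (span_over ?E L (h ` G))"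
    proof (intro simple_operators.intro simple_operators_axioms.intro V)
      show "subring (span_over ?E L (h ` G)) ?E" using S by (simp add: S_def)
      show "\<exists>T\<in>span_over ?E L (h ` G). T v = u" if "v \<in> carrier V" "v \<noteq> \<zero>\<^bsub>V\<^esub>" "u \<in> carrier V" for v u
        using simple[OF that] hS by (auto simp: S_def)
    qed
    show "h ` carrier W \<subseteq> span_over ?E L (h ` G)" using hS by (simp add: S_def)
    \<comment> \<open>Commuting with \<open>S\<close> means commuting with the image of
      \<open>W\<close>, which puts \<open>z\<close> into \<open>D\<close>, and with
      \<open>L\<close>, which then puts it into \<open>L\<close> by maximality.\<close>
    have "z \<in> S" if z: "z \<in> centralizer ?E S" for z
    proof (rule L_sub, rule Lmax)
      have zE: "z \<in> carrier ?E" and zS: "\<And>x. x \<in> S \<Longrightarrow> z \<otimes>\<^bsub>?E\<^esub> x = x \<otimes>\<^bsub>?E\<^esub> z"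
        using z by (auto simp: centralizer_def)
      show "z \<in> D" using zE zS hS by (intro DI) auto
      show "z \<otimes>\<^bsub>?E\<^esub> l = l \<otimes>\<^bsub>?E\<^esub> z" if "l \<in> L" for l using zS L_sub that by blast
    qed
    then show "centralizer ?E (span_over ?E L (h ` G)) \<subseteq> span_over ?E L (h ` G)" by (auto simp: S_def)
  qed
qed

section \<open>Polynomials in a central variable over a noncommutative ring\<close>

context UP_ring begin

lemma coeff_mult_monom:
  assumes p: "p \<in> carrier P" and b: "b \<in> carrier R"
  shows "up_ring.coeff P (p \<otimes>\<^bsub>P\<^esub> up_ring.monom P b m) n = (if m \<le> n then up_ring.coeff P p (n - m) \<otimes> b else \<zero>)"
proof -
  have "up_ring.coeff P (p \<otimes>\<^bsub>P\<^esub> up_ring.monom P b m) n = (\<Oplus>i\<in>{..n}. if m \<le> n \<and> i = n - m then up_ring.coeff P p i \<otimes> b else \<zero>)"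
    using p b by (simp, intro R.finsum_cong') auto
  also have "\<dots> = (if m \<le> n then up_ring.coeff P p (n - m) \<otimes> b else \<zero>)"
  proof (cases "m \<le> n")
    case True
    have "(\<Oplus>i\<in>{..n}. if i = n - m then up_ring.coeff P p i \<otimes> b else \<zero>) = up_ring.coeff P p (n - m) \<otimes> b"
      using p b by (intro R.add.finprod_singleton_swap) auto
    with True show ?thesis by simp
  qed simp
  finally show ?thesis .
qed

lemma coeff_monom_mult:
  assumes p: "p \<in> carrier P" and b: "b \<in> carrier R"
  shows "up_ring.coeff P (up_ring.monom P b m \<otimes>\<^bsub>P\<^esub> p) n = (if m \<le> n then b \<otimes> up_ring.coeff P p (n - m) else \<zero>)"
proof -
  have "up_ring.coeff P (up_ring.monom P b m \<otimes>\<^bsub>P\<^esub> p) n = (\<Oplus>i\<in>{..n}. if i = m then b \<otimes> up_ring.coeff P p (n - i) else \<zero>)"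
    using p b by (simp, intro R.finsum_cong') auto
  also have "\<dots> = (if m \<le> n then b \<otimes> up_ring.coeff P p (n - m) else \<zero>)"
  proof (cases "m \<le> n")
    case True
    have "(\<Oplus>i\<in>{..n}. if i = m then b \<otimes> up_ring.coeff P p (n - i) else \<zero>) = b \<otimes> up_ring.coeff P p (n - m)"
      using p b True by (intro R.add.finprod_singleton_swap) auto
    with True show ?thesis by simp
  next
    case False
    then show ?thesis by (simp, intro R.add.finprod_one_eqI) auto
  qed
  finally show ?thesis .
qed

lemma monom_one_central: "up_ring.monom P \<one> n \<in> center P"
  unfolding center_def
  by (auto intro!: up_eqI simp: coeff_mult_monom coeff_monom_mult simp del: coeff_mult)

lemma const_central: "c \<in> center R \<Longrightarrow> up_ring.monom P c 0 \<in> center P"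
  unfolding center_def
  by (auto intro!: up_eqI simp: coeff_mult_monom coeff_monom_mult simp del: coeff_mult)

text \<open>A polynomial is a sum of terms \<open>a t^n\<close> with \<open>t^n\<close> central.
  Hence \<open>R[t]\<close> is an extension of scalars of its constants, the form in which
  multilinear identities are transferred.\<close>

lemma UP_span_over_const: "carrier P \<subseteq> span_over P (center P) ((\<lambda>a. up_ring.monom P a 0) ` carrier R)"
proof
  let ?G = "(\<lambda>a. up_ring.monom P a 0) ` carrier R"
  have G: "?G \<subseteq> carrier P" and Z: "center P \<subseteq> carrier P" by (auto simp: center_def)
  fix p assume p: "p \<in> carrier P"
  have "up_ring.monom P a n \<in> span_over P (center P) ?G" if a: "a \<in> carrier R" for a n
  proof -
    have "up_ring.monom P a n = up_ring.monom P a 0 \<otimes>\<^bsub>P\<^esub> up_ring.monom P \<one> n \<oplus>\<^bsub>P\<^esub> \<zero>\<^bsub>P\<^esub>"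
      using a by (intro up_eqI) (auto simp: coeff_monom_mult simp del: coeff_mult)
    also have "\<dots> \<in> span_over P (center P) ?G" using a monom_one_central by (intro span_over.intros) auto
    finally show ?thesis .
  qed
  then have "(\<Oplus>\<^bsub>P\<^esub>i\<in>{..deg R p}. up_ring.monom P (up_ring.coeff P p i) i) \<in> span_over P (center P) ?G"
    using p by (intro P.span_over_finsum[OF Z G]) simp
  then show "p \<in> span_over P (center P) ?G" using up_repr[OF p] by simp
qed

text \<open>If \<open>1 = s + q (1 - b t)\<close> with \<open>s\<close> having coefficients in \<open>I\<close>, then \<open>q\<close> is congruent to the
  geometric series of \<open>b t\<close>, so \<open>b\<close> is nilpotent modulo \<open>I\<close>.\<close>

lemma left_ideal_geometric:
  assumes I: "ideal I R" and b: "b \<in> carrier R" and nonnil: "\<And>n::nat. b [^] n \<notin> I"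
  defines "e \<equiv> \<one>\<^bsub>P\<^esub> \<oplus>\<^bsub>P\<^esub> \<ominus>\<^bsub>P\<^esub> up_ring.monom P b 1"
  defines "N \<equiv> {s \<oplus>\<^bsub>P\<^esub> q \<otimes>\<^bsub>P\<^esub> e | s q. s \<in> carrier P \<and> (\<forall>n. up_ring.coeff P s n \<in> I) \<and> q \<in> carrier P}"
  shows "left_ideal P N" "\<one>\<^bsub>P\<^esub> \<notin> N" "e \<in> N"
    "\<And>s. s \<in> carrier P \<Longrightarrow> (\<And>n. up_ring.coeff P s n \<in> I) \<Longrightarrow> s \<in> N"
proof -
  interpret I: ideal I R by fact
  have e: "e \<in> carrier P" using b by (simp add: e_def)
  have NI: "s \<oplus>\<^bsub>P\<^esub> q \<otimes>\<^bsub>P\<^esub> e \<in> N" if "s \<in> carrier P" "\<And>n. up_ring.coeff P s n \<in> I" "q \<in> carrier P" for s q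
    using that by (auto simp: N_def)
  have z: "\<And>n. up_ring.coeff P \<zero>\<^bsub>P\<^esub> n \<in> I" by simp
  show "e \<in> N" using NI[OF P.zero_closed z P.one_closed] e by simp
  show "s \<in> N" if "s \<in> carrier P" "\<And>n. up_ring.coeff P s n \<in> I" for s
    using NI[OF that P.zero_closed] that e by simp
  show "left_ideal P N"
  proof (rule left_idealI)
    show "N \<subseteq> carrier P" using e by (auto simp: N_def)
    show "\<zero>\<^bsub>P\<^esub> \<in> N" using NI[OF P.zero_closed z P.zero_closed] e by simp
    fix x assume "x \<in> N"
    then obtain s q where x: "x = s \<oplus>\<^bsub>P\<^esub> q \<otimes>\<^bsub>P\<^esub> e" "s \<in> carrier P" "\<And>n. up_ring.coeff P s n \<in> I" "q \<in> carrier P"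
      by (auto simp: N_def)
    show "r \<otimes>\<^bsub>P\<^esub> x \<in> N" if r: "r \<in> carrier P" for r
    proof -
      have "up_ring.coeff P (r \<otimes>\<^bsub>P\<^esub> s) n \<in> I" for n
        using r x by (simp, intro I.finsum_mem R.ring_axioms I.I_l_closed) auto
      moreover have "r \<otimes>\<^bsub>P\<^esub> x = r \<otimes>\<^bsub>P\<^esub> s \<oplus>\<^bsub>P\<^esub> (r \<otimes>\<^bsub>P\<^esub> q) \<otimes>\<^bsub>P\<^esub> e"
        using r x e by (simp add: P.r_distr P.m_assoc)
      ultimately show ?thesis using NI r x by simp
    qed
    fix y assume "y \<in> N"
    then obtain s' q' where y: "y = s' \<oplus>\<^bsub>P\<^esub> q' \<otimes>\<^bsub>P\<^esub> e" "s' \<in> carrier P" "\<And>n. up_ring.coeff P s' n \<in> I" "q' \<in> carrier P"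
      by (auto simp: N_def)
    have "x \<oplus>\<^bsub>P\<^esub> y = (s \<oplus>\<^bsub>P\<^esub> s') \<oplus>\<^bsub>P\<^esub> (q \<oplus>\<^bsub>P\<^esub> q') \<otimes>\<^bsub>P\<^esub> e"
      using x y e by (simp add: P.l_distr P.a_ac)
    moreover have "up_ring.coeff P (s \<oplus>\<^bsub>P\<^esub> s') n \<in> I" for n using x y by simp
    ultimately show "x \<oplus>\<^bsub>P\<^esub> y \<in> N" using NI x y by simp
  qed
  show "\<one>\<^bsub>P\<^esub> \<notin> N"
  proof
    assume "\<one>\<^bsub>P\<^esub> \<in> N"
    then obtain s q where sq: "\<one>\<^bsub>P\<^esub> = s \<oplus>\<^bsub>P\<^esub> q \<otimes>\<^bsub>P\<^esub> e" "s \<in> carrier P" "\<And>n. up_ring.coeff P s n \<in> I" "q \<in> carrier P"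
      by (auto simp: N_def)
    have qc: "up_ring.coeff P q n \<in> carrier R" and sc: "up_ring.coeff P s n \<in> carrier R" for n using sq by auto
    have qe: "q \<otimes>\<^bsub>P\<^esub> e \<oplus>\<^bsub>P\<^esub> q \<otimes>\<^bsub>P\<^esub> up_ring.monom P b 1 = q"
      using sq(4) b by (simp add: e_def P.r_distr P.r_minus P.a_assoc P.l_neg)
    have "\<one>\<^bsub>P\<^esub> \<oplus>\<^bsub>P\<^esub> q \<otimes>\<^bsub>P\<^esub> up_ring.monom P b 1 = s \<oplus>\<^bsub>P\<^esub> q"
      unfolding sq(1) using sq(2,4) e b by (simp add: P.a_assoc qe del: One_nat_def)
    then have c: "up_ring.coeff P (\<one>\<^bsub>P\<^esub> \<oplus>\<^bsub>P\<^esub> q \<otimes>\<^bsub>P\<^esub> up_ring.monom P b 1) n = up_ring.coeff P (s \<oplus>\<^bsub>P\<^esub> q) n" for n by simp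
    have c0: "\<one> = up_ring.coeff P s 0 \<oplus> up_ring.coeff P q 0"
      using c[of 0] sq(2,4) b by (simp add: coeff_mult_monom del: coeff_mult)
    have cS: "up_ring.coeff P q n \<otimes> b = up_ring.coeff P s (Suc n) \<oplus> up_ring.coeff P q (Suc n)" for n
      using c[of "Suc n"] sq(2,4) b qc by (simp add: coeff_mult_monom del: coeff_mult)
    \<comment> \<open>Modulo \<open>I\<close> the comparison of coefficients reads
      \<open>q_0 = 1\<close> and \<open>q_(n+1) = q_n b\<close>. Past the degree of \<open>q\<close>
      the coefficient is zero, which puts a power of \<open>b\<close> into \<open>I\<close>.\<close>
    have "b [^] n \<oplus> \<ominus> up_ring.coeff P q n \<in> I" for n
    proof (induction n)
      case 0
      have "\<one> \<oplus> \<ominus> up_ring.coeff P q 0 = up_ring.coeff P s 0" unfolding c0 using qc sc by (simp add: R.a_assoc R.r_neg)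
      then show ?case using sq(3)[of 0] by simp
    next
      case (Suc n)
      have "(b [^] n \<oplus> \<ominus> up_ring.coeff P q n) \<otimes> b \<oplus> up_ring.coeff P s (Suc n) \<in> I"
        by (rule I.a_closed[OF I.I_r_closed[OF Suc b] sq(3)])
      also have "(b [^] n \<oplus> \<ominus> up_ring.coeff P q n) \<otimes> b = b [^] Suc n \<oplus> \<ominus> (up_ring.coeff P s (Suc n) \<oplus> up_ring.coeff P q (Suc n))"
        unfolding cS[symmetric] using b qc by (simp add: R.l_distr R.l_minus)
      also have "\<dots> \<oplus> up_ring.coeff P s (Suc n) = b [^] Suc n \<oplus> \<ominus> up_ring.coeff P q (Suc n)"
        using b qc sc by (simp add: R.minus_add R.a_assoc R.l_neg R.a_comm[of "\<ominus> up_ring.coeff P s (Suc n)"])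
      finally show ?case .
    qed
    from this[of "Suc (deg R q)"] nonnil[of "Suc (deg R q)"] show False
      using deg_aboveD[of q "Suc (deg R q)"] sq(4) b by simp
  qed
qed

end

section \<open>Separation by matrix representations\<close>

lemma multilin_cong:
  assumes "ring R" "\<And>w. c w \<in> carrier R" "\<And>i. i \<in> S \<Longrightarrow> r i \<in> carrier R" "\<And>i. i \<in> S \<Longrightarrow> r i = s i"
  shows "multilin R S c r = multilin R S c s"
proof -
  interpret ring R by fact
  have w: "set w = S" if "w \<in> permutations_of_set S" for w using that by (simp add: permutations_of_set_def)
  have eq: "word_eval R r w = word_eval R s w" if "w \<in> permutations_of_set S" for w
    using w[OF that] assms(4) by (intro word_eval_cong) auto
  have "word_eval R s w \<in> carrier R" if "w \<in> permutations_of_set S" for w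
    using w[OF that] assms(3,4) by (intro word_eval_closed) auto
  then show ?thesis
    unfolding multilin_def using eq assms(2) by (intro finsum_cong') auto
qed

lemma (in ring_hom_ring) hom_multilin:
  assumes "\<And>w. c w \<in> carrier R" "\<And>i. i \<in> A \<Longrightarrow> r i \<in> carrier R"
  shows "h (multilin R A c r) = multilin S A (\<lambda>w. h (c w)) (\<lambda>i. h (r i))"
proof -
  have word: "h (word_eval R r w) = word_eval S (\<lambda>i. h (r i)) w" if "set w \<subseteq> A" for w
    using that
  proof (induction w)
    case (Cons i w)
    then have "word_eval R r w \<in> carrier R" "r i \<in> carrier R" using assms(2) by auto
    with Cons show ?case by simp
  qed simp
  have w: "set w = A" if "w \<in> permutations_of_set A" for w using that by (simp add: permutations_of_set_def)
  have wc: "word_eval R r w \<in> carrier R" if "w \<in> permutations_of_set A" for w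
    using w[OF that] assms(2) by (intro R.word_eval_closed) auto
  have "h (multilin R A c r) = finsum S (h \<circ> (\<lambda>w. c w \<otimes> word_eval R r w)) (permutations_of_set A)"
    unfolding multilin_def using assms(1) wc by (intro hom_finsum) auto
  also have "\<dots> = multilin S A (\<lambda>w. h (c w)) (\<lambda>i. h (r i))"
    unfolding multilin_def
  proof (intro S.finsum_cong' refl Pi_I)
    fix u assume u: "u \<in> permutations_of_set A"
    have "h (word_eval R r u) = word_eval S (\<lambda>i. h (r i)) u" using word w[OF u] by simp
    then show "(h \<circ> (\<lambda>w. c w \<otimes> word_eval R r w)) u = h (c u) \<otimes>\<^bsub>S\<^esub> word_eval S (\<lambda>i. h (r i)) u"
      "h (c u) \<otimes>\<^bsub>S\<^esub> word_eval S (\<lambda>i. h (r i)) u \<in> carrier S"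
      using wc[OF u] assms(1) hom_closed[OF wc[OF u]] by simp_all
  qed
  finally show ?thesis .
qed

text \<open>A prime PI quotient is separated by matrix representations of bounded size: for
  \<open>a \<notin> P\<close> some multiple \<open>b\<close> of \<open>a\<close> is not nilpotent modulo \<open>P\<close>, and \<open>b\<close> acts nontrivially on a
  simple module over \<open>R[t]\<close> in which \<open>b t\<close> fixes the class of \<open>1\<close>.\<close>

theorem matrix_rep_separating:
  fixes R :: "('k, 'a, 'b) module_scheme" (structure)
  assumes alg: "assoc_algebra K R" and P: "nc_prime_ideal R P"
    and id: "multilin_identity K R P d c" "c [0..<d] \<noteq> \<zero>\<^bsub>K\<^esub>"
    and a: "a \<in> carrier R" "a \<notin> P"
  shows "\<exists>Q n (L :: ((nat \<Rightarrow> 'a) set \<Rightarrow> (nat \<Rightarrow> 'a) set) ring) \<kappa> \<rho>.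
    ideal Q R \<and> P \<subseteq> Q \<and> a \<notin> Q \<and> n < d \<and> matrix_rep K R n L \<kappa> \<rho> \<and> Q = matrix_kernel R n L \<rho> \<and>
    (\<forall>r. (\<forall>i<d * d. r i \<in> carrier R) \<longrightarrow> multilin R {..<d * d} (standard_coeff R) r \<in> Q)"
proof -
  interpret assoc_algebra K R by fact
  have idl: "ideal P R" using P by (simp add: nc_prime_ideal_def)
  interpret P: ideal P R by fact
  have cK: "c w \<in> carrier K" for w using id by (auto simp: multilin_identity_def)
  have cR: "c w \<odot> \<one> \<in> carrier R" for w using cK by simp
  \<comment> \<open>The coefficient \<open>c [0..<d]\<close> is invertible in \<open>K\<close>; its
    inverse shows that it stays outside \<open>P\<close> and, later, that it acts injectively on
    \<open>V\<close>.\<close>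
  let ?ci = "inv\<^bsub>K\<^esub> (c [0..<d])"
  have "c [0..<d] \<in> Units K" using cK id(2) K.field_Units by simp
  then have ci: "?ci \<in> carrier K" "?ci \<otimes>\<^bsub>K\<^esub> c [0..<d] = \<one>\<^bsub>K\<^esub>"
    by (simp_all add: monoid.Units_inv_closed monoid.Units_l_inv ring.is_monoid[OF K.is_ring])
  have ci1: "(?ci \<odot> \<one>) \<otimes> (c [0..<d] \<odot> \<one>) = \<one>"
    using ci cK by (simp add: smult_assoc_l smult_assoc1[symmetric])
  have "c [0..<d] \<odot> \<one> \<notin> P"
  proof
    assume "c [0..<d] \<odot> \<one> \<in> P"
    then have "\<one> \<in> P" using P.I_l_closed[of "c [0..<d] \<odot> \<one>" "?ci \<odot> \<one>"] ci(1) ci1 by simp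
    then show False using P.one_imp_carrier P by (simp add: nc_prime_ideal_def)
  qed
  moreover have "[0..<d] \<in> permutations_of_set {..<d}" by (auto simp: permutations_of_set_def)
  moreover have "multilin R {..<d} (\<lambda>w. c w \<odot> \<one>) r \<in> P"
    if "\<And>i. i \<in> {..<d} \<Longrightarrow> \<exists>x\<in>carrier R. r i = a \<otimes> x" for r
  proof -
    have "\<forall>i<d. r i \<in> carrier R" using that a(1) by fastforce
    then show ?thesis using id(1) by (simp add: multilin_identity_def)
  qed
  ultimately obtain x where x: "x \<in> carrier R" "\<And>m::nat. (a \<otimes> x) [^] m \<notin> P"
    using prime_PI_nil_right_ideal[OF P, of "{..<d}" "\<lambda>w. c w \<odot> \<one>" "[0..<d]" a] scalar_central[OF cK] a by auto
  define b where "b = a \<otimes> x"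
  have b: "b \<in> carrier R" "\<And>m::nat. b [^] m \<notin> P" using a x by (simp_all add: b_def)
  interpret U: UP_ring R "UP R" by unfold_locales
  let ?W = "UP R"
  let ?m = "up_ring.monom (UP R)"
  let ?e = "\<one>\<^bsub>?W\<^esub> \<oplus>\<^bsub>?W\<^esub> \<ominus>\<^bsub>?W\<^esub> ?m b 1"
  obtain N where N: "left_ideal ?W N" "\<one>\<^bsub>?W\<^esub> \<notin> N" "?e \<in> N"
    "\<And>s. s \<in> carrier ?W \<Longrightarrow> (\<And>n. up_ring.coeff ?W s n \<in> P) \<Longrightarrow> s \<in> N"
    using U.left_ideal_geometric[OF idl b] by blast
  obtain M where M: "maximal_left_ideal ?W M" "N \<subseteq> M" using ex_maximal_left_ideal[OF N(1,2)] by blast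
  have Ml: "left_ideal ?W M" "\<one>\<^bsub>?W\<^esub> \<notin> M" using M by (simp_all add: maximal_left_ideal_def)
  obtain V :: "(nat \<Rightarrow> 'a) set ring" and \<pi> h where V: "abelian_group V" and h: "h \<in> ring_hom ?W (End_ring V)"
    and \<pi>: "\<pi> ` carrier ?W = carrier V"
      "\<And>x y. x \<in> carrier ?W \<Longrightarrow> y \<in> carrier ?W \<Longrightarrow> \<pi> (x \<oplus>\<^bsub>?W\<^esub> y) = \<pi> x \<oplus>\<^bsub>V\<^esub> \<pi> y"
      "\<And>r x. r \<in> carrier ?W \<Longrightarrow> x \<in> carrier ?W \<Longrightarrow> h r (\<pi> x) = \<pi> (r \<otimes>\<^bsub>?W\<^esub> x)"
      "\<And>x. x \<in> carrier ?W \<Longrightarrow> \<pi> x = \<zero>\<^bsub>V\<^esub> \<longleftrightarrow> x \<in> M"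
    by (rule U.P.left_quotient_module[OF Ml(1)]) (rule that; assumption)
  interpret V: abelian_group V by fact
  let ?E = "End_ring V"
  interpret E: ring ?E by (rule V.ring_End_ring)
  have \<pi>V: "\<pi> w \<in> carrier V" if "w \<in> carrier ?W" for w using \<pi>(1) that by blast
  have "\<pi> \<one>\<^bsub>?W\<^esub> \<noteq> \<zero>\<^bsub>V\<^esub>" using \<pi>(4) Ml(2) by simp
  then have nontriv: "carrier V \<noteq> {\<zero>\<^bsub>V\<^esub>}" using \<pi>V[of "\<one>\<^bsub>?W\<^esub>"] by auto
  have simple: "\<exists>w\<in>carrier ?W. h w v = u" if v: "v \<in> carrier V" "v \<noteq> \<zero>\<^bsub>V\<^esub>" "u \<in> carrier V" for v u
  proof -
    obtain y where y: "y \<in> carrier ?W" "v = \<pi> y" using v(1) unfolding \<pi>(1)[symmetric] by (rule imageE)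
    obtain z where z: "z \<in> carrier ?W" "u = \<pi> z" using v(3) unfolding \<pi>(1)[symmetric] by (rule imageE)
    note yz = y z
    have "y \<notin> M" using v(2) \<pi>(4)[OF y(1)] y(2) by simp
    from U.P.maximal_left_ideal_transitive[OF M(1) yz(1) this yz(3)]
    obtain r where r: "r \<in> carrier ?W" "z \<oplus>\<^bsub>?W\<^esub> \<ominus>\<^bsub>?W\<^esub> (r \<otimes>\<^bsub>?W\<^esub> y) \<in> M" by (rule bexE)
    have ry: "r \<otimes>\<^bsub>?W\<^esub> y \<in> carrier ?W" using r yz by simp
    have "\<pi> z = \<pi> ((z \<oplus>\<^bsub>?W\<^esub> \<ominus>\<^bsub>?W\<^esub> (r \<otimes>\<^bsub>?W\<^esub> y)) \<oplus>\<^bsub>?W\<^esub> r \<otimes>\<^bsub>?W\<^esub> y)"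
      using yz ry by (simp add: U.P.a_assoc U.P.l_neg)
    also have "\<dots> = \<pi> (z \<oplus>\<^bsub>?W\<^esub> \<ominus>\<^bsub>?W\<^esub> (r \<otimes>\<^bsub>?W\<^esub> y)) \<oplus>\<^bsub>V\<^esub> \<pi> (r \<otimes>\<^bsub>?W\<^esub> y)"
      using yz ry by (intro \<pi>(2)) auto
    also have "\<pi> (z \<oplus>\<^bsub>?W\<^esub> \<ominus>\<^bsub>?W\<^esub> (r \<otimes>\<^bsub>?W\<^esub> y)) = \<zero>\<^bsub>V\<^esub>" using r yz ry \<pi>(4) by simp
    finally have "\<pi> z = h r v" using \<pi>V[OF ry] yz r \<pi>(3) by simp
    then show ?thesis using r yz by blast
  qed
  let ?G = "(\<lambda>a. ?m a 0) ` carrier R"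
  have Gm: "u \<otimes>\<^bsub>?W\<^esub> v \<in> ?G" if uv: "u \<in> ?G" "v \<in> ?G" for u v
  proof -
    obtain y z where "y \<in> carrier R" "u = ?m y 0" "z \<in> carrier R" "v = ?m z 0" using uv by blast
    then show ?thesis using ring_hom_mult[OF U.const_ring_hom, of y z] by (intro image_eqI[of _ _ "y \<otimes> z"]) auto
  qed
  have G: "?G \<subseteq> carrier ?W" "\<one>\<^bsub>?W\<^esub> \<in> ?G" using ring_hom_one[OF U.const_ring_hom] by (auto intro: image_eqI[of _ _ \<one>])
  obtain L where LE: "L \<subseteq> carrier ?E" and LL: "\<And>l m. l \<in> L \<Longrightarrow> m \<in> L \<Longrightarrow> l \<otimes>\<^bsub>?E\<^esub> m = m \<otimes>\<^bsub>?E\<^esub> l"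
    and Lh: "\<And>l w. l \<in> L \<Longrightarrow> w \<in> carrier ?W \<Longrightarrow> l \<otimes>\<^bsub>?E\<^esub> h w = h w \<otimes>\<^bsub>?E\<^esub> l"
    and so: "simple_operators V (span_over ?E L (h ` ?G))"
    and cent: "centralizer ?E (span_over ?E L (h ` ?G)) \<subseteq> span_over ?E L (h ` ?G)"
    and hS: "h ` carrier ?W \<subseteq> span_over ?E L (h ` ?G)"
    using simple_operators_maximal_commuting[OF V nontriv U.P.ring_axioms h simple G Gm U.UP_span_over_const] by blast
  let ?S = "span_over ?E L (h ` ?G)"
  interpret so: simple_operators V ?E ?S by (rule so) 
  define g where "g = (\<lambda>r. h (?m r 0))"
  have hE: "h w \<in> carrier ?E" if "w \<in> carrier ?W" for w using ring_hom_closed[OF h that] .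
  have mW: "?m r 0 \<in> carrier ?W" if "r \<in> carrier R" for r using that by simp
  have gh: "g \<in> ring_hom R ?E"
    by (rule ring_hom_memI)
      (simp_all add: g_def hE ring_hom_mult[OF U.const_ring_hom] ring_hom_add[OF U.const_ring_hom]
        ring_hom_one[OF U.const_ring_hom] ring_hom_mult[OF h] ring_hom_add[OF h] ring_hom_one[OF h] del: U.monom_add)
  interpret g: ring_hom_ring R ?E g by (intro ring_hom_ringI2 gh ring_axioms E.ring_axioms)
  have gS: "g r \<in> ?S" if "r \<in> carrier R" for r using hS mW[OF that] by (auto simp: g_def)
  \<comment> \<open>\<open>N\<close> contains all polynomials with coefficients in \<open>P\<close>.
    These form a two-sided ideal, so constants from \<open>P\<close> kill every class and not only
    that of \<open>1\<close>.\<close>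
  have gP: "g r = \<zero>\<^bsub>?E\<^esub>" if r: "r \<in> P" for r
  proof (rule so.E_eqI)
    have rc: "r \<in> carrier R" using r by simp
    show "g r \<in> carrier ?E" using rc by simp
    fix v assume v: "v \<in> carrier V"
    then obtain w where w: "w \<in> carrier ?W" "v = \<pi> w" unfolding \<pi>(1)[symmetric] by (rule imageE)
    have "up_ring.coeff ?W (?m r 0 \<otimes>\<^bsub>?W\<^esub> w) n \<in> P" for n
      unfolding U.coeff_monom_mult[OF w(1) rc] using r w(1) by (simp add: P.I_r_closed)
    then have "?m r 0 \<otimes>\<^bsub>?W\<^esub> w \<in> M" using N(4)[of "?m r 0 \<otimes>\<^bsub>?W\<^esub> w"] mW[OF rc] w(1) M(2) by auto
    then have "g r v = \<zero>\<^bsub>V\<^esub>" unfolding g_def w(2) \<pi>(3)[OF mW[OF rc] w(1)]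
      using \<pi>(4) mW[OF rc] w(1) by simp
    then show "g r v = \<zero>\<^bsub>?E\<^esub> v" using v by simp
  qed simp
  \<comment> \<open>If \<open>a\<close> acted as zero, so would \<open>b = a x\<close>; then
    \<open>b t\<close> and \<open>1 - b t\<close> would both lie in \<open>M\<close>, hence also
    \<open>1\<close>.\<close>
  have ga: "g a \<noteq> \<zero>\<^bsub>?E\<^esub>"
  proof
    assume "g a = \<zero>\<^bsub>?E\<^esub>"
    then have gb: "g b = \<zero>\<^bsub>?E\<^esub>" using a(1) x(1) by (simp add: b_def)
    have t: "?m \<one> 1 \<in> carrier ?W" by simp
    have "?m b 0 \<otimes>\<^bsub>?W\<^esub> ?m \<one> 1 = ?m b 1"
      using b(1) by (intro U.up_eqI) (auto simp: U.coeff_monom_mult simp del: U.coeff_mult)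
    moreover have "\<pi> (?m b 0 \<otimes>\<^bsub>?W\<^esub> ?m \<one> 1) = \<zero>\<^bsub>V\<^esub>"
      using \<pi>(3)[OF mW[OF b(1)] t] gb \<pi>V[OF t] by (simp add: g_def)
    ultimately have bM: "?m b 1 \<in> M" using \<pi>(4)[of "?m b 1"] b(1) by simp
    have "?e \<oplus>\<^bsub>?W\<^esub> ?m b 1 \<in> M" using N(3) M(2) bM left_idealD(3)[OF Ml(1)] by blast
    moreover have "?e \<oplus>\<^bsub>?W\<^esub> ?m b 1 = \<one>\<^bsub>?W\<^esub>" using b(1) by (simp add: U.P.a_assoc U.P.l_neg del: One_nat_def)
    ultimately show False using Ml(2) by simp
  qed
  have GE: "h ` ?G \<subseteq> carrier ?E" using G(1) hE by blast
  have LG: "l \<otimes>\<^bsub>?E\<^esub> y = y \<otimes>\<^bsub>?E\<^esub> l" if "l \<in> L" "y \<in> h ` ?G" for l y using that Lh G(1) by blast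
  have bound: "card B < d" if "so.indep B" for B
  proof (rule so.indep_card_less[OF _ _ _ that])
    show "g (c w \<odot> \<one>) \<in> carrier ?E" for w using cR by simp
    show "v = \<zero>\<^bsub>V\<^esub>" if v: "v \<in> carrier V" "g (c [0..<d] \<odot> \<one>) v = \<zero>\<^bsub>V\<^esub>" for v
    proof -
      have gg: "g (?ci \<odot> \<one>) \<otimes>\<^bsub>?E\<^esub> g (c [0..<d] \<odot> \<one>) = \<one>\<^bsub>?E\<^esub>"
        using g.hom_mult[of "?ci \<odot> \<one>" "c [0..<d] \<odot> \<one>"] ci(1) cR ci1 by simp
      have "v = (g (?ci \<odot> \<one>) \<otimes>\<^bsub>?E\<^esub> g (c [0..<d] \<odot> \<one>)) v"
        unfolding gg using v by simp
      also have "\<dots> = g (?ci \<odot> \<one>) \<zero>\<^bsub>V\<^esub>" using v by simp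
      also have "\<dots> = \<zero>\<^bsub>V\<^esub>" using ci(1) by (intro so.E_zero g.hom_closed) simp
      finally show ?thesis .
    qed
    fix r assume r: "\<And>i. i < d \<Longrightarrow> r i \<in> ?S"
    \<comment> \<open>On images of constants the identity holds because its values in
      \<open>R\<close> lie in \<open>P\<close>, which acts as zero; extension of scalars by
      \<open>L\<close> carries it to the whole operator ring.\<close>
    show "multilin ?E {..<d} (\<lambda>w. g (c w \<odot> \<one>)) r = \<zero>\<^bsub>?E\<^esub>"
    proof (rule E.multilin_span_over[OF _ _ LE GE LG LL])
      show "g (c w \<odot> \<one>) \<in> carrier ?E" for w using cR by simp
      show "r i \<in> ?S" if "i \<in> {..<d}" for i using r that by simp
      fix s assume s: "\<And>i. i \<in> {..<d} \<Longrightarrow> s i \<in> h ` ?G"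
      then have "\<forall>i\<in>{..<d}. \<exists>y\<in>carrier R. s i = g y" by (auto simp: g_def)
      then obtain y where y: "\<And>i. i < d \<Longrightarrow> y i \<in> carrier R" "\<And>i. i < d \<Longrightarrow> s i = g (y i)"
        by (metis lessThan_iff)
      have "multilin ?E {..<d} (\<lambda>w. g (c w \<odot> \<one>)) s = multilin ?E {..<d} (\<lambda>w. g (c w \<odot> \<one>)) (\<lambda>i. g (y i))"
        using s GE y(2) cR by (intro multilin_cong E.ring_axioms) auto
      also have "\<dots> = g (multilin R {..<d} (\<lambda>w. c w \<odot> \<one>) y)"
        using y(1) cR by (intro g.hom_multilin[symmetric]) auto
      also have "\<dots> = \<zero>\<^bsub>?E\<^esub>" using id(1) y(1) by (intro gP) (simp add: multilin_identity_def)
      finally show "multilin ?E {..<d} (\<lambda>w. g (c w \<odot> \<one>)) s = \<zero>\<^bsub>?E\<^esub>" .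
    qed simp
  qed
  obtain n T where n: "n < d" and T: "matrix_units ?E ?S n T" using so.ex_matrix_units[OF bound cent] by blast
  interpret mu: matrix_units ?E ?S n T by (rule T)
  \<comment> \<open>Scalars are central in \<open>R\<close>, hence in \<open>R[t]\<close>, and they
    commute with \<open>L\<close>; so they commute with the whole span.\<close>
  have sc: "g (k \<odot> \<one>) \<in> centralizer ?E ?S" if k: "k \<in> carrier K" for k
  proof -
    have z: "?m (k \<odot> \<one>) 0 \<in> center ?W" using U.const_central[OF scalar_central[OF k]] .
    note zD = centerD[OF z]
    have "g (k \<odot> \<one>) \<otimes>\<^bsub>?E\<^esub> s = s \<otimes>\<^bsub>?E\<^esub> g (k \<odot> \<one>)" if "s \<in> ?S" for s
    proof (rule E.span_over_commute[OF LE GE that])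
      show "g (k \<odot> \<one>) \<in> carrier ?E" using k by simp
      show "g (k \<odot> \<one>) \<otimes>\<^bsub>?E\<^esub> l = l \<otimes>\<^bsub>?E\<^esub> g (k \<odot> \<one>)" if "l \<in> L" for l
        using Lh[OF that zD(1)] by (simp add: g_def)
      show "g (k \<odot> \<one>) \<otimes>\<^bsub>?E\<^esub> y = y \<otimes>\<^bsub>?E\<^esub> g (k \<odot> \<one>)" if y: "y \<in> h ` ?G" for y
      proof -
        from y obtain w where "w \<in> ?G" "y = h w" by (rule imageE)
        then have w: "w \<in> carrier ?W" "y = h w" using subsetD[OF G(1)] by simp_all
        have "h (?m (k \<odot> \<one>) 0) \<otimes>\<^bsub>?E\<^esub> h w = h w \<otimes>\<^bsub>?E\<^esub> h (?m (k \<odot> \<one>) 0)"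
          using ring_hom_mult[OF h zD(1) w(1)] ring_hom_mult[OF h w(1) zD(1)] zD(2)[OF w(1)] by metis
        then show ?thesis by (simp add: g_def w(2))
      qed
    qed
    then show ?thesis using k by (simp add: centralizer_def)
  qed
  note rep = mu.matrix_rep_corner[OF alg gh gS sc]
  let ?Q = "{r \<in> carrier R. g r = \<zero>\<^bsub>?E\<^esub>}"
  have Q1: "ideal ?Q R" using g.kernel_is_ideal unfolding a_kernel_def' .
  have Q2: "P \<subseteq> ?Q"
  proof
    fix r assume r: "r \<in> P"
    show "r \<in> ?Q" using gP[OF r] P.Icarr[OF r] by simp
  qed
  have Q3: "a \<notin> ?Q" using ga by simp
  have Q4: "multilin R {..<d * d} (standard_coeff R) r \<in> ?Q" if r: "\<forall>i<d * d. r i \<in> carrier R" for r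
  proof -
    have sR: "standard_coeff R w \<in> carrier R" for w by (simp add: standard_coeff_def)
    have "g (multilin R {..<d * d} (standard_coeff R) r) = multilin ?E {..<d * d} (\<lambda>w. g (standard_coeff R w)) (\<lambda>i. g (r i))"
      using r sR by (intro g.hom_multilin) auto
    also have "(\<lambda>w. g (standard_coeff R w)) = standard_coeff ?E" by (auto simp: standard_coeff_def)
    \<comment> \<open>\<open>n < d\<close> gives \<open>n * n < d * d\<close>, so one degree serves
      all sizes below \<open>d\<close>.\<close>
    also have "multilin ?E {..<d * d} (standard_coeff ?E) (\<lambda>i. g (r i)) = \<zero>\<^bsub>?E\<^esub>"
      using n r gS by (intro mu.standard_identity) (auto intro: mult_strict_mono')
    finally have "g (multilin R {..<d * d} (standard_coeff R) r) = \<zero>\<^bsub>?E\<^esub>" .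
    moreover have "multilin R {..<d * d} (standard_coeff R) r \<in> carrier R"
      using r sR by (intro multilin_closed) simp_all
    ultimately show ?thesis by simp
  qed
  show ?thesis
    by (rule exI[of _ ?Q], rule exI[of _ n], rule exI[of _ mu.corner],
      rule exI[of _ "\<lambda>c. g (c \<odot> \<one>) \<otimes>\<^bsub>?E\<^esub> T 0 0"],
      rule exI[of _ "\<lambda>r i j. T 0 i \<otimes>\<^bsub>?E\<^esub> g r \<otimes>\<^bsub>?E\<^esub> T j 0"])
      (intro conjI allI impI Q1 Q2 Q3 Q4 n rep(1) rep(2)[symmetric]; simp)
qed

section \<open>Closed ideals and their finitely many prime components\<close>

definition closed_ideal :: "('a, 'b) ring_scheme \<Rightarrow> 'a set set \<Rightarrow> 'a set \<Rightarrow> bool" where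
  "closed_ideal R Y J \<longleftrightarrow> (\<exists>Z\<subseteq>Y. J = {r \<in> carrier R. \<forall>Q\<in>Z. r \<in> Q})"

text \<open>The analogue, for intersections of members of \<open>Y\<close>, of the finiteness of
  minimal primes in a Noetherian ring. By \<open>noeth\<close> ascending chains of closed ideals
  stop, which permits induction from large ideals to small ones: a proper closed ideal that is not
  prime is replaced by two strictly larger ones.\<close>

lemma finite_prime_components:
  fixes R (structure)
  assumes R: "ring R" and Y: "\<And>Q. Q \<in> Y \<Longrightarrow> ideal Q R"
    and noeth: "\<And>I. I \<subseteq> carrier R \<Longrightarrow> \<exists>F\<subseteq>I. finite F \<and> (\<forall>Q\<in>Y. F \<subseteq> Q \<longrightarrow> I \<subseteq> Q)"
  shows "\<exists>C. finite C \<and> (\<forall>N\<in>C. nc_prime_ideal R N \<and> closed_ideal R Y N) \<and>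
    (\<forall>P. nc_prime_ideal R P \<and> closed_ideal R Y P \<longrightarrow> (\<exists>N\<in>C. N \<subseteq> P))"
proof -
  interpret ring R by fact
  let ?cl = "\<lambda>Z. {r \<in> carrier R. \<forall>Q\<in>Z. r \<in> Q}"
  have clI: "closed_ideal R Y (?cl Z)" if "Z \<subseteq> Y" for Z using that by (auto simp: closed_ideal_def)
  have closed_carrier: "J \<subseteq> carrier R" if "closed_ideal R Y J" for J using that by (auto simp: closed_ideal_def)
  have cl_ideal: "ideal (?cl Z) R" if "Z \<subseteq> Y" for Z
  proof -
    have "?cl Z = \<Inter>(insert (carrier R) Z)" by auto
    moreover have "ideal (\<Inter>(insert (carrier R) Z)) R" using that Y oneideal by (intro i_Intersect) auto
    ultimately show ?thesis by simp
  qed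
  \<comment> \<open>Along an ascending chain, the finite set \<open>F\<close> for the union already
    lies in some \<open>f m\<close>. The members of \<open>Y\<close> whose intersection is
    \<open>f m\<close> then contain the whole union, so the chain stops at \<open>m\<close>.\<close>
  have "wf {(J, I). closed_ideal R Y I \<and> closed_ideal R Y J \<and> I \<subset> J}"
    unfolding wf_iff_no_infinite_down_chain
  proof
    assume "\<exists>f. \<forall>i. (f (Suc i), f i) \<in> {(J, I). closed_ideal R Y I \<and> closed_ideal R Y J \<and> I \<subset> J}"
    then obtain f where "\<forall>i. (f (Suc i), f i) \<in> {(J, I). closed_ideal R Y I \<and> closed_ideal R Y J \<and> I \<subset> J}"
      by (rule exE)
    then have f: "closed_ideal R Y (f i)" "f i \<subset> f (Suc i)" for i by simp_all
    have mono: "f i \<subseteq> f j" if "i \<le> j" for i j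
      by (rule lift_Suc_mono_le[of f, OF _ that]) (rule psubset_imp_subset[OF f(2)])
    let ?U = "\<Union>i. f i"
    have "?U \<subseteq> carrier R" using f(1) closed_carrier by blast
    then obtain F where F: "F \<subseteq> ?U" "finite F" "\<forall>Q\<in>Y. F \<subseteq> Q \<longrightarrow> ?U \<subseteq> Q" using noeth by metis
    have "\<exists>m. F \<subseteq> f m" using F(2,1)
    proof (induction F)
      case (insert x F)
      then obtain m k where "F \<subseteq> f m" "x \<in> f k" by auto
      then have "insert x F \<subseteq> f (max m k)" using mono[of m "max m k"] mono[of k "max m k"] by auto
      then show ?case by blast
    qed auto
    then obtain m where m: "F \<subseteq> f m" by blast
    obtain Z where Z: "Z \<subseteq> Y" "f m = ?cl Z" using f(1)[of m] by (auto simp: closed_ideal_def)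
    have "?U \<subseteq> Q" if Q: "Q \<in> Z" for Q
    proof -
      have "F \<subseteq> Q" using m Z(2) Q by blast
      then show ?thesis using F(3) Z(1) Q by blast
    qed
    then have "f (Suc m) \<subseteq> f m" using Z(2) closed_carrier[OF f(1)[of "Suc m"]] by blast
    then show False using f(2)[of m] by blast
  qed
  note wf = this
  \<comment> \<open>The family is neither asked to be minimal nor to lie above \<open>I\<close>, so
    the families for two larger ideals can simply be united.\<close>
  define comps where "comps = (\<lambda>I C. finite C \<and> (\<forall>N\<in>C. nc_prime_ideal R N \<and> closed_ideal R Y N) \<and>
    (\<forall>P. nc_prime_ideal R P \<longrightarrow> closed_ideal R Y P \<longrightarrow> I \<subseteq> P \<longrightarrow> (\<exists>N\<in>C. N \<subseteq> P)))"
  have compsI: "comps I C" if "finite C" "\<And>N. N \<in> C \<Longrightarrow> nc_prime_ideal R N \<and> closed_ideal R Y N"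
    "\<And>P. nc_prime_ideal R P \<Longrightarrow> closed_ideal R Y P \<Longrightarrow> I \<subseteq> P \<Longrightarrow> \<exists>N\<in>C. N \<subseteq> P" for I C
    using that by (simp add: comps_def)
  have compsD: "finite C" "N \<in> C \<Longrightarrow> nc_prime_ideal R N \<and> closed_ideal R Y N"
    "nc_prime_ideal R P \<Longrightarrow> closed_ideal R Y P \<Longrightarrow> I \<subseteq> P \<Longrightarrow> \<exists>N\<in>C. N \<subseteq> P" if "comps I C" for I C N P
    using that by (simp_all add: comps_def)
  have "closed_ideal R Y I \<longrightarrow> (\<exists>C. comps I C)" for I
  proof (induction I rule: wf_induct_rule[OF wf])
    case (1 I)
    show ?case
    proof
      assume I: "closed_ideal R Y I"
      then obtain Z where Z: "Z \<subseteq> Y" "I = ?cl Z" by (auto simp: closed_ideal_def)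
      have idl: "ideal I R" using cl_ideal Z by simp
      consider "I = carrier R" | "nc_prime_ideal R I" |
        J1 J2 where "ideal J1 R" "ideal J2 R" "J1 \<cdot> J2 \<subseteq> I" "\<not> J1 \<subseteq> I" "\<not> J2 \<subseteq> I"
        using idl unfolding nc_prime_ideal_def by blast
      then show "\<exists>C. comps I C"
      proof cases
        case 1
        have "\<not> I \<subseteq> P" if P: "nc_prime_ideal R P" for P
        proof -
          interpret P: ideal P R using P by (simp add: nc_prime_ideal_def)
          show ?thesis using P 1 P.a_subset by (auto simp: nc_prime_ideal_def)
        qed
        then have "comps I {}" by (intro compsI) simp_all
        then show ?thesis by blast
      next
        case 2
        then have "comps I {I}" using I by (intro compsI) simp_all
        then show ?thesis by blast
      next
        case 3
        \<comment> \<open>The closed hull of \<open>I + J\<close>: strictly above \<open>I\<close>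
          when the ideal \<open>J\<close> is not inside \<open>I\<close>, yet inside every closed
          ideal containing both.\<close>
        define I' where "I' = (\<lambda>J. ?cl {Q \<in> Y. I \<subseteq> Q \<and> J \<subseteq> Q})"
        have I': "closed_ideal R Y (I' J)" "I \<subseteq> I' J" for J
        proof -
          show "closed_ideal R Y (I' J)" unfolding I'_def by (rule clI) blast
          show "I \<subseteq> I' J" using closed_carrier[OF I] unfolding I'_def by blast
        qed
        have I'P: "I' J \<subseteq> P" if P: "closed_ideal R Y P" "I \<subseteq> P" "J \<subseteq> P" for J P
        proof -
          obtain T where T: "T \<subseteq> Y" "P = ?cl T" using P(1) by (auto simp: closed_ideal_def)
          have "I' J \<subseteq> Q" if Q: "Q \<in> T" for Q
          proof -
            have "P \<subseteq> Q" using T(2) Q by blast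
            then have "Q \<in> {Q \<in> Y. I \<subseteq> Q \<and> J \<subseteq> Q}" using P T(1) Q by blast
            then show ?thesis unfolding I'_def by blast
          qed
          moreover have "I' J \<subseteq> carrier R" by (auto simp: I'_def)
          ultimately show ?thesis using T(2) by blast
        qed
        have ex: "\<exists>C. comps (I' J) C" if J: "ideal J R" "\<not> J \<subseteq> I" for J
        proof -
          interpret J: ideal J R by fact
          have "J \<subseteq> I' J" using J.a_subset by (auto simp: I'_def)
          then have "I \<subset> I' J" using I'(2)[of J] J(2) by blast
          then have "(I' J, I) \<in> {(J, I). closed_ideal R Y I \<and> closed_ideal R Y J \<and> I \<subset> J}"
            using I I'(1) by simp
          from "1.IH"[OF this] show ?thesis using I'(1) by (rule mp)
        qed
        obtain C1 where C1: "comps (I' J1) C1" using ex[OF 3(1,4)] by (rule exE)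
        obtain C2 where C2: "comps (I' J2) C2" using ex[OF 3(2,5)] by (rule exE)
        have "comps I (C1 \<union> C2)"
        proof (rule compsI)
          show "finite (C1 \<union> C2)" using compsD(1)[OF C1] compsD(1)[OF C2] by simp
          show "nc_prime_ideal R N \<and> closed_ideal R Y N" if "N \<in> C1 \<union> C2" for N
            using that compsD(2)[OF C1] compsD(2)[OF C2] by (rule UnE)
          fix P assume P: "nc_prime_ideal R P" "closed_ideal R Y P" "I \<subseteq> P"
          have "J1 \<cdot> J2 \<subseteq> P" using 3(3) P(3) by blast
          then have "J1 \<subseteq> P \<or> J2 \<subseteq> P" using P(1) 3(1,2) unfolding nc_prime_ideal_def by blast
          then show "\<exists>N\<in>C1 \<union> C2. N \<subseteq> P"
          proof
            assume "J1 \<subseteq> P"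
            from compsD(3)[OF C1 P(1,2) I'P[OF P(2,3) this]] show ?thesis by blast
          next
            assume "J2 \<subseteq> P"
            from compsD(3)[OF C2 P(1,2) I'P[OF P(2,3) this]] show ?thesis by blast
          qed
        qed
        then show ?thesis by blast
      qed
    qed
  qed
  from mp[OF this clI[OF subset_refl]] obtain C where C: "comps (?cl Y) C" by (rule exE)
  have "?cl Y \<subseteq> P" if "closed_ideal R Y P" for P using that by (auto simp: closed_ideal_def)
  then have "\<exists>N\<in>C. N \<subseteq> P" if "nc_prime_ideal R P" "closed_ideal R Y P" for P
    using compsD(3)[OF C that] that by blast
  then show ?thesis using compsD(1,2)[OF C] by (intro exI[of _ C]) blast
qed

section \<open>Height one primes\<close>

theorem proposition1p26:
  fixes K :: "('k, 'c) ring_scheme" and R :: "('k, 'a, 'b) module_scheme"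
  assumes "assoc_algebra K R"
    and "affine_algebra K R"
    and "almost_PI K R"
  shows "countable {P. nc_prime_ideal R P \<and> prime_height R P = 1}"
proof -
  interpret assoc_algebra K R by fact
  \<comment> \<open>The type of \<open>L\<close> is fixed to the one delivered by
    \<open>matrix_rep_separating\<close>, so that representations can be quantified over.\<close>
  define rep where "rep = (\<lambda>n Q L \<kappa> \<rho>. matrix_rep K R n (L :: ((nat \<Rightarrow> 'a) set \<Rightarrow> (nat \<Rightarrow> 'a) set) ring) \<kappa> \<rho> \<and>
    Q = matrix_kernel R n L \<rho>)"
  \<comment> \<open>The standard identity of degree \<open>d * d\<close> is built into membership
    because it passes to intersections, where it will exclude the zero ideal.\<close>
  define Y where "Y = (\<lambda>d. {Q. ideal Q R \<and> (\<exists>n<d. \<exists>L \<kappa> \<rho>. rep n Q L \<kappa> \<rho>) \<and>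
    (\<forall>r. (\<forall>i<d * d. r i \<in> carrier R) \<longrightarrow> multilin R {..<d * d} (standard_coeff R) r \<in> Q)})"
  have noeth: "\<exists>F\<subseteq>I. finite F \<and> (\<forall>Q\<in>Y d. F \<subseteq> Q \<longrightarrow> I \<subseteq> Q)" if I: "I \<subseteq> carrier R" for d I
  proof -
    have "\<exists>F\<subseteq>I. finite F \<and> (\<forall>Q. (\<exists>L \<kappa> \<rho>. rep n Q L \<kappa> \<rho>) \<longrightarrow> F \<subseteq> Q \<longrightarrow> I \<subseteq> Q)" for n
    proof -
      let ?Z = "{Q. \<exists>L \<kappa> \<rho>. rep n Q L \<kappa> \<rho>}"
      \<comment> \<open>Kernels serve as indices of the family: one representation is chosen for
        each kernel, and the finiteness obtained then speaks of the kernels themselves.\<close>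
      define t where "t = (\<lambda>Q. SOME t. rep n Q (fst t) (fst (snd t)) (snd (snd t)))"
      have r: "rep n Q (fst (t Q)) (fst (snd (t Q))) (snd (snd (t Q)))" if "Q \<in> ?Z" for Q
      proof -
        from that obtain L \<kappa> \<rho> where "rep n Q L \<kappa> \<rho>" by blast
        then show ?thesis
          unfolding t_def by (intro someI_ex[of "\<lambda>t. rep n Q (fst t) (fst (snd t)) (snd (snd t))"]
              exI[of _ "(L, \<kappa>, \<rho>)"]) simp
      qed
      let ?ker = "\<lambda>Q. matrix_kernel R n (fst (t Q)) (snd (snd (t Q)))"
      have "\<exists>F\<subseteq>I. finite F \<and> (\<forall>Q\<in>?Z. F \<subseteq> ?ker Q \<longrightarrow> I \<subseteq> ?ker Q)"
        by (rule matrix_kernels_noetherian[OF assms(1,2) _ I, where \<kappa> = "\<lambda>Q. fst (snd (t Q))"])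
          (use r in \<open>simp add: rep_def\<close>)
      moreover have "?ker Q = Q" if "Q \<in> ?Z" for Q using r[OF that] by (simp add: rep_def)
      ultimately show ?thesis by auto
    qed
    then obtain F where F: "\<And>n. F n \<subseteq> I" "\<And>n. finite (F n)"
      "\<And>n Q. (\<exists>L \<kappa> \<rho>. rep n Q L \<kappa> \<rho>) \<Longrightarrow> F n \<subseteq> Q \<Longrightarrow> I \<subseteq> Q" by metis
    show ?thesis
    proof (intro exI[of _ "\<Union>n<d. F n"] conjI ballI impI)
      show "(\<Union>n<d. F n) \<subseteq> I" using F(1) by blast
      show "finite (\<Union>n<d. F n)" using F(2) by simp
      fix Q assume "Q \<in> Y d" "(\<Union>n<d. F n) \<subseteq> Q"
      then obtain n where "n < d" "\<exists>L \<kappa> \<rho>. rep n Q L \<kappa> \<rho>" "F n \<subseteq> Q" by (auto simp: Y_def)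
      then show "I \<subseteq> Q" using F(3) by blast
    qed
  qed
  have "\<exists>C. finite C \<and> (\<forall>N\<in>C. nc_prime_ideal R N \<and> closed_ideal R (Y d) N) \<and>
    (\<forall>P. nc_prime_ideal R P \<and> closed_ideal R (Y d) P \<longrightarrow> (\<exists>N\<in>C. N \<subseteq> P))" for d
    by (rule finite_prime_components[OF ring_axioms _ noeth]) (simp add: Y_def)
  then obtain C where C: "\<And>d. finite (C d)" "\<And>d N. N \<in> C d \<Longrightarrow> nc_prime_ideal R N \<and> closed_ideal R (Y d) N"
    "\<And>d P. nc_prime_ideal R P \<Longrightarrow> closed_ideal R (Y d) P \<Longrightarrow> \<exists>N\<in>C d. N \<subseteq> P" by metis
  have nonzero: "N \<noteq> {\<zero>\<^bsub>R\<^esub>}" if N: "N \<in> C d" for N d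
  proof
    assume N0: "N = {\<zero>\<^bsub>R\<^esub>}"
    obtain Z where Z: "Z \<subseteq> Y d" "N = {r \<in> carrier R. \<forall>Q\<in>Z. r \<in> Q}"
      using C(2)[OF N] by (auto simp: closed_ideal_def)
    let ?A = "permutations_of_set {..<d * d}"
    have "PI_algebra K R"
    proof (rule PI_algebraI[of ?A "[0..<d * d]" "standard_coeff K"])
      show "[0..<d * d] \<in> ?A" by (auto simp: permutations_of_set_def)
      have K1: "\<one>\<^bsub>K\<^esub> \<in> carrier K" "\<ominus>\<^bsub>K\<^esub> \<one>\<^bsub>K\<^esub> \<in> carrier K" by simp_all
      then show "standard_coeff K w \<in> carrier K" for w by (simp add: standard_coeff_def)
      have "\<ominus>\<^bsub>K\<^esub> \<one>\<^bsub>K\<^esub> \<noteq> \<zero>\<^bsub>K\<^esub>"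
      proof
        assume "\<ominus>\<^bsub>K\<^esub> \<one>\<^bsub>K\<^esub> = \<zero>\<^bsub>K\<^esub>"
        then have "\<zero>\<^bsub>K\<^esub> \<oplus>\<^bsub>K\<^esub> \<one>\<^bsub>K\<^esub> = \<zero>\<^bsub>K\<^esub>"
          using abelian_group.l_neg[OF ring.is_abelian_group[OF K.is_ring] K1(1)] by simp
        then show False using K.one_not_zero K1(1) by simp
      qed
      then show "standard_coeff K [0..<d * d] \<noteq> \<zero>\<^bsub>K\<^esub>" using K.one_not_zero by (simp add: standard_coeff_def)
      fix r assume r: "\<And>i::nat. r i \<in> carrier R"
      have "standard_coeff K w \<odot>\<^bsub>R\<^esub> \<one>\<^bsub>R\<^esub> = standard_coeff R w" for w
        by (simp add: standard_coeff_def smult_l_minus)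
      then have "(\<Oplus>\<^bsub>R\<^esub>w\<in>?A. (standard_coeff K w \<odot>\<^bsub>R\<^esub> \<one>\<^bsub>R\<^esub>) \<otimes>\<^bsub>R\<^esub> word_eval R r w) = multilin R {..<d * d} (standard_coeff R) r"
        by (simp add: multilin_def)
      also have "\<dots> \<in> N"
        unfolding Z(2)
      proof (intro CollectI conjI ballI)
        show "multilin R {..<d * d} (standard_coeff R) r \<in> carrier R"
          using r by (intro multilin_closed) (simp_all add: standard_coeff_def)
        show "multilin R {..<d * d} (standard_coeff R) r \<in> Q" if "Q \<in> Z" for Q
          using that Z(1) r by (auto simp: Y_def)
      qed
      finally show "(\<Oplus>\<^bsub>R\<^esub>w\<in>?A. (standard_coeff K w \<odot>\<^bsub>R\<^esub> \<one>\<^bsub>R\<^esub>) \<otimes>\<^bsub>R\<^esub> word_eval R r w) = \<zero>\<^bsub>R\<^esub>" using N0 by simp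
    qed simp
    then show False using assms(3) by (simp add: almost_PI_def)
  qed
  have "{P. nc_prime_ideal R P \<and> prime_height R P = 1} \<subseteq> (\<Union>d. C d)"
  proof
    fix P assume "P \<in> {P. nc_prime_ideal R P \<and> prime_height R P = 1}"
    then have P: "nc_prime_ideal R P" and ht: "prime_height R P = 1" by auto
    have idl: "ideal P R" using P by (simp add: nc_prime_ideal_def)
    interpret P: ideal P R by fact
    have "P \<noteq> {\<zero>\<^bsub>R\<^esub>}"
    proof
      assume P0: "P = {\<zero>\<^bsub>R\<^esub>}"
      \<comment> \<open>No ideal lies strictly inside zero, so chains starting there have length 0
        and the height is not 1.\<close>
      have "enat n \<le> 0" if "descending_prime_chain R P n Q" for n Q
      proof (cases n)
        case (Suc m)
        then have "Q 1 \<subset> P" "nc_prime_ideal R (Q 1)"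
          using that by (auto simp: descending_prime_chain_def)
        then have "ideal (Q 1) R" "Q 1 \<subset> {\<zero>\<^bsub>R\<^esub>}" using P0 by (auto simp: nc_prime_ideal_def)
        then have "\<zero>\<^bsub>R\<^esub> \<in> Q 1" by (intro additive_subgroup.zero_closed ideal.axioms(1))
        then show ?thesis using \<open>Q 1 \<subset> {\<zero>\<^bsub>R\<^esub>}\<close> by blast
      qed (simp add: zero_enat_def)
      then have "prime_height R P \<le> 0" unfolding prime_height_def by (intro Sup_least) auto
      then show False using ht by simp
    qed
    then have "PI_algebra K (alg_quot R P)" using assms(3) idl by (simp add: almost_PI_def)
    then obtain d c where id: "multilin_identity K R P d c" "c [0..<d] \<noteq> \<zero>\<^bsub>K\<^esub>"
      using PI_quotient_multilin_identity[OF idl] by blast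
    \<comment> \<open>Every \<open>a\<close> outside \<open>P\<close> is excluded by some member of
      \<open>Y d\<close> above \<open>P\<close>; so \<open>P\<close> is closed, although it need not
      be a kernel itself.\<close>
    have "P = {r \<in> carrier R. \<forall>Q\<in>{Q \<in> Y d. P \<subseteq> Q}. r \<in> Q}"
    proof (intro equalityI subsetI)
      fix a assume a: "a \<in> {r \<in> carrier R. \<forall>Q\<in>{Q \<in> Y d. P \<subseteq> Q}. r \<in> Q}"
      show "a \<in> P"
      proof (rule ccontr)
        assume "a \<notin> P"
        then obtain Q n and L :: "((nat \<Rightarrow> 'a) set \<Rightarrow> (nat \<Rightarrow> 'a) set) ring" and \<kappa> \<rho> where
          Q: "ideal Q R" "P \<subseteq> Q" "a \<notin> Q" "n < d" "matrix_rep K R n L \<kappa> \<rho>" "Q = matrix_kernel R n L \<rho>"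
            "\<forall>r. (\<forall>i<d * d. r i \<in> carrier R) \<longrightarrow> multilin R {..<d * d} (standard_coeff R) r \<in> Q"
          using matrix_rep_separating[OF assms(1) P id, of a] a by auto
        have "rep n Q L \<kappa> \<rho>" using Q(5,6) by (simp add: rep_def)
        then have "Q \<in> Y d" using Q(1,4,7) by (auto simp: Y_def)
        then show False using a Q(2,3) by blast
      qed
    qed auto
    then have "closed_ideal R (Y d) P" unfolding closed_ideal_def by (intro exI[of _ "{Q \<in> Y d. P \<subseteq> Q}"]) blast
    then obtain N where N: "N \<in> C d" "N \<subseteq> P" using C(3)[OF P] by blast
    have "N = P"
    proof (rule ccontr)
      assume "N \<noteq> P"
      have NP: "nc_prime_ideal R N" using C(2)[OF N(1)] by simp
      then have "\<zero>\<^bsub>R\<^esub> \<in> N" unfolding nc_prime_ideal_def by (intro additive_subgroup.zero_closed ideal.axioms(1)) simp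
      then have "{\<zero>\<^bsub>R\<^esub>} \<subset> N" using nonzero[OF N(1)] by blast
      \<comment> \<open>\<open>P\<close>, \<open>N\<close>, \<open>0\<close> would be a strictly
        descending chain of primes of length 2.\<close>
      define Q where "Q = (\<lambda>i::nat. if i = 0 then P else if i = 1 then N else {\<zero>\<^bsub>R\<^esub>})"
      have "descending_prime_chain R P 2 Q"
        unfolding descending_prime_chain_def
        using P NP almost_PI_zero_prime[OF assms(3)] \<open>{\<zero>\<^bsub>R\<^esub>} \<subset> N\<close> N(2) \<open>N \<noteq> P\<close>
        by (auto simp: Q_def numeral_2_eq_2 less_Suc_eq)
      then have "enat 2 \<le> prime_height R P" unfolding prime_height_def by (intro Sup_upper) blast
      then show False using ht by (simp add: one_enat_def)
    qed
    then show "P \<in> (\<Union>d. C d)" using N(1) by blast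
  qed
  moreover have "countable (\<Union>d. C d)" using C(1) by (intro countable_UN) (simp_all add: countable_finite)
  ultimately show ?thesis by (rule countable_subset)
qed

end
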